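(* Let $g=-dt^2+a^2(t)\,dy^2$ on $M=(0,\infty)\times\mathbb R^3$, where $a>0$ is smooth on $(0,\infty)$. Let $t_1>t_0>0$, $M_0=(t_0,\infty)\times\mathbb R^3$, $\Sigma=\{(t,y)\in M: t=t_0\}$, let $\mathcal U_1\subset\mathbb R^3$ be open and bounded, and set $\mathcal U=\{t_1\}\times\mathcal U_1$. Let $g_\epsilon\in C^2(M;\mathrm{Sym}^2)$, $\epsilon\in[0,1]$, be a one parameter family of Lorentzian metrics with $g_0=g$ such that the map $\epsilon\mapsto g_\epsilon$ is differentiable from $[0,1]$ to $C^2_b(M_0;\mathrm{Sym}^2)$, and such that $g_\epsilon=g$ in $\mathcal U\cup\Sigma$ and in $M\setminus M_0$. Define $$f(t,x')=\begin{cases}\partial_\epsilon g_\epsilon(t,x')|_{\epsilon=0},& t\in(t_0,t_1),\\ 0,&\text{otherwise.}\end{cases}$$ Then on $\mathcal U_1\times S^2$, $$\partial_\epsilon R_\epsilon|_{\epsilon=0}=\frac{1}{2a(t_0)}\,L_{t_1}\,a^2\,\mathcal L_{a\partial_t}\,a^{-2}f,$$ where $\mathcal L_{a\partial_t}$ is the Lie derivative along the vector field $a\,\partial_t$, and $a^2$, $a^{-2}$ act as multiplication operators.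
   Context: $\mathrm{Sym}^2$ denotes symmetric covariant 2-tensors; $C^2_b(M_0;\mathrm{Sym}^2)$ is the Banach space of $C^2$ tensor fields on $M_0$ with all coordinate derivatives of order $\le 2$ bounded, with the sup norm of these. Lorentzian metrics have signature $(-,+,+,+)$. $S^2$ is the Euclidean unit sphere in $\mathbb R^3$, and $\theta(v)=-(1,a(t_1)^{-1}v)\in\mathbb R^{1+3}$ for $v\in S^2$. Redshift data: for small $\epsilon$ and $(y,v)\in\mathcal U_1\times S^2$, with $x=(t_1,y)$ and $\theta=\theta(v)$, $$R_\epsilon(y,v)=(\dot\gamma_\epsilon(\tau_\epsilon(x,\theta);x,\theta),\partial_t)_{g_\epsilon}-1,\qquad \tau_\epsilon(x,\theta)=\min\{\tau>0:\ \gamma_\epsilon(\tau;x,\theta)\in\Sigma\},$$ where $\gamma_\epsilon(\cdot;x,\theta)$ is the geodesic of $(M,g_\epsilon)$ with initial position $x$ and initial velocity $\theta$. Light ray transform of a symmetric 2-tensor field $h$: $L_{t_1}h(y,v)=\int (h_{lm}\circ\gamma)\dot\gamma^l\dot\gamma^m\,d\tau$, where $\gamma(\tau)=\gamma(\tau;(t_1,y),\theta(v))$ is the geodesic of $(M,g)$ with initial data $((t_1,y),\theta(v))$, integrated over its whole maximal parameter interval. We write $a(x)=a(t)$ for $x=(t,y)$. *)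

theory Defs
  imports "HOL-Analysis.Analysis"
begin

text \<open>
  Points of \<open>\<real>\<^sup>1\<^sup>+\<^sup>3\<close> are pairs \<open>(t, y)\<close>. A covariant 2-tensor field assigns to each point
  a function of two tangent vectors; its coordinate components \<open>h\<^sub>l\<^sub>m\<close> are its values
  \<open>h x l m\<close> at \<open>l, m \<in> Basis\<close>, where \<open>(1, 0) \<in> Basis\<close> is \<open>\<partial>\<^sub>t\<close>. Fields are total functions;
  only their values on the open set under consideration matter.
\<close>

type_synonym event = "real \<times> (real^3)"
type_synonym tensor2 = "event \<Rightarrow> event \<Rightarrow> event \<Rightarrow> real"

definition spacetime :: "event set" where
  "spacetime = {x. 0 < fst x}"

definition after :: "real \<Rightarrow> event set" where
  "after t0 = {x. t0 < fst x}"

definition time_slice :: "real \<Rightarrow> event set" where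
  "time_slice t0 = {x. fst x = t0}"

definition flrw :: "(real \<Rightarrow> real) \<Rightarrow> tensor2" where
  "flrw a x u w = - (fst u * fst w) + (a (fst x))\<^sup>2 * (snd u \<bullet> snd w)"

definition smooth_on_pos :: "(real \<Rightarrow> real) \<Rightarrow> bool" where
  "smooth_on_pos a \<longleftrightarrow> (\<forall>n. \<forall>t>0. (deriv ^^ n) a differentiable (at t))"


subsection \<open>Regularity of tensor fields\<close>

text \<open>\<open>pd u \<phi> x\<close> is the derivative of \<open>\<phi>\<close> at \<open>x\<close> in direction \<open>u\<close>; for \<open>u \<in> Basis\<close> it is a
  coordinate derivative.\<close>

definition pd :: "event \<Rightarrow> (event \<Rightarrow> real) \<Rightarrow> event \<Rightarrow> real" where
  "pd u \<phi> x = frechet_derivative \<phi> (at x) u"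

definition C1_on :: "event set \<Rightarrow> (event \<Rightarrow> real) \<Rightarrow> bool" where
  "C1_on S \<phi> \<longleftrightarrow> (\<forall>x\<in>S. \<phi> differentiable (at x)) \<and> (\<forall>i\<in>Basis. continuous_on S (pd i \<phi>))"

definition C2_on :: "event set \<Rightarrow> (event \<Rightarrow> real) \<Rightarrow> bool" where
  "C2_on S \<phi> \<longleftrightarrow> C1_on S \<phi> \<and> (\<forall>i\<in>Basis. C1_on S (pd i \<phi>))"

definition sym_bilinear :: "(event \<Rightarrow> event \<Rightarrow> real) \<Rightarrow> bool" where
  "sym_bilinear b \<longleftrightarrow> bilinear b \<and> (\<forall>u w. b u w = b w u)"

definition C2_sym2 :: "event set \<Rightarrow> tensor2 set" where
  "C2_sym2 S = {h. (\<forall>x\<in>S. sym_bilinear (h x)) \<and>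
                   (\<forall>l\<in>Basis. \<forall>m\<in>Basis. C2_on S (\<lambda>x. h x l m))}"

definition coord_derivs :: "event set \<Rightarrow> tensor2 \<Rightarrow> real set" where
  "coord_derivs S h = (\<Union>x\<in>S. \<Union>l\<in>Basis. \<Union>m\<in>Basis.
      {h x l m}
      \<union> (\<Union>i\<in>Basis. {pd i (\<lambda>z. h z l m) x})
      \<union> (\<Union>i\<in>Basis. \<Union>j\<in>Basis. {pd j (pd i (\<lambda>z. h z l m)) x}))"

definition C2b_sym2 :: "event set \<Rightarrow> tensor2 set" where
  "C2b_sym2 S = {h \<in> C2_sym2 S. bounded (coord_derivs S h)}"

definition C2b_norm :: "event set \<Rightarrow> tensor2 \<Rightarrow> real" where
  "C2b_norm S h = (SUP r\<in>coord_derivs S h. \<bar>r\<bar>)"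

definition C2b_differentiable_on :: "(real \<Rightarrow> tensor2) \<Rightarrow> event set \<Rightarrow> real set \<Rightarrow> bool" where
  "C2b_differentiable_on g S I \<longleftrightarrow>
     (\<forall>\<epsilon>\<in>I. g \<epsilon> \<in> C2b_sym2 S) \<and>
     (\<forall>\<epsilon>\<in>I. \<exists>d\<in>C2b_sym2 S.
        ((\<lambda>s. C2b_norm S (\<lambda>x u w. (g s x u w - g \<epsilon> x u w) / (s - \<epsilon>) - d x u w))
           \<longlongrightarrow> 0) (at \<epsilon> within I))"


subsection \<open>Lorentzian metrics and geodesics\<close>

definition lorentzian_on :: "event set \<Rightarrow> tensor2 \<Rightarrow> bool" where
  "lorentzian_on S g \<longleftrightarrow> (\<forall>x\<in>S. sym_bilinear (g x) \<and>
     (\<exists>A :: event \<Rightarrow> event. linear A \<and> bij A \<and>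
        (\<forall>u w. g x (A u) (A w) = - (fst u * fst w) + snd u \<bullet> snd w)))"

text \<open>Raising an index with a nondegenerate form \<open>b\<close>: the vector representing the covector \<open>\<alpha>\<close>.\<close>

definition sharp :: "(event \<Rightarrow> event \<Rightarrow> real) \<Rightarrow> (event \<Rightarrow> real) \<Rightarrow> event" where
  "sharp b \<alpha> = (THE c. \<forall>w. b c w = \<alpha> w)"

text \<open>\<open>christoffel g x u v\<close> is the vector \<open>\<Gamma>\<^sup>k\<^sub>i\<^sub>j(x) u\<^sup>i v\<^sup>j\<close>, where
  \<open>\<Gamma>\<^sup>k\<^sub>i\<^sub>j = g\<^sup>k\<^sup>l (\<partial>\<^sub>i g\<^sub>j\<^sub>l + \<partial>\<^sub>j g\<^sub>i\<^sub>l - \<partial>\<^sub>l g\<^sub>i\<^sub>j) / 2\<close>.\<close>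

definition christoffel :: "tensor2 \<Rightarrow> event \<Rightarrow> event \<Rightarrow> event \<Rightarrow> event" where
  "christoffel g x u v = sharp (g x)
     (\<lambda>w. (pd u (\<lambda>z. g z v w) x + pd v (\<lambda>z. g z u w) x - pd w (\<lambda>z. g z u v) x) / 2)"

definition geodesic_on ::
    "tensor2 \<Rightarrow> event \<Rightarrow> event \<Rightarrow> real set \<Rightarrow> (real \<Rightarrow> event) \<Rightarrow> bool" where
  "geodesic_on g x \<theta> J \<gamma> \<longleftrightarrow>
     open J \<and> is_interval J \<and> 0 \<in> J \<and> \<gamma> ` J \<subseteq> spacetime \<and>
     (\<exists>\<gamma>'. \<gamma> 0 = x \<and> \<gamma>' 0 = \<theta> \<and>
        (\<forall>\<tau>\<in>J. (\<gamma> has_vector_derivative \<gamma>' \<tau>) (at \<tau>) \<and>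
               (\<gamma>' has_vector_derivative - christoffel g (\<gamma> \<tau>) (\<gamma>' \<tau>) (\<gamma>' \<tau>)) (at \<tau>)))"

text \<open>The maximal geodesic in \<open>spacetime\<close>: the union of all solutions of the initial value
  problem, which agree on common intervals when the metric is \<open>C\<^sup>2\<close> and Lorentzian.\<close>

definition geod_dom :: "tensor2 \<Rightarrow> event \<Rightarrow> event \<Rightarrow> real set" where
  "geod_dom g x \<theta> = \<Union>{J. \<exists>\<gamma>. geodesic_on g x \<theta> J \<gamma>}"

definition geod :: "tensor2 \<Rightarrow> event \<Rightarrow> event \<Rightarrow> real \<Rightarrow> event" where
  "geod g x \<theta> \<tau> = (THE p. \<exists>J \<gamma>. geodesic_on g x \<theta> J \<gamma> \<and> \<tau> \<in> J \<and> p = \<gamma> \<tau>)"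

definition geod_vel :: "tensor2 \<Rightarrow> event \<Rightarrow> event \<Rightarrow> real \<Rightarrow> event" where
  "geod_vel g x \<theta> \<tau> = vector_derivative (geod g x \<theta>) (at \<tau>)"


subsection \<open>Redshift and light ray transform\<close>

definition ray_dir :: "(real \<Rightarrow> real) \<Rightarrow> real \<Rightarrow> real^3 \<Rightarrow> event" where
  "ray_dir a t1 v = - (1, inverse (a t1) *\<^sub>R v)"

definition hit_param :: "tensor2 \<Rightarrow> real \<Rightarrow> event \<Rightarrow> event \<Rightarrow> real" where
  "hit_param g t0 x \<theta> =
     (LEAST \<tau>. 0 < \<tau> \<and> \<tau> \<in> geod_dom g x \<theta> \<and> geod g x \<theta> \<tau> \<in> time_slice t0)"

definition redshift ::
    "(real \<Rightarrow> real) \<Rightarrow> real \<Rightarrow> real \<Rightarrow> tensor2 \<Rightarrow> real^3 \<Rightarrow> real^3 \<Rightarrow> real" where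
  "redshift a t0 t1 g y v =
     (let x = (t1, y); \<theta> = ray_dir a t1 v; \<tau> = hit_param g t0 x \<theta>
      in g (geod g x \<theta> \<tau>) (geod_vel g x \<theta> \<tau>) (1, 0) - 1)"

definition light_ray_transform ::
    "(real \<Rightarrow> real) \<Rightarrow> real \<Rightarrow> tensor2 \<Rightarrow> real^3 \<Rightarrow> real^3 \<Rightarrow> real" where
  "light_ray_transform a t1 h y v =
     (let g = flrw a; x = (t1, y); \<theta> = ray_dir a t1 v
      in LINT \<tau>:geod_dom g x \<theta>|lborel.
           h (geod g x \<theta> \<tau>) (geod_vel g x \<theta> \<tau>) (geod_vel g x \<theta> \<tau>))"

text \<open>In coordinates,
  \<open>(\<L>\<^sub>X h)\<^sub>l\<^sub>m = X\<^sup>k \<partial>\<^sub>k h\<^sub>l\<^sub>m + h\<^sub>k\<^sub>m \<partial>\<^sub>l X\<^sup>k + h\<^sub>l\<^sub>k \<partial>\<^sub>m X\<^sup>k\<close>.\<close>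

definition lie_deriv :: "(event \<Rightarrow> event) \<Rightarrow> tensor2 \<Rightarrow> tensor2" where
  "lie_deriv X h x u w =
     pd (X x) (\<lambda>z. h z u w) x
     + h x (frechet_derivative X (at x) u) w
     + h x u (frechet_derivative X (at x) w)"

definition a_dt :: "(real \<Rightarrow> real) \<Rightarrow> event \<Rightarrow> event" where
  "a_dt a x = (a (fst x), 0)"

definition scale_field :: "(event \<Rightarrow> real) \<Rightarrow> tensor2 \<Rightarrow> tensor2" where
  "scale_field \<phi> h x u w = \<phi> x * h x u w"

text \<open>The derivative at the endpoint \<open>\<epsilon> = 0\<close> of \<open>[0,1]\<close> is one-sided.\<close>

definition first_variation :: "(real \<Rightarrow> tensor2) \<Rightarrow> real \<Rightarrow> real \<Rightarrow> tensor2" where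
  "first_variation g t0 t1 x u w =
     (if t0 < fst x \<and> fst x < t1
      then vector_derivative (\<lambda>\<epsilon>. g \<epsilon> x u w) (at 0 within {0..1}) else 0)"

end

theory Submission
  imports Defs
begin

text \<open>
  The vector field \<open>X = a \<partial>\<^sub>t\<close> is conformal Killing for the background metric. Along a geodesic
  \<open>\<gamma>\<close> of \<open>g\<^sub>\<epsilon>\<close> with null initial velocity this gives
  \<open>(d/d\<tau>) g\<^sub>\<epsilon>(\<gamma>', X) = (1/2) (a\<^sup>2 \<L>\<^sub>X a\<^sup>-\<^sup>2 (g\<^sub>\<epsilon> - g))(\<gamma>', \<gamma>')\<close>.
  Integrating up to the hitting time of \<open>\<Sigma>\<close> expresses \<open>a(t\<^sub>0) (R\<^sub>\<epsilon> + 1) - a(t\<^sub>1)\<close> as an integral whose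
  integrand is \<open>O(\<epsilon>)\<close>. After division by \<open>\<epsilon>\<close> the limit follows by dominated convergence from the
  mere continuity of \<open>(\<gamma>\<^sub>\<epsilon>, \<gamma>\<^sub>\<epsilon>')\<close> in \<open>\<epsilon>\<close>; the geodesic flow need not be linearised.
\<close>

text \<open>The integrand is linear in \<open>g \<epsilon> - g\<close>, so its first order sees only
  the zeroth order of the ray. The rays are null for every \<epsilon> because
  \<open>g \<epsilon>\<close> equals \<open>g\<close> at their starting point. Three obstacles shape
  the rest. The endpoint \<open>hit \<epsilon>\<close> moves; its convergence is never proved.
  Instead the integrand is cut off at \<open>hit \<epsilon>\<close>, and the sign of
  \<open>t - t0\<close> along the converging rays decides on which side of the cut a parameter lies.
  Next, geodesics of \<open>g \<epsilon>\<close> are given only as the union of local solutions, so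
  existence up to a fixed parameter has to be part of the stability statement; it needs Lipschitz
  bounds and closeness for the geodesic field. These are obtained without an inverse metric: the
  Christoffel covector is estimated and nondegeneracy, made uniform by compactness, turns this into
  an estimate of the vector. Finally \<open>f\<close> may fail to be differentiable at
  \<open>t0\<close> and \<open>t1\<close>, so the Lie derivative is controlled only off these times,
  which the background ray meets at just two parameters.\<close>

subsection \<open>Ordinary differential equations\<close>

text \<open>The integral over a reversed interval is 0, so at most one term survives: this is the
  oriented integral from 0 to \<open>t\<close>. Both signs of \<open>t\<close> occur because
  geodesics live on open intervals around 0.\<close>

definition signed_integral :: "(real \<Rightarrow> 'a::euclidean_space) \<Rightarrow> real \<Rightarrow> 'a" where
  "signed_integral \<phi> t = integral {0..t} \<phi> - integral {t..0} \<phi>"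

lemma has_vector_derivative_signed_integral:
  assumes "continuous_on UNIV \<phi>"
  shows "(signed_integral \<phi> has_vector_derivative \<phi> t) (at t)"
proof -
  \<comment> \<open>A base point below both 0 and \<open>t\<close> makes the oriented integral, near
    \<open>t\<close>, an ordinary one minus a constant. The unit margins keep \<open>t\<close>
    interior to \<open>{c..d}\<close>.\<close>
  define c where "c = - \<bar>t\<bar> - 1"
  define d where "d = \<bar>t\<bar> + 1"
  have cd: "c < 0" "0 < d" "c < t" "t < d" by (auto simp: c_def d_def)
  have int: "\<phi> integrable_on {p..q}" for p q
    by (rule integrable_continuous_real[OF continuous_on_subset[OF assms]]) auto
  have eq: "signed_integral \<phi> u = integral {c..u} \<phi> - integral {c..0} \<phi>" if "u \<in> {c<..<d}" for u
  proof (cases "0 \<le> u")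
    case True
    have "integral {c..0} \<phi> + integral {0..u} \<phi> = integral {c..u} \<phi>"
      using cd True int by (intro Henstock_Kurzweil_Integration.integral_combine) auto
    moreover have "integral {u..0} \<phi> = 0"
      using True by (cases "u = 0") auto
    ultimately show ?thesis by (simp add: signed_integral_def algebra_simps)
  next
    case False
    have "integral {c..u} \<phi> + integral {u..0} \<phi> = integral {c..0} \<phi>"
      using that False int by (intro Henstock_Kurzweil_Integration.integral_combine) auto
    then show ?thesis using False by (simp add: signed_integral_def algebra_simps)
  qed
  have "((\<lambda>u. integral {c..u} \<phi>) has_vector_derivative \<phi> t) (at t within {c..d})"
    using cd by (intro integral_has_vector_derivative continuous_on_subset[OF assms]) auto
  then have "((\<lambda>u. integral {c..u} \<phi>) has_vector_derivative \<phi> t) (at t)"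
    using at_within_interior[of t "{c..d}"] cd by (simp add: interior_atLeastAtMost_real)
  then have "((\<lambda>u. integral {c..u} \<phi> - integral {c..0} \<phi>) has_vector_derivative \<phi> t) (at t)"
    by (auto intro!: derivative_eq_intros)
  then show ?thesis
    by (rule has_vector_derivative_transform_within_open[where S="{c<..<d}"]) (use cd eq in auto)
qed

text \<open>Integrating the weight \<open>exp (K * \<bar>s\<bar>)\<close> gains a factor
  \<open>1 / K\<close>, the source of the contraction below. The comparison function is an
  antiderivative of the bound on each side of 0; its value at 0 only helps and is dropped.\<close>

lemma norm_signed_integral_le:
  assumes cont: "continuous_on UNIV \<phi>" and K: "K > 0"
    and le: "\<And>s. norm (\<phi> s) \<le> C * exp (K * \<bar>s\<bar>)"
  shows "norm (signed_integral \<phi> t) \<le> C / K * exp (K * \<bar>t\<bar>)"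
proof -
  note der = has_vector_derivative_signed_integral[OF cont]
  have C: "C \<ge> 0" using order_trans[OF norm_ge_zero le[of 0]] by simp
  have cs: "continuous_on S (signed_integral \<phi>)" for S
    by (meson der continuous_at_imp_continuous_on has_vector_derivative_continuous)
  have zero: "signed_integral \<phi> 0 = 0" by (simp add: signed_integral_def)
  have CK: "C / K \<ge> 0" using C K by simp
  consider "t = 0" | "t > 0" | "t < 0" by linarith
  then show ?thesis
  proof cases
    case 1 then show ?thesis using CK by (simp add: zero)
  next
    case 2
    have "norm (signed_integral \<phi> t - signed_integral \<phi> 0)
        \<le> C / K * exp (K * t) - C / K * exp (K * 0)"
    proof (rule differentiable_bound_general[OF 2 cs _ der])
      show "((\<lambda>s. C / K * exp (K * s)) has_vector_derivative C * exp (K * s)) (at s)" for s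
        using K by (auto intro!: derivative_eq_intros simp flip: has_real_derivative_iff_has_vector_derivative)
      show "norm (\<phi> s) \<le> C * exp (K * s)" if "0 < s" for s using le[of s] that by simp
    qed (use K in \<open>auto intro!: continuous_intros\<close>)
    then show ?thesis using 2 CK by (simp add: zero)
  next
    case 3
    have "norm (signed_integral \<phi> 0 - signed_integral \<phi> t)
        \<le> - (C / K * exp (- K * 0)) - - (C / K * exp (- K * t))"
    proof (rule differentiable_bound_general[OF 3 cs _ der])
      show "((\<lambda>s. - (C / K * exp (- K * s))) has_vector_derivative C * exp (- K * s)) (at s)" for s
        using K by (auto intro!: derivative_eq_intros simp flip: has_real_derivative_iff_has_vector_derivative)
      show "norm (\<phi> s) \<le> C * exp (- K * s)" if "s < 0" for s using le[of s] that by simp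
    qed (use K in \<open>auto intro!: continuous_intros\<close>)
    then show ?thesis using 3 CK by (simp add: zero)
  qed
qed

lemma signed_integral_diff:
  assumes "continuous_on UNIV \<phi>" "continuous_on UNIV \<psi>"
  shows "signed_integral (\<lambda>s. \<phi> s - \<psi> s) t = signed_integral \<phi> t - signed_integral \<psi> t"
proof -
  have "\<phi> integrable_on {p..q}" "\<psi> integrable_on {p..q}" for p q
    using assms by (auto intro!: integrable_continuous_real intro: continuous_on_subset)
  then show ?thesis by (simp add: signed_integral_def Henstock_Kurzweil_Integration.integral_diff)
qed

text \<open>Picard iteration contracts in the sup norm with weight \<open>exp (- K \<bar>t\<bar>)\<close> once \<open>K = 2 L\<close>.\<close>

lemma global_flow_exists:
  fixes G :: "'a::euclidean_space \<Rightarrow> 'a"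
  assumes bd: "\<And>z. norm (G z) \<le> B" and lip: "\<And>z w. norm (G z - G w) \<le> L * norm (z - w)"
  shows "\<exists>w. w 0 = z0 \<and> (\<forall>t. (w has_vector_derivative G (w t)) (at t))"
proof -
  \<comment> \<open>\<open>M\<close> is a Lipschitz constant that is positive whatever the sign of
    \<open>L\<close>, so that \<open>K\<close> may be divided by.\<close>
  define M where "M = \<bar>L\<bar> + 1"
  define K where "K = 2 * M"
  have M: "M > 0" "K > 0" by (auto simp: M_def K_def)
  have lip': "norm (G z - G w) \<le> M * norm (z - w)" for z w
    using lip[of z w] mult_right_mono[of L M "norm (z - w)"] by (force simp: M_def)
  have contG: "continuous_on UNIV G"
    by (rule lipschitz_on_continuous_on[of M]) (use lip' M in \<open>auto simp: lipschitz_on_def dist_norm\<close>)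
  \<comment> \<open>The unknown is \<open>u = exp (- K * \<bar>t\<bar>) w\<close> instead of
    \<open>w\<close>: the weighted norm becomes the norm of the complete space of bounded continuous
    functions. \<open>P\<close> is the Picard map in this variable, with contraction factor
    \<open>M / K = 1 / 2\<close>.\<close>
  define \<phi> where "\<phi> u s = G (exp (K * \<bar>s\<bar>) *\<^sub>R apply_bcontfun u s)"
    for u :: "real \<Rightarrow>\<^sub>C 'a" and s
  have cont\<phi>: "continuous_on UNIV (\<phi> u)" for u
    unfolding \<phi>_def
    by (rule continuous_on_compose2[OF contG]) (auto intro!: continuous_intros)
  define P where "P u t = exp (- (K * \<bar>t\<bar>)) *\<^sub>R (z0 + signed_integral (\<phi> u) t)" for u t
  have B: "B \<ge> 0" using order_trans[OF norm_ge_zero bd] .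
  have sbd: "norm (signed_integral (\<phi> u) t) \<le> B / K * exp (K * \<bar>t\<bar>)" for u t
  proof (rule norm_signed_integral_le[OF cont\<phi> M(2)])
    fix s
    have "B * 1 \<le> B * exp (K * \<bar>s\<bar>)" using B M by (intro mult_left_mono) auto
    then show "norm (\<phi> u s) \<le> B * exp (K * \<bar>s\<bar>)" using order_trans[OF bd] by (simp add: \<phi>_def)
  qed
  have conts: "continuous_on UNIV (signed_integral (\<phi> u))" for u
    by (meson has_vector_derivative_signed_integral[OF cont\<phi>] continuous_at_imp_continuous_on has_vector_derivative_continuous)
  have PB: "P u \<in> bcontfun" for u
  proof (rule bcontfun_normI)
    show "continuous_on UNIV (P u)"
      unfolding P_def by (intro continuous_intros continuous_on_subset[OF conts]) auto
    fix t
    have "norm (P u t) = exp (- (K * \<bar>t\<bar>)) * norm (z0 + signed_integral (\<phi> u) t)" by (simp add: P_def)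
    also have "\<dots> \<le> exp (- (K * \<bar>t\<bar>)) * (norm z0 + B / K * exp (K * \<bar>t\<bar>))"
      using sbd[of u t] norm_triangle_ineq[of z0 "signed_integral (\<phi> u) t"] by (intro mult_left_mono) auto
    also have "\<dots> = exp (- (K * \<bar>t\<bar>)) * norm z0 + B / K"
      by (simp add: exp_minus field_simps)
    also have "\<dots> \<le> norm z0 + B / K"
      using M by (simp add: mult_left_le_one_le)
    finally show "norm (P u t) \<le> norm z0 + B / K" .
  qed
  define \<Phi> where "\<Phi> u = Bcontfun (P u)" for u
  have app: "apply_bcontfun (\<Phi> u) = P u" for u
    unfolding \<Phi>_def using PB by (simp add: Bcontfun_inverse)
  have "\<exists>!u. \<Phi> u = u"
  proof (rule banach_fix_type[of "1/2"])
    show "\<forall>u v. dist (\<Phi> u) (\<Phi> v) \<le> 1 / 2 * dist u v"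
    proof (intro allI dist_bound)
      fix u v t
      have "norm (signed_integral (\<lambda>s. \<phi> u s - \<phi> v s) t) \<le> (M * dist u v) / K * exp (K * \<bar>t\<bar>)"
      proof (rule norm_signed_integral_le[OF _ M(2)])
        show "continuous_on UNIV (\<lambda>s. \<phi> u s - \<phi> v s)" by (intro continuous_intros cont\<phi>)
        fix s
        have "norm (\<phi> u s - \<phi> v s) \<le> M * norm (exp (K * \<bar>s\<bar>) *\<^sub>R apply_bcontfun u s - exp (K * \<bar>s\<bar>) *\<^sub>R apply_bcontfun v s)"
          unfolding \<phi>_def by (rule lip')
        also have "\<dots> = M * (exp (K * \<bar>s\<bar>) * dist (apply_bcontfun u s) (apply_bcontfun v s))"
          by (simp add: dist_norm flip: scaleR_diff_right)
        also have "\<dots> \<le> M * (exp (K * \<bar>s\<bar>) * dist u v)"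
          using M dist_bounded[of u s v] by (intro mult_left_mono) auto
        finally show "norm (\<phi> u s - \<phi> v s) \<le> M * dist u v * exp (K * \<bar>s\<bar>)" by (simp add: mult_ac)
      qed
      then have *: "norm (signed_integral (\<phi> u) t - signed_integral (\<phi> v) t) \<le> dist u v / 2 * exp (K * \<bar>t\<bar>)"
        using M by (simp add: signed_integral_diff cont\<phi> K_def)
      have "dist (P u t) (P v t) = exp (- (K * \<bar>t\<bar>)) * norm (signed_integral (\<phi> u) t - signed_integral (\<phi> v) t)"
        unfolding P_def dist_norm scaleR_diff_right[symmetric] by simp
      also have "\<dots> \<le> exp (- (K * \<bar>t\<bar>)) * (dist u v / 2 * exp (K * \<bar>t\<bar>))"
        using * by (intro mult_left_mono) auto
      also have "\<dots> = 1 / 2 * dist u v" by (simp add: exp_minus field_simps)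
      finally show "dist (apply_bcontfun (\<Phi> u) t) (apply_bcontfun (\<Phi> v) t) \<le> 1 / 2 * dist u v"
        by (simp add: app)
    qed
  qed auto
  then obtain u where u: "\<Phi> u = u" by auto
  define w where "w t = z0 + signed_integral (\<phi> u) t" for t
  have wu: "exp (K * \<bar>t\<bar>) *\<^sub>R apply_bcontfun u t = w t" for t
  proof -
    have "apply_bcontfun u t = P u t" using app[of u] u by simp
    then show ?thesis by (simp add: P_def w_def exp_minus)
  qed
  have "(w has_vector_derivative G (w t)) (at t)" for t
  proof -
    have "((\<lambda>t. z0 + signed_integral (\<phi> u) t) has_vector_derivative (0 + \<phi> u t)) (at t)"
      by (intro derivative_intros has_vector_derivative_signed_integral[OF cont\<phi>])
    moreover have "(\<lambda>t. z0 + signed_integral (\<phi> u) t) = w" by (auto simp: w_def)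
    ultimately show ?thesis by (simp add: \<phi>_def wu)
  qed
  moreover have "w 0 = z0" by (simp add: w_def signed_integral_def)
  ultimately show ?thesis by blast
qed

text \<open>The function \<open>k s = exp (- c s) \<psi> s - d s\<close> is nonincreasing: its
  derivative is at most \<open>exp (- c s) d - d\<close>, which is nonpositive for
  \<open>c, d \<ge> 0\<close>.\<close>

lemma gronwall:
  fixes \<psi> :: "real \<Rightarrow> real"
  assumes der: "\<And>s. s \<in> {0..T} \<Longrightarrow> (\<psi> has_real_derivative \<psi>' s) (at s within {0..T})"
    and le: "\<And>s. s \<in> {0..T} \<Longrightarrow> \<psi>' s \<le> c * \<psi> s + d" and c: "c \<ge> 0" and d: "d \<ge> 0"
    and s: "s \<in> {0..T}"
  shows "\<psi> s \<le> exp (c * s) * (\<psi> 0 + d * s)"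
proof (cases "s = 0")
  case False
  then have s0: "0 < s" using s by simp
  define k where "k r = exp (- (c * r)) * \<psi> r - d * r" for r
  define k' where "k' r = exp (- (c * r)) * (\<psi>' r - c * \<psi> r) - d" for r
  have "(k has_derivative (\<lambda>h. h * k' r)) (at r within {0..s})" if "0 \<le> r" "r \<le> s" for r
  proof -
    have "(\<psi> has_real_derivative \<psi>' r) (at r within {0..s})"
      using s that by (intro DERIV_subset[OF der]) auto
    then have "(k has_real_derivative k' r) (at r within {0..s})"
      unfolding k_def k'_def by (auto intro!: derivative_eq_intros simp: algebra_simps)
    then show ?thesis by (simp add: has_field_derivative_def mult_commute_abs)
  qed
  from mvt_simple[OF s0 this] obtain r where r: "r \<in> {0<..<s}" "k s - k 0 = (s - 0) * k' r" by auto
  have "\<psi>' r - c * \<psi> r \<le> d" using le[of r] r s by auto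
  then have "exp (- (c * r)) * (\<psi>' r - c * \<psi> r) \<le> exp (- (c * r)) * d" by (intro mult_left_mono) auto
  also have "\<dots> \<le> d" using d c r by (simp add: mult_left_le_one_le)
  finally have "k' r \<le> 0" by (simp add: k'_def)
  then have "k s \<le> k 0" using r s0 by (smt (verit) mult_nonneg_nonpos)
  then have "exp (- (c * s)) * \<psi> s \<le> \<psi> 0 + d * s" by (simp add: k_def)
  then have "exp (c * s) * (exp (- (c * s)) * \<psi> s) \<le> exp (c * s) * (\<psi> 0 + d * s)"
    by (intro mult_left_mono) auto
  then show ?thesis by (simp flip: mult.assoc exp_add)
qed auto

text \<open>The squared distance is used because the norm is not differentiable at 0. With
  \<open>e = z1 - z2\<close>, Cauchy-Schwarz and
  \<open>2 |e| \<delta> \<le> |e|^2 + \<delta>^2\<close> give the rate \<open>2 L + 1\<close>.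
  Closeness of the two fields is asked only along \<open>z1\<close>.\<close>

lemma flow_dist_le:
  fixes z1 z2 :: "real \<Rightarrow> 'a::euclidean_space"
  assumes z1: "\<And>s. s \<in> {0..T} \<Longrightarrow> (z1 has_vector_derivative F (z1 s)) (at s within {0..T})"
    and z2: "\<And>s. s \<in> {0..T} \<Longrightarrow> (z2 has_vector_derivative G (z2 s)) (at s within {0..T})"
    and close: "\<And>s. s \<in> {0..T} \<Longrightarrow> norm (F (z1 s) - G (z1 s)) \<le> \<delta>"
    and lip: "\<And>s. s \<in> {0..T} \<Longrightarrow> norm (G (z1 s) - G (z2 s)) \<le> L * norm (z1 s - z2 s)"
    and L: "L \<ge> 0" and init: "z1 0 = z2 0" and s: "s \<in> {0..T}"
  shows "(norm (z1 s - z2 s))\<^sup>2 \<le> exp ((2 * L + 1) * s) * (\<delta>\<^sup>2 * s)"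
proof -
  define e where "e s = z1 s - z2 s" for s
  define \<psi> where "\<psi> s = e s \<bullet> e s" for s
  define \<psi>' where "\<psi>' s = 2 * (e s \<bullet> (F (z1 s) - G (z2 s)))" for s
  have "\<psi> s \<le> exp ((2 * L + 1) * s) * (\<psi> 0 + \<delta>\<^sup>2 * s)"
  proof (rule gronwall[where \<psi>'=\<psi>' and T=T])
    fix r assume r: "r \<in> {0..T}"
    have "(e has_vector_derivative (F (z1 r) - G (z2 r))) (at r within {0..T})"
      unfolding e_def by (intro derivative_intros z1 z2 r)
    then have "(\<psi> has_derivative (\<lambda>h. e r \<bullet> (h *\<^sub>R (F (z1 r) - G (z2 r))) + (h *\<^sub>R (F (z1 r) - G (z2 r))) \<bullet> e r)) (at r within {0..T})"
      unfolding \<psi>_def has_vector_derivative_def by (intro derivative_intros)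
    then show "(\<psi> has_real_derivative \<psi>' r) (at r within {0..T})"
      by (rule has_derivative_imp_has_field_derivative) (simp add: \<psi>'_def inner_commute algebra_simps)
    have "\<psi>' r = 2 * (e r \<bullet> (F (z1 r) - G (z1 r))) + 2 * (e r \<bullet> (G (z1 r) - G (z2 r)))"
      by (simp add: \<psi>'_def inner_diff_right)
    also have "\<dots> \<le> 2 * (norm (e r) * \<delta>) + 2 * (norm (e r) * (L * norm (e r)))"
    proof (intro add_mono mult_left_mono)
      show "e r \<bullet> (F (z1 r) - G (z1 r)) \<le> norm (e r) * \<delta>"
        using norm_cauchy_schwarz mult_left_mono[OF close[OF r], of "norm (e r)"] norm_ge_zero order_trans by blast
      show "e r \<bullet> (G (z1 r) - G (z2 r)) \<le> norm (e r) * (L * norm (e r))"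
        using norm_cauchy_schwarz mult_left_mono[OF lip[OF r], of "norm (e r)"] norm_ge_zero order_trans
        unfolding e_def by blast
    qed auto
    also have "\<dots> \<le> (2 * L + 1) * \<psi> r + \<delta>\<^sup>2"
      using sum_squares_bound[of "norm (e r)" \<delta>]
      by (simp add: \<psi>_def algebra_simps power2_eq_square flip: norm_eq_square power2_norm_eq_inner)
    finally show "\<psi>' r \<le> (2 * L + 1) * \<psi> r + \<delta>\<^sup>2" .
  qed (use s L in auto)
  moreover have "\<psi> 0 = 0" by (simp add: \<psi>_def e_def init)
  moreover have "\<psi> s = (norm (z1 s - z2 s))\<^sup>2" by (simp add: \<psi>_def e_def power2_norm_eq_inner)
  ultimately show ?thesis by simp
qed

subsection \<open>Tensor fields of class \<open>C\<^sup>1\<close>\<close>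

definition C1_sym2 :: "event set \<Rightarrow> tensor2 set" where
  "C1_sym2 S = {h. (\<forall>x\<in>S. sym_bilinear (h x)) \<and>
                   (\<forall>l\<in>Basis. \<forall>m\<in>Basis. C1_on S (\<lambda>x. h x l m))}"

lemma C2_sym2_imp_C1: "h \<in> C2_sym2 S \<Longrightarrow> h \<in> C1_sym2 S"
  by (auto simp: C2_sym2_def C1_sym2_def C2_on_def)

lemma open_spacetime: "open spacetime"
  unfolding spacetime_def by (intro open_Collect_less continuous_intros)

lemma open_after: "open (after t)"
  unfolding after_def by (intro open_Collect_less continuous_intros)

lemma sym_bilinear_expand:
  assumes "sym_bilinear b"
  shows "b u w = (\<Sum>i\<in>Basis. \<Sum>j\<in>Basis. (u \<bullet> i) * (w \<bullet> j) * b i j)"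
proof -
  have b: "bilinear b" using assms by (simp add: sym_bilinear_def)
  have "b u w = b (\<Sum>i\<in>Basis. (u \<bullet> i) *\<^sub>R i) (\<Sum>j\<in>Basis. (w \<bullet> j) *\<^sub>R j)"
    by (simp add: euclidean_representation)
  also have "\<dots> = (\<Sum>(i, j)\<in>Basis \<times> Basis. b ((u \<bullet> i) *\<^sub>R i) ((w \<bullet> j) *\<^sub>R j))"
    by (rule bilinear_sum[OF b])
  also have "\<dots> = (\<Sum>i\<in>Basis. \<Sum>j\<in>Basis. (u \<bullet> i) * (w \<bullet> j) * b i j)"
    by (simp add: sum.cartesian_product bilinear_lmul[OF b] bilinear_rmul[OF b] mult_ac)
  finally show ?thesis .
qed

lemma sym_bilinear_simps:
  assumes "sym_bilinear b"
  shows "b (u + v) w = b u w + b v w" "b u (v + w) = b u v + b u w"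
    "b (u - v) w = b u w - b v w" "b u (v - w) = b u v - b u w"
    "b (r *\<^sub>R u) w = r * b u w" "b u (r *\<^sub>R w) = r * b u w"
    "b (- u) w = - b u w" "b u (- w) = - b u w" "b 0 w = 0" "b u 0 = 0"
  using assms
  by (auto simp: sym_bilinear_def bilinear_ladd bilinear_radd bilinear_lmul bilinear_rmul
      bilinear_lsub bilinear_rsub bilinear_lneg bilinear_rneg bilinear_lzero bilinear_rzero)

lemma sym_bilinear_commute: "sym_bilinear b \<Longrightarrow> b u w = b w u"
  unfolding sym_bilinear_def by blast

text \<open>\<open>frechet_derivative\<close> chooses among all derivatives; functions that agree
  near \<open>x\<close> have the same ones, hence the same choice, even where there is none.\<close>

lemma pd_cong:
  assumes "open S" "x \<in> S" "\<And>z. z \<in> S \<Longrightarrow> \<phi> z = \<psi> z"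
  shows "pd v \<phi> x = pd v \<psi> x"
proof -
  have "(\<phi> has_derivative D) (at x) = (\<psi> has_derivative D) (at x)" for D
    using has_derivative_transform_within_open[OF _ assms(1,2)] assms(3) by (metis (no_types))
  then show ?thesis by (simp add: pd_def frechet_derivative_def)
qed

lemma pd_eqI: "(\<phi> has_derivative D) (at x) \<Longrightarrow> pd v \<phi> x = D v"
  by (simp add: pd_def flip: frechet_derivative_at)

lemma has_derivative_pd: "\<phi> differentiable (at x) \<Longrightarrow> (\<phi> has_derivative (\<lambda>v. pd v \<phi> x)) (at x)"
  by (simp add: pd_def frechet_derivative_works)

lemma pd_expand:
  assumes "\<phi> differentiable (at x)"
  shows "pd v \<phi> x = (\<Sum>k\<in>Basis. (v \<bullet> k) * pd k \<phi> x)"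
proof -
  have lin: "linear (\<lambda>v. pd v \<phi> x)" using has_derivative_linear[OF has_derivative_pd[OF assms]] .
  have "pd v \<phi> x = pd (\<Sum>k\<in>Basis. (v \<bullet> k) *\<^sub>R k) \<phi> x" by (simp add: euclidean_representation)
  also have "\<dots> = (\<Sum>k\<in>Basis. (v \<bullet> k) * pd k \<phi> x)"
    by (simp add: linear_sum[OF lin] linear_cmul[OF lin])
  finally show ?thesis .
qed

text \<open>Regularity is assumed for basis components only; bilinearity on \<open>S\<close> carries
  it to arbitrary arguments.\<close>

lemma C1_sym2_has_derivative:
  assumes h: "h \<in> C1_sym2 S" and S: "open S" "x \<in> S"
  shows "((\<lambda>z. h z u w) has_derivative
     (\<lambda>v. \<Sum>i\<in>Basis. \<Sum>j\<in>Basis. (u \<bullet> i) * (w \<bullet> j) * pd v (\<lambda>z. h z i j) x)) (at x)"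
proof -
  have "((\<lambda>z. \<Sum>i\<in>Basis. \<Sum>j\<in>Basis. (u \<bullet> i) * (w \<bullet> j) * h z i j) has_derivative
     (\<lambda>v. \<Sum>i\<in>Basis. \<Sum>j\<in>Basis. (u \<bullet> i) * (w \<bullet> j) * pd v (\<lambda>z. h z i j) x)) (at x)"
    using h S by (intro has_derivative_sum has_derivative_mult_right has_derivative_pd)
      (auto simp: C1_sym2_def C1_on_def)
  then show ?thesis
    by (rule has_derivative_transform_within_open[OF _ S])
      (use h in \<open>simp add: C1_sym2_def flip: sym_bilinear_expand\<close>)
qed

lemma C1_sym2_differentiable:
  assumes "h \<in> C1_sym2 S" "open S" "x \<in> S"
  shows "(\<lambda>z. h z u w) differentiable (at x)"
  using C1_sym2_has_derivative[OF assms] unfolding differentiable_def by blast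

lemma pd_C1_sym2:
  assumes "h \<in> C1_sym2 S" "open S" "x \<in> S"
  shows "pd v (\<lambda>z. h z u w) x = (\<Sum>i\<in>Basis. \<Sum>j\<in>Basis. (u \<bullet> i) * (w \<bullet> j) * pd v (\<lambda>z. h z i j) x)"
  by (rule pd_eqI[OF C1_sym2_has_derivative[OF assms]])

lemma pd_C1_sym2_linear:
  assumes h: "h \<in> C1_sym2 S" "open S" "x \<in> S"
  shows "linear (\<lambda>v. pd v (\<lambda>z. h z u w) x)" "linear (\<lambda>u. pd v (\<lambda>z. h z u w) x)"
    "linear (\<lambda>w. pd v (\<lambda>z. h z u w) x)"
proof -
  show "linear (\<lambda>v. pd v (\<lambda>z. h z u w) x)"
    by (rule has_derivative_linear[OF has_derivative_pd[OF C1_sym2_differentiable[OF h]]])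
  have 1: "linear (\<lambda>u. \<Sum>i\<in>Basis. \<Sum>j\<in>Basis. (u \<bullet> i) * (w \<bullet> j) * Q i j)"
    for w :: event and Q :: "event \<Rightarrow> event \<Rightarrow> real"
    by (rule linearI) (simp_all only: inner_add_left inner_scaleR_left distrib_right sum.distrib
        sum_distrib_left mult.assoc real_scaleR_def)
  have 2: "linear (\<lambda>w. \<Sum>i\<in>Basis. \<Sum>j\<in>Basis. (u \<bullet> i) * (w \<bullet> j) * Q i j)"
    for u :: event and Q :: "event \<Rightarrow> event \<Rightarrow> real"
    using 1[of u "\<lambda>i j. Q j i"] by (subst sum.swap) (simp only: mult.commute[of "u \<bullet> _"])
  show "linear (\<lambda>u. pd v (\<lambda>z. h z u w) x)"
    using 1[of w "\<lambda>i j. pd v (\<lambda>z. h z i j) x"] by (simp flip: pd_C1_sym2[OF h])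
  show "linear (\<lambda>w. pd v (\<lambda>z. h z u w) x)"
    using 2[of u "\<lambda>i j. pd v (\<lambda>z. h z i j) x"] by (simp flip: pd_C1_sym2[OF h])
qed

lemma pd_C1_sym2_lincomb:
  assumes "h \<in> C1_sym2 S" "k \<in> C1_sym2 S" "open S" "x \<in> S"
  shows "pd v (\<lambda>z. r * h z u w - k z u w) x = r * pd v (\<lambda>z. h z u w) x - pd v (\<lambda>z. k z u w) x"
  by (rule pd_eqI) (intro has_derivative_diff has_derivative_mult_right has_derivative_pd
      C1_sym2_differentiable[OF _ assms(3,4)] assms)

lemma C1_sym2_lincomb:
  assumes h: "h \<in> C1_sym2 S" and k: "k \<in> C1_sym2 S" and S: "open S"
  shows "(\<lambda>x u w. r * h x u w - k x u w) \<in> C1_sym2 S"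
proof -
  have "sym_bilinear (\<lambda>u w. r * h x u w - k x u w)" if "x \<in> S" for x
  proof -
    have hx: "sym_bilinear (h x)" and kx: "sym_bilinear (k x)" using h k that by (auto simp: C1_sym2_def)
    have "bilinear (\<lambda>u w. r * h x u w - k x u w)"
      unfolding bilinear_def
      by (intro conjI allI linearI)
        (simp_all add: sym_bilinear_simps[OF hx] sym_bilinear_simps[OF kx] distrib_left right_diff_distrib)
    moreover have "r * h x u w - k x u w = r * h x w u - k x w u" for u w
      using sym_bilinear_commute[OF hx, of u w] sym_bilinear_commute[OF kx, of u w] by simp
    ultimately show ?thesis unfolding sym_bilinear_def by blast
  qed
  moreover have "C1_on S (\<lambda>x. r * h x l m - k x l m)" if "l \<in> Basis" "m \<in> Basis" for l m
  proof -
    have hk: "C1_on S (\<lambda>x. h x l m)" "C1_on S (\<lambda>x. k x l m)"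
      using h k that by (auto simp: C1_sym2_def)
    have "continuous_on S (pd i (\<lambda>x. r * h x l m - k x l m))" if "i \<in> Basis" for i
      using hk that pd_C1_sym2_lincomb[OF h k S]
        continuous_on_diff[OF continuous_on_mult_left, of S "pd i (\<lambda>x. h x l m)" "pd i (\<lambda>x. k x l m)" r]
      unfolding C1_on_def by (metis (mono_tags, lifting) continuous_on_cong)
    moreover have "(\<lambda>x. r * h x l m - k x l m) differentiable (at x)" if "x \<in> S" for x
      by (intro differentiable_diff differentiable_mult differentiable_const
          C1_sym2_differentiable[OF h S that] C1_sym2_differentiable[OF k S that])
    ultimately show ?thesis unfolding C1_on_def by blast
  qed
  ultimately show ?thesis unfolding C1_sym2_def by blast
qed

lemma C1_sym2_diff:
  assumes "h \<in> C1_sym2 S" "k \<in> C1_sym2 S" "open S"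
  shows "(\<lambda>x u w. h x u w - k x u w) \<in> C1_sym2 S"
  using C1_sym2_lincomb[OF assms, of 1] by simp

lemma pd_C1_sym2_diff:
  assumes "h \<in> C1_sym2 S" "k \<in> C1_sym2 S" "open S" "x \<in> S"
  shows "pd v (\<lambda>z. h z u w - k z u w) x = pd v (\<lambda>z. h z u w) x - pd v (\<lambda>z. k z u w) x"
  using pd_C1_sym2_lincomb[OF assms, of v 1 u w] by simp

text \<open>The Leibniz rule, obtained by differentiating products of real functions in the basis
  expansion. The expansion is valid only while the curve is in \<open>S\<close>, which openness
  grants near \<open>\<tau>\<close>.\<close>

lemma C1_sym2_along_curve:
  assumes h: "h \<in> C1_sym2 S" and S: "open S" "\<gamma> \<tau> \<in> S"
    and \<gamma>: "(\<gamma> has_vector_derivative \<gamma>') (at \<tau>)"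
    and V: "(V has_vector_derivative V') (at \<tau>)" and W: "(W has_vector_derivative W') (at \<tau>)"
  shows "((\<lambda>s. h (\<gamma> s) (V s) (W s)) has_real_derivative
     pd \<gamma>' (\<lambda>z. h z (V \<tau>) (W \<tau>)) (\<gamma> \<tau>) + h (\<gamma> \<tau>) V' (W \<tau>) + h (\<gamma> \<tau>) (V \<tau>) W') (at \<tau>)"
proof -
  have sb: "sym_bilinear (h x)" if "x \<in> S" for x using h that by (simp add: C1_sym2_def)
  have comp: "((\<lambda>s. h (\<gamma> s) i j) has_real_derivative pd \<gamma>' (\<lambda>z. h z i j) (\<gamma> \<tau>)) (at \<tau>)" for i j
  proof -
    have "((\<lambda>z. h z i j) has_derivative (\<lambda>v. pd v (\<lambda>z. h z i j) (\<gamma> \<tau>))) (at (\<gamma> \<tau>))"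
      by (intro has_derivative_pd C1_sym2_differentiable[OF h S])
    from has_derivative_compose[OF \<gamma>[unfolded has_vector_derivative_def] this]
    show ?thesis
      by (rule has_derivative_imp_has_field_derivative)
        (simp add: linear_cmul[OF pd_C1_sym2_linear(1)[OF h S]])
  qed
  have Vi: "((\<lambda>s. V s \<bullet> i) has_real_derivative V' \<bullet> i) (at \<tau>)" for i
    using V by (auto simp: has_real_derivative_iff_has_vector_derivative
        intro: bounded_linear.has_vector_derivative[OF bounded_linear_inner_left])
  have Wi: "((\<lambda>s. W s \<bullet> i) has_real_derivative W' \<bullet> i) (at \<tau>)" for i
    using W by (auto simp: has_real_derivative_iff_has_vector_derivative
        intro: bounded_linear.has_vector_derivative[OF bounded_linear_inner_left])
  have *: "((\<lambda>s. \<Sum>i\<in>Basis. \<Sum>j\<in>Basis. (V s \<bullet> i) * (W s \<bullet> j) * h (\<gamma> s) i j) has_real_derivative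
     (\<Sum>i\<in>Basis. \<Sum>j\<in>Basis. (V \<tau> \<bullet> i) * (W \<tau> \<bullet> j) * pd \<gamma>' (\<lambda>z. h z i j) (\<gamma> \<tau>)
       + ((V' \<bullet> i) * (W \<tau> \<bullet> j) * h (\<gamma> \<tau>) i j + (V \<tau> \<bullet> i) * (W' \<bullet> j) * h (\<gamma> \<tau>) i j))) (at \<tau>)"
  proof (rule DERIV_sum, rule DERIV_sum)
    fix i j :: event
    show "((\<lambda>s. (V s \<bullet> i) * (W s \<bullet> j) * h (\<gamma> s) i j) has_real_derivative
       (V \<tau> \<bullet> i) * (W \<tau> \<bullet> j) * pd \<gamma>' (\<lambda>z. h z i j) (\<gamma> \<tau>)
       + ((V' \<bullet> i) * (W \<tau> \<bullet> j) * h (\<gamma> \<tau>) i j + (V \<tau> \<bullet> i) * (W' \<bullet> j) * h (\<gamma> \<tau>) i j)) (at \<tau>)"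
      by (rule DERIV_cong[OF DERIV_mult[OF DERIV_mult[OF Vi Wi] comp]]) (simp add: algebra_simps)
  qed
  have "(\<Sum>i\<in>Basis. \<Sum>j\<in>Basis. (V \<tau> \<bullet> i) * (W \<tau> \<bullet> j) * pd \<gamma>' (\<lambda>z. h z i j) (\<gamma> \<tau>)
       + ((V' \<bullet> i) * (W \<tau> \<bullet> j) * h (\<gamma> \<tau>) i j + (V \<tau> \<bullet> i) * (W' \<bullet> j) * h (\<gamma> \<tau>) i j))
      = pd \<gamma>' (\<lambda>z. h z (V \<tau>) (W \<tau>)) (\<gamma> \<tau>) + h (\<gamma> \<tau>) V' (W \<tau>) + h (\<gamma> \<tau>) (V \<tau>) W'"
    unfolding pd_C1_sym2[OF h S, of \<gamma>' "V \<tau>" "W \<tau>"] sym_bilinear_expand[OF sb[OF S(2)], of V']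
      sym_bilinear_expand[OF sb[OF S(2)], of "V \<tau>"]
    by (simp add: sum.distrib)
  note * = *[unfolded this]
  have "isCont \<gamma> \<tau>" using \<gamma> by (rule has_vector_derivative_continuous)
  then have ev: "\<forall>\<^sub>F s in at \<tau>. \<gamma> s \<in> S"
    using S by (metis continuous_at topological_tendstoD)
  then have ev': "\<forall>\<^sub>F s in nhds \<tau>. \<gamma> s \<in> S"
    using S(2) by (simp add: eventually_nhds_conv_at)
  have "\<forall>\<^sub>F s in nhds \<tau>. h (\<gamma> s) (V s) (W s) =
      (\<Sum>i\<in>Basis. \<Sum>j\<in>Basis. (V s \<bullet> i) * (W s \<bullet> j) * h (\<gamma> s) i j)"
    by (rule eventually_mono[OF ev']) (rule sym_bilinear_expand[OF sb])
  from DERIV_cong_ev[OF refl this refl] * show ?thesis by blast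
qed

subsection \<open>The geodesic vector field\<close>

definition nondegenerate :: "(event \<Rightarrow> event \<Rightarrow> real) \<Rightarrow> bool" where
  "nondegenerate b \<longleftrightarrow> (\<forall>c. (\<forall>w. b c w = 0) \<longrightarrow> c = 0)"

lemma sym_bilinear_expand_right:
  assumes "sym_bilinear b"
  shows "b c w = (\<Sum>l\<in>Basis. (w \<bullet> l) * b c l)"
proof -
  have lin: "linear (b c)" using assms unfolding sym_bilinear_def bilinear_def by blast
  have "b c w = b c (\<Sum>l\<in>Basis. (w \<bullet> l) *\<^sub>R l)" by (simp only: euclidean_representation)
  also have "\<dots> = (\<Sum>l\<in>Basis. b c ((w \<bullet> l) *\<^sub>R l))" by (rule linear_sum[OF lin])
  finally show ?thesis by (simp only: sym_bilinear_simps[OF assms])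
qed

lemma sym_bilinear_expand_left:
  assumes "sym_bilinear b"
  shows "b c w = (\<Sum>l\<in>Basis. (c \<bullet> l) * b l w)"
  using sym_bilinear_expand_right[OF assms, of w c] by (simp only: sym_bilinear_commute[OF assms, of w])

lemma lorentzian_nondegenerate:
  assumes "lorentzian_on S g" "x \<in> S"
  shows "nondegenerate (g x)"
  unfolding nondegenerate_def
proof (intro allI impI)
  fix c assume c: "\<forall>w. g x c w = 0"
  obtain A :: "event \<Rightarrow> event" where A: "linear A" "bij A" "\<And>u w. g x (A u) (A w) = - (fst u * fst w) + snd u \<bullet> snd w"
    using bspec[OF assms(1)[unfolded lorentzian_on_def] assms(2)] by metis
  obtain d where d: "c = A d" using A(2) by (metis bij_pointE)
  \<comment> \<open>Reflecting the time component turns the Minkowski form into the Euclidean square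
    of \<open>d\<close>.\<close>
  have "g x (A d) (A (- fst d, snd d)) = 0" using c d by blast
  then have "fst d * fst d + snd d \<bullet> snd d = 0" by (simp add: A(3))
  moreover have "snd d \<bullet> snd d \<ge> 0" "fst d * fst d \<ge> 0" by auto
  ultimately have "fst d * fst d = 0" "snd d \<bullet> snd d = 0" by linarith+
  then have "d = 0" by (simp add: prod_eq_iff)
  then show "c = 0" using d A(1) by (simp add: linear_0)
qed

lemma sharp_eqI:
  assumes b: "sym_bilinear b" "nondegenerate b" and c: "\<And>w. b c w = \<alpha> w"
  shows "sharp b \<alpha> = c"
  unfolding sharp_def
proof (rule the_equality)
  show "\<forall>w. b c w = \<alpha> w" using c by blast
  fix c' assume "\<forall>w. b c' w = \<alpha> w"
  then have "\<forall>w. b (c' - c) w = 0" using c by (simp only: sym_bilinear_simps[OF b(1)]) simp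
  then show "c' = c" using b(2) unfolding nondegenerate_def by (metis eq_iff_diff_eq_0)
qed

text \<open>This is the existence behind \<open>THE\<close>: \<open>B\<close>, which collects the
  values of \<open>b c\<close> on the basis, is injective by nondegeneracy and hence surjective in
  finite dimension.\<close>

lemma sharp_works:
  assumes b: "sym_bilinear b" "nondegenerate b" and \<alpha>: "linear \<alpha>"
  shows "b (sharp b \<alpha>) w = \<alpha> w"
proof -
  define B where "B c = (\<Sum>i\<in>Basis. b c i *\<^sub>R i)" for c
  have Bi: "B c \<bullet> i = b c i" if "i \<in> Basis" for c i
    using that by (simp add: B_def)
  note bw = sym_bilinear_expand_right[OF b(1)]
  have "linear B"
    unfolding B_def
    by (rule linearI)
      (simp_all add: sym_bilinear_simps[OF b(1)] scaleR_left_distrib sum.distrib scaleR_right.sum)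
  moreover have "inj B"
  proof (rule linear_injective_0[THEN iffD2, OF \<open>linear B\<close>], intro allI impI)
    fix c assume "B c = 0"
    then have "b c i = 0" if "i \<in> Basis" for i using Bi[OF that, of c] by simp
    then have "b c w = 0" for w by (subst bw) simp
    then show "c = 0" using b(2) unfolding nondegenerate_def by blast
  qed
  ultimately have "surj B" by (rule linear_inj_imp_surj)
  then obtain c where c: "B c = (\<Sum>i\<in>Basis. \<alpha> i *\<^sub>R i)" by (metis surjD)
  have "b c w = \<alpha> w" for w
  proof -
    have "b c i = \<alpha> i" if "i \<in> Basis" for i using Bi[OF that, of c] c that by simp
    then have "b c w = (\<Sum>i\<in>Basis. (w \<bullet> i) * \<alpha> i)" by (subst bw) simp
    also have "\<dots> = \<alpha> (\<Sum>i\<in>Basis. (w \<bullet> i) *\<^sub>R i)" by (simp add: linear_sum[OF \<alpha>] linear_cmul[OF \<alpha>])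
    finally show ?thesis by (simp add: euclidean_representation)
  qed
  with sharp_eqI[OF b this] show ?thesis by simp
qed

lemma christoffel_works:
  assumes g: "g \<in> C1_sym2 S" "open S" "x \<in> S" and nd: "nondegenerate (g x)"
  shows "g x (christoffel g x u u) w = pd u (\<lambda>z. g z u w) x - pd w (\<lambda>z. g z u u) x / 2"
proof -
  have sb: "sym_bilinear (g x)" using g by (simp add: C1_sym2_def)
  note l1 = linear_cmul[OF pd_C1_sym2_linear(1)[OF g]] linear_add[OF pd_C1_sym2_linear(1)[OF g]]
    and l3 = linear_cmul[OF pd_C1_sym2_linear(3)[OF g]] linear_add[OF pd_C1_sym2_linear(3)[OF g]]
  have "linear (\<lambda>w. (pd u (\<lambda>z. g z u w) x + pd u (\<lambda>z. g z u w) x - pd w (\<lambda>z. g z u u) x) / 2)"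
    by (rule linearI) (simp_all add: l1 l3 field_simps)
  from sharp_works[OF sb nd this, of w] show ?thesis
    by (simp add: christoffel_def field_simps)
qed

definition geodesic_field :: "tensor2 \<Rightarrow> event \<times> event \<Rightarrow> event \<times> event" where
  "geodesic_field g z = (snd z, - christoffel g (fst z) (snd z) (snd z))"

text \<open>The Christoffel symbol with its index lowered: polynomial in the velocity and linear in
  the first derivatives of the metric. Estimates pass through it so that no inverse metric has to be
  formed.\<close>

definition lowered_christoffel :: "tensor2 \<Rightarrow> event \<times> event \<Rightarrow> event \<Rightarrow> real" where
  "lowered_christoffel g z k = (\<Sum>i\<in>Basis. \<Sum>j\<in>Basis. (snd z \<bullet> i) * (snd z \<bullet> j) *
      (pd i (\<lambda>x. g x j k) (fst z) - pd k (\<lambda>x. g x i j) (fst z) / 2))"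

lemma lowered_christoffel:
  assumes g: "g \<in> C1_sym2 S" "open S" "fst z \<in> S" and nd: "nondegenerate (g (fst z))"
  shows "g (fst z) (christoffel g (fst z) (snd z) (snd z)) k = lowered_christoffel g z k"
proof -
  have "pd (snd z) (\<lambda>x. g x (snd z) k) (fst z)
      = pd (\<Sum>i\<in>Basis. (snd z \<bullet> i) *\<^sub>R i) (\<lambda>x. g x (snd z) k) (fst z)"
    by (simp add: euclidean_representation)
  also have "\<dots> = (\<Sum>i\<in>Basis. (snd z \<bullet> i) * pd i (\<lambda>x. g x (snd z) k) (fst z))"
    by (simp add: linear_sum[OF pd_C1_sym2_linear(1)[OF g]] linear_cmul[OF pd_C1_sym2_linear(1)[OF g]])
  also have "\<dots> = (\<Sum>i\<in>Basis. (snd z \<bullet> i) * pd i (\<lambda>x. g x (\<Sum>j\<in>Basis. (snd z \<bullet> j) *\<^sub>R j) k) (fst z))"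
    by (simp add: euclidean_representation)
  also have "\<dots> = (\<Sum>i\<in>Basis. \<Sum>j\<in>Basis. (snd z \<bullet> i) * (snd z \<bullet> j) * pd i (\<lambda>x. g x j k) (fst z))"
    by (simp add: linear_sum[OF pd_C1_sym2_linear(2)[OF g]] linear_cmul[OF pd_C1_sym2_linear(2)[OF g]]
        sum_distrib_left mult_ac)
  finally have 1: "pd (snd z) (\<lambda>x. g x (snd z) k) (fst z) =
      (\<Sum>i\<in>Basis. \<Sum>j\<in>Basis. (snd z \<bullet> i) * (snd z \<bullet> j) * pd i (\<lambda>x. g x j k) (fst z))" .
  show ?thesis
    unfolding christoffel_works[OF g nd] lowered_christoffel_def 1
    by (subst pd_C1_sym2[OF g]) (simp add: sum_divide_distrib sum_subtractf right_diff_distrib)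
qed

section \<open>Calculus of bounded Lipschitz functions\<close>

definition lipschitz_bounded :: "'a::real_normed_vector set \<Rightarrow> ('a \<Rightarrow> real) \<Rightarrow> bool" where
  "lipschitz_bounded K \<phi> \<longleftrightarrow> (\<exists>B\<ge>0. \<exists>L\<ge>0. (\<forall>z\<in>K. \<bar>\<phi> z\<bar> \<le> B) \<and>
     (\<forall>z\<in>K. \<forall>w\<in>K. \<bar>\<phi> z - \<phi> w\<bar> \<le> L * norm (z - w)))"

lemma lipschitz_boundedI:
  assumes "\<And>z. z \<in> K \<Longrightarrow> \<bar>\<phi> z\<bar> \<le> B" "\<And>z w. z \<in> K \<Longrightarrow> w \<in> K \<Longrightarrow> \<bar>\<phi> z - \<phi> w\<bar> \<le> L * norm (z - w)"
  shows "lipschitz_bounded K \<phi>"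
  unfolding lipschitz_bounded_def
proof (rule exI[of _ "\<bar>B\<bar>"], rule conjI, simp, rule exI[of _ "\<bar>L\<bar>"], intro conjI ballI)
  show "\<bar>\<phi> z\<bar> \<le> \<bar>B\<bar>" if "z \<in> K" for z using assms(1)[OF that] by linarith
  show "\<bar>\<phi> z - \<phi> w\<bar> \<le> \<bar>L\<bar> * norm (z - w)" if "z \<in> K" "w \<in> K" for z w
    using assms(2)[OF that] mult_right_mono[OF abs_ge_self, of "norm (z - w)" L] by force
qed auto

lemma lipschitz_boundedE:
  assumes "lipschitz_bounded K \<phi>"
  obtains B L where "B \<ge> 0" "L \<ge> 0" "\<And>z. z \<in> K \<Longrightarrow> \<bar>\<phi> z\<bar> \<le> B"
    "\<And>z w. z \<in> K \<Longrightarrow> w \<in> K \<Longrightarrow> \<bar>\<phi> z - \<phi> w\<bar> \<le> L * norm (z - w)"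
  using assms unfolding lipschitz_bounded_def by blast

lemma lipschitz_bounded_const: "lipschitz_bounded K (\<lambda>_. c)"
  by (rule lipschitz_boundedI[of _ _ "\<bar>c\<bar>" 0]) auto

lemma lipschitz_bounded_add:
  assumes "lipschitz_bounded K \<phi>" "lipschitz_bounded K \<psi>"
  shows "lipschitz_bounded K (\<lambda>z. \<phi> z + \<psi> z)"
proof -
  obtain B L where 1: "B \<ge> 0" "L \<ge> 0" "\<And>z. z \<in> K \<Longrightarrow> \<bar>\<phi> z\<bar> \<le> B"
      "\<And>z w. z \<in> K \<Longrightarrow> w \<in> K \<Longrightarrow> \<bar>\<phi> z - \<phi> w\<bar> \<le> L * norm (z - w)"
    by (rule lipschitz_boundedE[OF assms(1)]) blast
  obtain B' L' where 2: "B' \<ge> 0" "L' \<ge> 0" "\<And>z. z \<in> K \<Longrightarrow> \<bar>\<psi> z\<bar> \<le> B'"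
      "\<And>z w. z \<in> K \<Longrightarrow> w \<in> K \<Longrightarrow> \<bar>\<psi> z - \<psi> w\<bar> \<le> L' * norm (z - w)"
    by (rule lipschitz_boundedE[OF assms(2)]) blast
  note * = 1(3,4) 2(3,4)
  note nn = 1(1) 2(1) 1(2) 2(2)
  show ?thesis
  proof (rule lipschitz_boundedI)
    show "\<bar>\<phi> z + \<psi> z\<bar> \<le> B + B'" if "z \<in> K" for z using *(1,3)[OF that] by linarith
    show "\<bar>\<phi> z + \<psi> z - (\<phi> w + \<psi> w)\<bar> \<le> (L + L') * norm (z - w)" if "z \<in> K" "w \<in> K" for z w
      using *(2,4)[OF that] unfolding distrib_right by linarith
  qed
qed

text \<open>Products are the reason why the predicate carries a bound besides the Lipschitz
  constant.\<close>

lemma lipschitz_bounded_mult: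
  assumes "lipschitz_bounded K \<phi>" "lipschitz_bounded K \<psi>"
  shows "lipschitz_bounded K (\<lambda>z. \<phi> z * \<psi> z)"
proof -
  obtain B L where 1: "B \<ge> 0" "L \<ge> 0" "\<And>z. z \<in> K \<Longrightarrow> \<bar>\<phi> z\<bar> \<le> B"
      "\<And>z w. z \<in> K \<Longrightarrow> w \<in> K \<Longrightarrow> \<bar>\<phi> z - \<phi> w\<bar> \<le> L * norm (z - w)"
    by (rule lipschitz_boundedE[OF assms(1)]) blast
  obtain B' L' where 2: "B' \<ge> 0" "L' \<ge> 0" "\<And>z. z \<in> K \<Longrightarrow> \<bar>\<psi> z\<bar> \<le> B'"
      "\<And>z w. z \<in> K \<Longrightarrow> w \<in> K \<Longrightarrow> \<bar>\<psi> z - \<psi> w\<bar> \<le> L' * norm (z - w)"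
    by (rule lipschitz_boundedE[OF assms(2)]) blast
  note * = 1(3,4) 2(3,4)
  note nn = 1(1) 2(1) 1(2) 2(2)
  show ?thesis
  proof (rule lipschitz_boundedI)
    show "\<bar>\<phi> z * \<psi> z\<bar> \<le> B * B'" if "z \<in> K" for z
      unfolding abs_mult using *(1,3)[OF that] nn by (intro mult_mono) auto
    show "\<bar>\<phi> z * \<psi> z - \<phi> w * \<psi> w\<bar> \<le> (B * L' + L * B') * norm (z - w)" if zw: "z \<in> K" "w \<in> K" for z w
    proof -
      have "\<bar>\<phi> z * \<psi> z - \<phi> w * \<psi> w\<bar> = \<bar>\<phi> z * (\<psi> z - \<psi> w) + (\<phi> z - \<phi> w) * \<psi> w\<bar>"
        by (simp add: algebra_simps)
      also have "\<dots> \<le> \<bar>\<phi> z\<bar> * \<bar>\<psi> z - \<psi> w\<bar> + \<bar>\<phi> z - \<phi> w\<bar> * \<bar>\<psi> w\<bar>"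
        by (metis abs_mult abs_triangle_ineq)
      also have "\<dots> \<le> B * (L' * norm (z - w)) + (L * norm (z - w)) * B'"
        using * zw nn by (intro add_mono mult_mono) auto
      finally show ?thesis by (simp add: algebra_simps)
    qed
  qed
qed

lemma lipschitz_bounded_diff:
  assumes "lipschitz_bounded K \<phi>" "lipschitz_bounded K \<psi>"
  shows "lipschitz_bounded K (\<lambda>z. \<phi> z - \<psi> z)"
  using lipschitz_bounded_add[OF assms(1) lipschitz_bounded_mult[OF lipschitz_bounded_const[of K "-1"] assms(2)]]
  by simp

lemma lipschitz_bounded_sum:
  "(\<And>i. i \<in> I \<Longrightarrow> lipschitz_bounded K (\<phi> i)) \<Longrightarrow> lipschitz_bounded K (\<lambda>z. \<Sum>i\<in>I. \<phi> i z)"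
  by (induction I rule: infinite_finite_induct) (auto intro: lipschitz_bounded_const lipschitz_bounded_add)

lemma norm_fst_le_norm: "norm (fst z) \<le> norm z"
  by (metis norm_fst_le prod.collapse)

lemma norm_snd_le_norm: "norm (snd z) \<le> norm z"
  by (metis norm_snd_le prod.collapse)

lemma lipschitz_bounded_fst:
  assumes "lipschitz_bounded (fst ` K) \<phi>"
  shows "lipschitz_bounded K (\<lambda>z. \<phi> (fst z))"
proof -
  obtain B L where B: "B \<ge> 0" and L: "L \<ge> 0" and *: "\<And>x. x \<in> fst ` K \<Longrightarrow> \<bar>\<phi> x\<bar> \<le> B"
      "\<And>x y. x \<in> fst ` K \<Longrightarrow> y \<in> fst ` K \<Longrightarrow> \<bar>\<phi> x - \<phi> y\<bar> \<le> L * norm (x - y)"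
    by (rule lipschitz_boundedE[OF assms]) blast
  show ?thesis
  proof (rule lipschitz_boundedI)
    show "\<bar>\<phi> (fst z)\<bar> \<le> B" if "z \<in> K" for z using *(1) that by blast
    show "\<bar>\<phi> (fst z) - \<phi> (fst w)\<bar> \<le> L * norm (z - w)" if "z \<in> K" "w \<in> K" for z w
    proof -
      have "\<bar>\<phi> (fst z) - \<phi> (fst w)\<bar> \<le> L * norm (fst z - fst w)" using *(2) that by blast
      also have "\<dots> \<le> L * norm (z - w)"
        using L norm_fst_le_norm[of "z - w"] by (intro mult_left_mono) auto
      finally show ?thesis .
    qed
  qed
qed

lemma lipschitz_bounded_snd_inner:
  assumes "bounded K"
  shows "lipschitz_bounded K (\<lambda>z. snd z \<bullet> i)"
proof -
  obtain R where R: "\<And>z. z \<in> K \<Longrightarrow> norm z \<le> R" using assms unfolding bounded_iff by blast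
  have *: "\<bar>snd z \<bullet> i\<bar> \<le> norm i * norm z" for z
  proof -
    have "\<bar>snd z \<bullet> i\<bar> \<le> norm (snd z) * norm i" by (rule Cauchy_Schwarz_ineq2)
    also have "\<dots> \<le> norm z * norm i" by (intro mult_right_mono norm_snd_le_norm norm_ge_zero)
    finally show ?thesis by (simp add: mult.commute)
  qed
  show ?thesis
  proof (rule lipschitz_boundedI)
    show "\<bar>snd z \<bullet> i\<bar> \<le> norm i * R" if "z \<in> K" for z
      using *[of z] mult_left_mono[OF R[OF that], of "norm i"] by force
    show "\<bar>snd z \<bullet> i - snd w \<bullet> i\<bar> \<le> norm i * norm (z - w)" for z w
      using *[of "z - w"] by (simp add: inner_diff_left)
  qed
qed

text \<open>Mean value inequality on the convex set \<open>K\<close>: the operator norm of the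
  derivative is at most the sum of the absolute partials, which is continuous and so bounded on the
  compact \<open>K\<close>.\<close>

lemma C1_lipschitz_bounded:
  assumes \<phi>: "C1_on S \<phi>" and K: "compact K" "convex K" "K \<subseteq> S"
  shows "lipschitz_bounded K \<phi>"
proof -
  have diff: "\<phi> differentiable (at x)" if "x \<in> K" for x using \<phi> K that unfolding C1_on_def by blast
  have "continuous_on K \<phi>"
    by (meson diff continuous_at_imp_continuous_on differentiable_imp_continuous_within)
  then have "bounded (\<phi> ` K)" using K(1) compact_continuous_image compact_imp_bounded by blast
  then obtain B where B: "\<And>x. x \<in> K \<Longrightarrow> \<bar>\<phi> x\<bar> \<le> B" unfolding bounded_iff by auto
  have "continuous_on K (\<lambda>x. \<Sum>k\<in>Basis. \<bar>pd k \<phi> x\<bar>)"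
    using \<phi> K(3) unfolding C1_on_def by (intro continuous_intros) (meson continuous_on_subset)
  then have "bounded ((\<lambda>x. \<Sum>k\<in>Basis. \<bar>pd k \<phi> x\<bar>) ` K)"
    using K(1) compact_continuous_image compact_imp_bounded by blast
  then obtain D where D: "\<And>x. x \<in> K \<Longrightarrow> \<bar>\<Sum>k\<in>Basis. \<bar>pd k \<phi> x\<bar>\<bar> \<le> D"
    unfolding bounded_iff by auto
  show ?thesis
  proof (rule lipschitz_boundedI[OF B])
    fix z w assume zw: "z \<in> K" "w \<in> K"
    have "norm (\<phi> z - \<phi> w) \<le> D * norm (z - w)"
    proof (rule differentiable_bound[OF K(2) _ _ zw(1,2)])
      show "(\<phi> has_derivative (\<lambda>v. pd v \<phi> x)) (at x within K)" if "x \<in> K" for x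
        by (rule has_derivative_at_withinI[OF has_derivative_pd[OF diff[OF that]]])
      show "onorm (\<lambda>v. pd v \<phi> x) \<le> D" if "x \<in> K" for x
      proof (rule onorm_le)
        fix v
        have "norm (pd v \<phi> x) \<le> (\<Sum>k\<in>Basis. \<bar>v \<bullet> k\<bar> * \<bar>pd k \<phi> x\<bar>)"
          by (subst pd_expand[OF diff[OF that]]) (auto simp flip: abs_mult intro: sum_abs)
        also have "\<dots> \<le> (\<Sum>k\<in>Basis. norm v * \<bar>pd k \<phi> x\<bar>)"
          by (intro sum_mono mult_right_mono Basis_le_norm) auto
        also have "\<dots> \<le> D * norm v"
          using mult_right_mono[OF order_trans[OF abs_ge_self D[OF that]], of "norm v"]
          by (simp add: mult.commute flip: sum_distrib_left)
        finally show "norm (pd v \<phi> x) \<le> D * norm v" .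
      qed
    qed
    then show "\<bar>\<phi> z - \<phi> w\<bar> \<le> D * norm (z - w)" by simp
  qed
qed

text \<open>Nondegeneracy made uniform: \<open>q\<close> attains its minimum over \<open>K\<close>
  times the unit sphere, the minimum cannot be 0, and homogeneity in \<open>c\<close> extends it to
  all vectors. It stands in for a bound on the inverse metric.\<close>

lemma nondegenerate_lower_bound:
  fixes g :: tensor2
  assumes K: "compact K" and cont: "\<And>l m. l \<in> Basis \<Longrightarrow> m \<in> Basis \<Longrightarrow> continuous_on K (\<lambda>x. g x l m)"
    and sb: "\<And>x. x \<in> K \<Longrightarrow> sym_bilinear (g x)" and nd: "\<And>x. x \<in> K \<Longrightarrow> nondegenerate (g x)"
  shows "\<exists>m>0. \<forall>x\<in>K. \<forall>c. m * norm c \<le> (\<Sum>k\<in>Basis. \<bar>g x c k\<bar>)"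
proof (cases "K = {}")
  case False
  define q where "q p = (\<Sum>k\<in>Basis. \<bar>\<Sum>l\<in>Basis. (snd p \<bullet> l) * g (fst p) l k\<bar>)" for p :: "event \<times> event"
  have gq: "(\<Sum>k\<in>Basis. \<bar>g x c k\<bar>) = q (x, c)" if "x \<in> K" for x c
  proof -
    have "g x c k = (\<Sum>l\<in>Basis. (c \<bullet> l) * g x l k)" if "k \<in> Basis" for k
    proof -
      show ?thesis by (rule sym_bilinear_expand_left[OF sb[OF \<open>x \<in> K\<close>]])
    qed
    then show ?thesis by (simp add: q_def)
  qed
  have c1: "continuous_on (K \<times> sphere 0 1) (\<lambda>p. g (fst p) l k)" if "l \<in> Basis" "k \<in> Basis" for l k
    by (rule continuous_on_compose2[OF cont[OF that]]) (auto intro: continuous_intros)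
  have "continuous_on (K \<times> sphere 0 1) q"
    unfolding q_def by (intro continuous_intros c1) auto
  moreover have "compact (K \<times> (sphere 0 1 :: event set))" using K by (intro compact_Times) auto
  moreover have "K \<times> (sphere 0 1 :: event set) \<noteq> {}" using False by auto
  ultimately obtain p where p: "p \<in> K \<times> sphere 0 1" "\<And>p'. p' \<in> K \<times> sphere 0 1 \<Longrightarrow> q p \<le> q p'"
    using continuous_attains_inf[of "K \<times> sphere 0 1" q] by blast
  have pK: "fst p \<in> K" and p1: "norm (snd p) = 1" using p(1) by auto
  have "q p \<ge> 0" unfolding q_def by (simp add: sum_nonneg)
  moreover have "q p \<noteq> 0"
  proof
    assume "q p = 0"
    then have "(\<Sum>k\<in>Basis. \<bar>g (fst p) (snd p) k\<bar>) = 0" using gq[OF pK, of "snd p"] by simp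
    then have z: "g (fst p) (snd p) k = 0" if "k \<in> Basis" for k
      using that by (subst (asm) sum_nonneg_eq_0_iff) auto
    have "linear (g (fst p) (snd p))" using sb[OF pK] unfolding sym_bilinear_def bilinear_def by blast
    moreover have "linear (\<lambda>w::event. 0::real)" by (rule linear_zero)
    ultimately have "g (fst p) (snd p) = (\<lambda>w. 0)" by (rule linear_eq_stdbasis) (use z in auto)
    then have "snd p = 0" using nd[OF pK] unfolding nondegenerate_def by metis
    with p1 show False by simp
  qed
  ultimately have pos: "q p > 0" by linarith
  have "q p * norm c \<le> (\<Sum>k\<in>Basis. \<bar>g x c k\<bar>)" if x: "x \<in> K" for x c
  proof (cases "c = 0")
    case True then show ?thesis by (simp add: sum_nonneg)
  next
    case False
    define e where "e = inverse (norm c) *\<^sub>R c"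
    have e: "norm e = 1" "c = norm c *\<^sub>R e" using False by (auto simp: e_def)
    have "q p \<le> (\<Sum>k\<in>Basis. \<bar>g x e k\<bar>)" using gq[OF x] p(2)[of "(x, e)"] x e by simp
    then have "q p * norm c \<le> (\<Sum>k\<in>Basis. \<bar>g x e k\<bar>) * norm c" by (intro mult_right_mono) auto
    also have "\<dots> = (\<Sum>k\<in>Basis. \<bar>g x (norm c *\<^sub>R e) k\<bar>)"
      by (simp add: sym_bilinear_simps[OF sb[OF x]] abs_mult sum_distrib_left mult.commute)
    finally show ?thesis using e(2) by simp
  qed
  with pos show ?thesis by blast
qed (auto intro: exI[of _ 1])

text \<open>Stability of a linear system when both sides change:
  \<open>b1 (c1 - c2) = (b1 c1 - b2 c2) + (b2 - b1) c2\<close>. The lower bound is required of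
  \<open>b1\<close> alone. Below it compares one metric at two points, and two metrics at one
  point.\<close>

lemma sym_bilinear_solution_diff:
  assumes b1: "sym_bilinear b1" and b2: "sym_bilinear b2"
    and m: "\<And>c. m * norm c \<le> (\<Sum>k\<in>Basis. \<bar>b1 c k\<bar>)"
  shows "m * norm (c1 - c2) \<le> (\<Sum>k\<in>Basis. \<bar>b1 c1 k - b2 c2 k\<bar>)
     + norm c2 * (\<Sum>k\<in>Basis. \<Sum>l\<in>Basis. \<bar>b2 l k - b1 l k\<bar>)"
proof -
  have "\<bar>b1 (c1 - c2) k\<bar> \<le> \<bar>b1 c1 k - b2 c2 k\<bar> + norm c2 * (\<Sum>l\<in>Basis. \<bar>b2 l k - b1 l k\<bar>)" for k
  proof -
    note ex = sym_bilinear_expand_left[of _ c2 k]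
    have "\<bar>b2 c2 k - b1 c2 k\<bar> = \<bar>\<Sum>l\<in>Basis. (c2 \<bullet> l) * (b2 l k - b1 l k)\<bar>"
      by (subst ex[OF b1], subst ex[OF b2]) (simp add: sum_subtractf right_diff_distrib)
    also have "\<dots> \<le> (\<Sum>l\<in>Basis. \<bar>c2 \<bullet> l\<bar> * \<bar>b2 l k - b1 l k\<bar>)"
      by (auto simp flip: abs_mult intro: sum_abs)
    also have "\<dots> \<le> (\<Sum>l\<in>Basis. norm c2 * \<bar>b2 l k - b1 l k\<bar>)"
      by (intro sum_mono mult_right_mono Basis_le_norm) auto
    finally have "\<bar>b2 c2 k - b1 c2 k\<bar> \<le> norm c2 * (\<Sum>l\<in>Basis. \<bar>b2 l k - b1 l k\<bar>)"
      by (simp add: sum_distrib_left)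
    moreover have "b1 (c1 - c2) k = (b1 c1 k - b2 c2 k) + (b2 c2 k - b1 c2 k)"
      by (simp add: sym_bilinear_simps[OF b1])
    ultimately show ?thesis by linarith
  qed
  then have "(\<Sum>k\<in>Basis. \<bar>b1 (c1 - c2) k\<bar>) \<le>
      (\<Sum>k\<in>Basis. \<bar>b1 c1 k - b2 c2 k\<bar> + norm c2 * (\<Sum>l\<in>Basis. \<bar>b2 l k - b1 l k\<bar>))"
    by (intro sum_mono)
  also have "\<dots> = (\<Sum>k\<in>Basis. \<bar>b1 c1 k - b2 c2 k\<bar>) + norm c2 * (\<Sum>k\<in>Basis. \<Sum>l\<in>Basis. \<bar>b2 l k - b1 l k\<bar>)"
    by (simp add: sum.distrib sum_distrib_left)
  finally show ?thesis using m[of "c1 - c2"] by linarith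
qed

section \<open>Local bounds for the geodesic field of a \<open>C\<^sup>2\<close> Lorentzian
  metric\<close>

definition regular_metric :: "tensor2 \<Rightarrow> bool" where
  "regular_metric g \<longleftrightarrow> g \<in> C2_sym2 spacetime \<and> lorentzian_on spacetime g"

lemma regular_metric_C1: "regular_metric g \<Longrightarrow> g \<in> C1_sym2 spacetime"
  by (simp add: regular_metric_def C2_sym2_imp_C1)

lemma regular_metric_sym: "regular_metric g \<Longrightarrow> x \<in> spacetime \<Longrightarrow> sym_bilinear (g x)"
  by (simp add: regular_metric_def lorentzian_on_def)

lemma regular_metric_nondegenerate: "regular_metric g \<Longrightarrow> x \<in> spacetime \<Longrightarrow> nondegenerate (g x)"
  unfolding regular_metric_def by (blast intro: lorentzian_nondegenerate)

lemma regular_metric_lower_bound: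
  assumes g: "regular_metric g" and K: "compact K" "K \<subseteq> spacetime"
  shows "\<exists>m>0. \<forall>x\<in>K. \<forall>c. m * norm c \<le> (\<Sum>k\<in>Basis. \<bar>g x c k\<bar>)"
proof (rule nondegenerate_lower_bound[OF K(1)])
  fix l m :: event assume "l \<in> Basis" "m \<in> Basis"
  have "(\<lambda>x. g x l m) differentiable (at x)" if "x \<in> K" for x
    using that K by (intro C1_sym2_differentiable[OF regular_metric_C1[OF g] open_spacetime]) auto
  then show "continuous_on K (\<lambda>x. g x l m)"
    by (meson continuous_at_imp_continuous_on differentiable_imp_continuous_within)
qed (use K g regular_metric_sym regular_metric_nondegenerate in blast)+

text \<open>Second derivatives of the metric enter here: they make its first derivatives Lipschitz
  on compact convex sets.\<close>

lemma lowered_christoffel_lipschitz: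
  assumes g: "g \<in> C2_sym2 S" and K: "compact K" "convex K" "fst ` K \<subseteq> S" and k: "k \<in> Basis"
  shows "lipschitz_bounded K (\<lambda>z. lowered_christoffel g z k)"
proof -
  have K': "compact (fst ` K)" "convex (fst ` K)"
    using K by (auto intro!: compact_continuous_image convex_linear_image linear_fst continuous_intros)
  have pdl: "lipschitz_bounded K (\<lambda>z. pd i (\<lambda>x. g x l m) (fst z))" if "i \<in> Basis" "l \<in> Basis" "m \<in> Basis" for i l m
  proof (rule lipschitz_bounded_fst, rule C1_lipschitz_bounded[OF _ K' K(3)])
    show "C1_on S (pd i (\<lambda>x. g x l m))" using g that unfolding C2_sym2_def C2_on_def by blast
  qed
  have half: "lowered_christoffel g z k = (\<Sum>i\<in>Basis. \<Sum>j\<in>Basis. (snd z \<bullet> i) * (snd z \<bullet> j) *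
      (pd i (\<lambda>x. g x j k) (fst z) - (1 / 2) * pd k (\<lambda>x. g x i j) (fst z)))" for z
    by (simp add: lowered_christoffel_def)
  show ?thesis unfolding half
    by (intro lipschitz_bounded_sum lipschitz_bounded_mult lipschitz_bounded_diff lipschitz_bounded_const
        lipschitz_bounded_snd_inner pdl compact_imp_bounded K k)
qed

lemma uniform_lipschitz_bounds:
  fixes \<phi> :: "'i \<Rightarrow> 'a::real_normed_vector \<Rightarrow> real"
  assumes "finite I" "\<And>i. i \<in> I \<Longrightarrow> lipschitz_bounded K (\<phi> i)"
  shows "\<exists>B\<ge>0. \<exists>L\<ge>0. (\<forall>z\<in>K. (\<Sum>i\<in>I. \<bar>\<phi> i z\<bar>) \<le> B) \<and>
     (\<forall>z\<in>K. \<forall>w\<in>K. (\<Sum>i\<in>I. \<bar>\<phi> i z - \<phi> i w\<bar>) \<le> L * norm (z - w))"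
proof -
  have "\<exists>B L. 0 \<le> B \<and> 0 \<le> L \<and> (\<forall>z\<in>K. \<bar>\<phi> i z\<bar> \<le> B) \<and> (\<forall>z\<in>K. \<forall>w\<in>K. \<bar>\<phi> i z - \<phi> i w\<bar> \<le> L * norm (z - w))"
    if "i \<in> I" for i using assms(2)[OF that] unfolding lipschitz_bounded_def by blast
  then obtain B L where *: "\<And>i. i \<in> I \<Longrightarrow> 0 \<le> B i" "\<And>i. i \<in> I \<Longrightarrow> 0 \<le> L i"
      "\<And>i z. i \<in> I \<Longrightarrow> z \<in> K \<Longrightarrow> \<bar>\<phi> i z\<bar> \<le> B i"
      "\<And>i z w. i \<in> I \<Longrightarrow> z \<in> K \<Longrightarrow> w \<in> K \<Longrightarrow> \<bar>\<phi> i z - \<phi> i w\<bar> \<le> L i * norm (z - w)"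
    by metis
  have "(\<Sum>i\<in>I. \<bar>\<phi> i z\<bar>) \<le> (\<Sum>i\<in>I. B i)" if "z \<in> K" for z using *(3) that by (intro sum_mono)
  moreover have "(\<Sum>i\<in>I. \<bar>\<phi> i z - \<phi> i w\<bar>) \<le> (\<Sum>i\<in>I. L i) * norm (z - w)" if "z \<in> K" "w \<in> K" for z w
    unfolding sum_distrib_right using *(4) that by (intro sum_mono)
  moreover have "(\<Sum>i\<in>I. B i) \<ge> 0" "(\<Sum>i\<in>I. L i) \<ge> 0" using *(1,2) by (auto intro: sum_nonneg)
  ultimately show ?thesis by blast
qed

lemma geodesic_field_lipschitz:
  assumes g: "regular_metric g" and K: "compact K" "convex K" "fst ` K \<subseteq> spacetime"
  shows "\<exists>B\<ge>0. \<exists>L\<ge>0. (\<forall>z\<in>K. norm (christoffel g (fst z) (snd z) (snd z)) \<le> B \<and> norm (geodesic_field g z) \<le> B) \<and>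
     (\<forall>z\<in>K. \<forall>w\<in>K. norm (geodesic_field g z - geodesic_field g w) \<le> L * norm (z - w))"
proof -
  note C1 = regular_metric_C1[OF g]
  have K': "compact (fst ` K)" "convex (fst ` K)"
    using K by (auto intro!: compact_continuous_image convex_linear_image linear_fst continuous_intros)
  obtain m where m: "m > 0" "\<And>x c. x \<in> fst ` K \<Longrightarrow> m * norm c \<le> (\<Sum>k\<in>Basis. \<bar>g x c k\<bar>)"
    using regular_metric_lower_bound[OF g K'(1) K(3)] by blast
  obtain R where R: "\<And>z. z \<in> K \<Longrightarrow> norm z \<le> R" and R0: "R > 0"
    using compact_imp_bounded[OF K(1)] unfolding bounded_pos by blast
  define c where "c z = christoffel g (fst z) (snd z) (snd z)" for z
  have Ks: "fst z \<in> spacetime" if "z \<in> K" for z using that K(3) by blast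
  have low: "g (fst z) (c z) k = lowered_christoffel g z k" if "z \<in> K" for z k
    unfolding c_def
    by (intro lowered_christoffel[OF C1 open_spacetime] regular_metric_nondegenerate[OF g] Ks that)
  obtain B1 L1 where 1: "B1 \<ge> 0" "L1 \<ge> 0" "\<And>z. z \<in> K \<Longrightarrow> (\<Sum>k\<in>Basis. \<bar>lowered_christoffel g z k\<bar>) \<le> B1"
    "\<And>z w. z \<in> K \<Longrightarrow> w \<in> K \<Longrightarrow>
       (\<Sum>k\<in>Basis. \<bar>lowered_christoffel g z k - lowered_christoffel g w k\<bar>) \<le> L1 * norm (z - w)"
    using uniform_lipschitz_bounds[OF finite_Basis, of K "\<lambda>k z. lowered_christoffel g z k",
        OF lowered_christoffel_lipschitz[OF conjunct1[OF g[unfolded regular_metric_def]] K]] by blast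
  have lbg: "lipschitz_bounded K (\<lambda>z. g (fst z) (fst p) (snd p))" if "p \<in> Basis \<times> Basis" for p
    by (rule lipschitz_bounded_fst, rule C1_lipschitz_bounded[OF _ K' K(3)])
      (use C1 that in \<open>auto simp: C1_sym2_def\<close>)
  have fB: "finite (Basis \<times> Basis :: (event \<times> event) set)" by simp
  obtain B2 L2 where 2: "0 \<le> B2" "0 \<le> L2"
    "\<forall>z\<in>K. (\<Sum>p\<in>Basis \<times> Basis. \<bar>g (fst z) (fst p) (snd p)\<bar>) \<le> B2"
    "\<forall>z\<in>K. \<forall>w\<in>K. (\<Sum>p\<in>Basis \<times> Basis. \<bar>g (fst z) (fst p) (snd p) - g (fst w) (fst p) (snd p)\<bar>) \<le> L2 * norm (z - w)"
    by (rule uniform_lipschitz_bounds[OF fB, of K "\<lambda>p z. g (fst z) (fst p) (snd p)", THEN exE],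
        rule lbg, assumption, elim exE conjE) (rule that)
  have cB: "norm (c z) \<le> B1 / m" if "z \<in> K" for z
    using m(2)[of "fst z" "c z"] 1(3)[OF that] that m(1) by (simp add: low[OF that] pos_le_divide_eq mult.commute)
  \<comment> \<open>\<open>L1\<close> comes from the lowered symbol, \<open>L2\<close> from the
    metric components, weighted by the bound \<open>B1 / m\<close> on the Christoffel vector; the
    outer division by \<open>m\<close> undoes the lowering.\<close>
  define L where "L = (L1 + B1 / m * L2) / m"
  have L: "L \<ge> 0" using 1 2 m by (simp add: L_def)
  have lip: "norm (c z - c w) \<le> L * norm (z - w)" if zw: "z \<in> K" "w \<in> K" for z w
  proof -
    have "m * norm (c z - c w) \<le> (\<Sum>k\<in>Basis. \<bar>g (fst z) (c z) k - g (fst w) (c w) k\<bar>)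
       + norm (c w) * (\<Sum>k\<in>Basis. \<Sum>l\<in>Basis. \<bar>g (fst w) l k - g (fst z) l k\<bar>)"
      using zw K(3) m(2) by (intro sym_bilinear_solution_diff regular_metric_sym[OF g]) auto
    also have "(\<Sum>k\<in>Basis. \<Sum>l\<in>Basis. \<bar>g (fst w) l k - g (fst z) l k\<bar>)
        = (\<Sum>p\<in>Basis \<times> Basis. \<bar>g (fst w) (fst p) (snd p) - g (fst z) (fst p) (snd p)\<bar>)"
      by (subst sum.swap) (simp add: sum.cartesian_product case_prod_beta)
    also have "(\<Sum>k\<in>Basis. \<bar>g (fst z) (c z) k - g (fst w) (c w) k\<bar>) + norm (c w) * \<dots>
        \<le> L1 * norm (z - w) + B1 / m * (L2 * norm (w - z))"
      using 1(1,2) 1(4)[OF zw] 2(1,2) 2(4)[rule_format, OF zw(2,1)] cB[OF zw(2)] m(1)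
      by (intro add_mono mult_mono) (simp_all add: low zw sum_nonneg)
    also have "\<dots> = (L1 + B1 / m * L2) * norm (z - w)" by (simp add: algebra_simps norm_minus_commute)
    finally show ?thesis using m(1) by (simp add: L_def pos_le_divide_eq mult.commute)
  qed
  have nle: "norm (geodesic_field g z - geodesic_field g w) \<le> norm (z - w) + norm (c z - c w)" for z w
  proof -
    have "norm (geodesic_field g z - geodesic_field g w) = norm (snd z - snd w, c w - c z)"
      by (simp add: geodesic_field_def c_def)
    also have "\<dots> \<le> norm (snd z - snd w) + norm (c w - c z)" by (rule norm_Pair_le)
    also have "\<dots> \<le> norm (z - w) + norm (c z - c w)"
      using norm_snd_le_norm[of "z - w"] by (simp add: norm_minus_commute)
    finally show ?thesis .
  qed
  have nle2: "norm (geodesic_field g z) \<le> norm z + norm (c z)" for z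
    using norm_Pair_le[of "snd z" "- c z"] norm_snd_le_norm[of z] by (simp add: geodesic_field_def c_def)
  have "norm (geodesic_field g z - geodesic_field g w) \<le> (1 + L) * norm (z - w)" if "z \<in> K" "w \<in> K" for z w
    using nle[of z w] lip[OF that] by (simp add: distrib_right)
  moreover have "norm (geodesic_field g z) \<le> R + B1 / m" if "z \<in> K" for z
    using nle2[of z] cB[OF that] R[OF that] by linarith
  moreover have "norm (christoffel g (fst z) (snd z) (snd z)) \<le> R + B1 / m" if "z \<in> K" for z
    using cB[OF that] R0 by (simp add: c_def)
  moreover have "R + B1 / m \<ge> 0" "1 + L \<ge> 0" using R0 L 1 m by auto
  ultimately show ?thesis by meson
qed

section \<open>Dependence of the geodesic field on the metric\<close>

definition C1_close :: "real \<Rightarrow> tensor2 \<Rightarrow> tensor2 \<Rightarrow> bool" where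
  "C1_close \<delta> g g0 \<longleftrightarrow> (\<forall>x\<in>spacetime. \<forall>l\<in>Basis. \<forall>m\<in>Basis. \<bar>g x l m - g0 x l m\<bar> \<le> \<delta> \<and>
     (\<forall>i\<in>Basis. \<bar>pd i (\<lambda>z. g z l m) x - pd i (\<lambda>z. g0 z l m) x\<bar> \<le> \<delta>))"

lemma abs_diff_half_le:
  fixes p q r s \<delta> :: real
  assumes "\<bar>p - q\<bar> \<le> \<delta>" "\<bar>r - s\<bar> \<le> \<delta>"
  shows "\<bar>(q - p) - (s - r) / 2\<bar> \<le> 2 * \<delta>"
  using assms by (auto simp: abs_if field_simps split: if_splits)

lemma lowered_christoffel_close:
  assumes close: "C1_close \<delta> g g0" and z: "fst z \<in> spacetime" "norm z \<le> R" and k: "k \<in> Basis"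
  shows "\<bar>lowered_christoffel g0 z k - lowered_christoffel g z k\<bar> \<le>
     (\<Sum>i\<in>(Basis::event set). \<Sum>j\<in>(Basis::event set). 2 * R * R) * \<delta>"
proof -
  have R: "\<bar>snd z \<bullet> i\<bar> \<le> R" if "i \<in> Basis" for i
    using Basis_le_norm[OF that, of "snd z"] norm_snd_le_norm[of z] z(2) by linarith
  have R0: "R \<ge> 0" using z(2) norm_ge_zero order_trans by blast
  define D where "D i j = (pd i (\<lambda>x. g0 x j k) (fst z) - pd i (\<lambda>x. g x j k) (fst z))
     - (pd k (\<lambda>x. g0 x i j) (fst z) - pd k (\<lambda>x. g x i j) (fst z)) / 2" for i j
  have D: "\<bar>D i j\<bar> \<le> 2 * \<delta>" if "i \<in> Basis" "j \<in> Basis" for i j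
  proof -
    have "\<bar>pd i (\<lambda>x. g x j k) (fst z) - pd i (\<lambda>x. g0 x j k) (fst z)\<bar> \<le> \<delta>"
      "\<bar>pd k (\<lambda>x. g x i j) (fst z) - pd k (\<lambda>x. g0 x i j) (fst z)\<bar> \<le> \<delta>"
      using close z(1) k that unfolding C1_close_def by blast+
    then show ?thesis unfolding D_def by (rule abs_diff_half_le)
  qed
  have "lowered_christoffel g0 z k - lowered_christoffel g z k
      = (\<Sum>i\<in>Basis. \<Sum>j\<in>Basis. (snd z \<bullet> i) * (snd z \<bullet> j) * D i j)"
    unfolding lowered_christoffel_def D_def sum_subtractf[symmetric]
    by (intro sum.cong refl) (simp add: field_simps)
  also have "\<bar>\<dots>\<bar> \<le> (\<Sum>i\<in>(Basis::event set). \<Sum>j\<in>(Basis::event set). R * R * (2 * \<delta>))"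
  proof (intro order_trans[OF sum_abs] sum_mono)
    fix i j :: event assume ij: "i \<in> Basis" "j \<in> Basis"
    show "\<bar>(snd z \<bullet> i) * (snd z \<bullet> j) * D i j\<bar> \<le> R * R * (2 * \<delta>)"
      unfolding abs_mult using R ij D R0 by (intro mult_mono) auto
  qed
  also have "\<dots> = (\<Sum>i\<in>(Basis::event set). \<Sum>j\<in>(Basis::event set). 2 * R * R) * \<delta>"
    by (simp add: algebra_simps)
  finally show ?thesis .
qed

text \<open>\<open>\<delta>\<close> must not depend on \<open>g\<close>, so only the lower bound
  \<open>m\<close> of \<open>g0\<close> is available. The unknown size of the Christoffel vector
  \<open>c\<close> of \<open>g\<close> is bounded by \<open>B + norm (c0 - c)\<close>, and the last
  term is absorbed on the left.\<close>

lemma geodesic_field_close: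
  assumes g0: "regular_metric g0" and K: "compact K" "convex K" "fst ` K \<subseteq> spacetime" and \<eta>: "\<eta> > 0"
  shows "\<exists>\<delta>>0. \<forall>g. regular_metric g \<and> C1_close \<delta> g g0 \<longrightarrow>
     (\<forall>z\<in>K. norm (geodesic_field g z - geodesic_field g0 z) \<le> \<eta>)"
proof -
  have K': "compact (fst ` K)" using K by (auto intro!: compact_continuous_image continuous_intros)
  obtain m where m: "m > 0" "\<And>x c. x \<in> fst ` K \<Longrightarrow> m * norm c \<le> (\<Sum>k\<in>Basis. \<bar>g0 x c k\<bar>)"
    using regular_metric_lower_bound[OF g0 K' K(3)] by blast
  obtain B where B: "B \<ge> 0" "\<And>z. z \<in> K \<Longrightarrow> norm (christoffel g0 (fst z) (snd z) (snd z)) \<le> B"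
    using geodesic_field_lipschitz[OF g0 K] by blast
  obtain R where R: "\<And>z. z \<in> K \<Longrightarrow> norm z \<le> R" "R > 0"
    using compact_imp_bounded[OF K(1)] unfolding bounded_pos by blast
  define A where "A = (\<Sum>k\<in>(Basis::event set). \<Sum>i\<in>(Basis::event set). \<Sum>j\<in>(Basis::event set). 2 * R * R)"
  define N where "N = (\<Sum>k\<in>(Basis::event set). \<Sum>l\<in>(Basis::event set). (1::real))"
  have A: "A \<ge> 0" and N: "N \<ge> 0" using R by (auto simp: A_def N_def intro!: sum_nonneg)
  \<comment> \<open>The first entry makes the absorbed term at most half of the left side; the
    second makes what remains at most \<open>\<eta> * m / 2\<close>. The summands 1 keep the
    denominators positive.\<close>
  define \<delta> where "\<delta> = min (m / (2 * (N + 1))) (\<eta> * m / (2 * (A + B * N + 1)))"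
  have BN: "B * N \<ge> 0" using B N by simp
  have \<delta>: "\<delta> > 0" using m \<eta> A BN N by (auto simp: \<delta>_def intro!: divide_pos_pos)
  have \<delta>1: "N * \<delta> \<le> m / 2"
  proof -
    have "\<delta> * (2 * (N + 1)) \<le> m" using N by (simp add: \<delta>_def flip: pos_le_divide_eq)
    then show ?thesis using \<delta> by (simp add: algebra_simps)
  qed
  have \<delta>2: "(A + B * N) * \<delta> \<le> \<eta> * m / 2"
  proof -
    have "\<delta> * (2 * (A + B * N + 1)) \<le> \<eta> * m" using A BN by (simp add: \<delta>_def flip: pos_le_divide_eq)
    then show ?thesis using \<delta> by (simp add: algebra_simps)
  qed
  have "norm (geodesic_field g z - geodesic_field g0 z) \<le> \<eta>"
    if g: "regular_metric g" "C1_close \<delta> g g0" and z: "z \<in> K" for g z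
  proof -
    define c where "c = christoffel g (fst z) (snd z) (snd z)"
    define c0 where "c0 = christoffel g0 (fst z) (snd z) (snd z)"
    have zs: "fst z \<in> spacetime" using z K(3) by blast
    have c: "g (fst z) c k = lowered_christoffel g z k" for k
      unfolding c_def using zs g regular_metric_nondegenerate
      by (intro lowered_christoffel[OF regular_metric_C1 open_spacetime]) auto
    have c0: "g0 (fst z) c0 k = lowered_christoffel g0 z k" for k
      unfolding c0_def using zs g0 regular_metric_nondegenerate
      by (intro lowered_christoffel[OF regular_metric_C1 open_spacetime]) auto
    have "m * norm (c0 - c) \<le> (\<Sum>k\<in>Basis. \<bar>g0 (fst z) c0 k - g (fst z) c k\<bar>)
       + norm c * (\<Sum>k\<in>Basis. \<Sum>l\<in>Basis. \<bar>g (fst z) l k - g0 (fst z) l k\<bar>)"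
      using zs z m(2) by (intro sym_bilinear_solution_diff regular_metric_sym g g0) auto
    also have "\<dots> \<le> A * \<delta> + norm c * (N * \<delta>)"
    proof (intro add_mono mult_left_mono)
      show "(\<Sum>k\<in>Basis. \<bar>g0 (fst z) c0 k - g (fst z) c k\<bar>) \<le> A * \<delta>"
        unfolding A_def sum_distrib_right c c0
        using lowered_christoffel_close[OF g(2) zs R(1)[OF z]] by (intro sum_mono) (simp only: sum_distrib_right)
      have "(\<Sum>k\<in>Basis. \<Sum>l\<in>Basis. \<bar>g (fst z) l k - g0 (fst z) l k\<bar>)
          \<le> (\<Sum>k\<in>(Basis::event set). \<Sum>l\<in>(Basis::event set). 1 * \<delta>)"
        using g(2) zs unfolding C1_close_def by (intro sum_mono) simp
      then show "(\<Sum>k\<in>Basis. \<Sum>l\<in>Basis. \<bar>g (fst z) l k - g0 (fst z) l k\<bar>) \<le> N * \<delta>"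
        unfolding N_def sum_distrib_right by simp
    qed auto
    also have "norm c * (N * \<delta>) \<le> (B + norm (c0 - c)) * (N * \<delta>)"
    proof (rule mult_right_mono)
      have "norm c0 \<le> B" using B(2)[OF z] by (simp add: c0_def)
      then show "norm c \<le> B + norm (c0 - c)"
        using norm_triangle_sub[of c c0] by (simp add: norm_minus_commute)
    qed (use N \<delta> in auto)
    also have "\<dots> = B * N * \<delta> + norm (c0 - c) * (N * \<delta>)" by (simp add: algebra_simps)
    also have "norm (c0 - c) * (N * \<delta>) \<le> norm (c0 - c) * (m / 2)" using \<delta>1 by (intro mult_left_mono) auto
    finally have "m * norm (c0 - c) \<le> (A + B * N) * \<delta> + m * norm (c0 - c) / 2"
      by (simp add: algebra_simps)
    then have "m * norm (c0 - c) \<le> m * \<eta>" using \<delta>2 by (simp add: algebra_simps)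
    then have "norm (c0 - c) \<le> \<eta>" using m by simp
    moreover have "geodesic_field g z - geodesic_field g0 z = (0, c0 - c)"
      by (simp add: geodesic_field_def c_def c0_def)
    ultimately show ?thesis by (simp add: norm_Pair)
  qed
  with \<delta> show ?thesis by blast
qed

section \<open>Compact convex boxes in phase space\<close>

definition phase_box :: "real \<Rightarrow> real \<Rightarrow> (event \<times> event) set" where
  "phase_box m R = {z. m \<le> fst (fst z)} \<inter> cball 0 R"

text \<open>Convexity serves both the mean value inequality and the closest point projection;
  \<open>m > 0\<close> keeps the box away from the edge \<open>t = 0\<close> of
  \<open>spacetime\<close>.\<close>

lemma phase_box:
  assumes "m > 0"
  shows "compact (phase_box m R)" "convex (phase_box m R)" "fst ` phase_box m R \<subseteq> spacetime"
proof -
  have cl: "closed {z::event \<times> event. m \<le> fst (fst z)}"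
    by (intro closed_Collect_le continuous_intros)
  show "compact (phase_box m R)" unfolding phase_box_def
    by (intro closed_Int_compact cl compact_cball)
  have "linear (\<lambda>z::event \<times> event. fst (fst z))" by (intro linearI) auto
  then have "convex ((\<lambda>z::event \<times> event. fst (fst z)) -` {m..})"
    by (intro convex_linear_vimage) auto
  then have "convex {z::event \<times> event. m \<le> fst (fst z)}" by (simp add: vimage_def)
  then show "convex (phase_box m R)" unfolding phase_box_def by (intro convex_Int convex_cball)
  show "fst ` phase_box m R \<subseteq> spacetime" using assms by (auto simp: phase_box_def spacetime_def)
qed

text \<open>The factor 2 and the summand 1 leave a margin, \<open>m\<close> in time and 1 in norm,
  inside which a perturbed curve stays in the box.\<close>

lemma compact_in_phase_box:
  assumes C: "compact C" "fst ` C \<subseteq> spacetime"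
  shows "\<exists>m>0. \<exists>R. \<forall>z\<in>C. 2 * m \<le> fst (fst z) \<and> norm z + 1 \<le> R"
proof (cases "C = {}")
  case False
  have "continuous_on C (\<lambda>z. fst (fst z))" by (intro continuous_intros)
  then obtain p where p: "p \<in> C" "\<And>z. z \<in> C \<Longrightarrow> fst (fst p) \<le> fst (fst z)"
    using continuous_attains_inf[OF C(1) False] by blast
  have "fst (fst p) > 0" using p(1) C(2) by (auto simp: spacetime_def)
  moreover obtain R where "\<And>z. z \<in> C \<Longrightarrow> norm z \<le> R"
    using compact_imp_bounded[OF C(1)] unfolding bounded_iff by blast
  ultimately show ?thesis using p by (intro exI[of _ "fst (fst p) / 2"] conjI exI[of _ "R + 1"]) auto
qed (auto intro: exI[of _ 1])

section \<open>Geodesics as curves in phase space\<close>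

definition phase_curve :: "tensor2 \<Rightarrow> event \<times> event \<Rightarrow> real set \<Rightarrow> (real \<Rightarrow> event \<times> event) \<Rightarrow> bool" where
  "phase_curve g p J z \<longleftrightarrow> open J \<and> is_interval J \<and> 0 \<in> J \<and> z 0 = p \<and>
     (\<forall>\<tau>\<in>J. fst (z \<tau>) \<in> spacetime \<and> (z has_vector_derivative geodesic_field g (z \<tau>)) (at \<tau>))"

lemma geodesic_on_iff_phase_curve:
  "geodesic_on g x \<theta> J \<gamma> \<longleftrightarrow> (\<exists>z. phase_curve g (x, \<theta>) J z \<and> \<gamma> = fst \<circ> z)"
proof
  assume *: "geodesic_on g x \<theta> J \<gamma>"
  obtain \<gamma>' where \<gamma>': "\<gamma> 0 = x" "\<gamma>' 0 = \<theta>" "\<And>\<tau>. \<tau> \<in> J \<Longrightarrow> (\<gamma> has_vector_derivative \<gamma>' \<tau>) (at \<tau>)"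
      "\<And>\<tau>. \<tau> \<in> J \<Longrightarrow> (\<gamma>' has_vector_derivative - christoffel g (\<gamma> \<tau>) (\<gamma>' \<tau>) (\<gamma>' \<tau>)) (at \<tau>)"
    using * unfolding geodesic_on_def by blast
  have "((\<lambda>\<tau>. (\<gamma> \<tau>, \<gamma>' \<tau>)) has_vector_derivative geodesic_field g (\<gamma> \<tau>, \<gamma>' \<tau>)) (at \<tau>)" if "\<tau> \<in> J" for \<tau>
    unfolding geodesic_field_def using has_vector_derivative_Pair[OF \<gamma>'(3,4)[OF that]] by simp
  moreover have "fst (\<gamma> \<tau>, \<gamma>' \<tau>) \<in> spacetime" if "\<tau> \<in> J" for \<tau>
    using * that unfolding geodesic_on_def by auto
  ultimately have "phase_curve g (x, \<theta>) J (\<lambda>\<tau>. (\<gamma> \<tau>, \<gamma>' \<tau>))"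
    using * \<gamma>'(1,2) unfolding phase_curve_def geodesic_on_def by blast
  then show "\<exists>z. phase_curve g (x, \<theta>) J z \<and> \<gamma> = fst \<circ> z" by (intro exI[of _ "\<lambda>\<tau>. (\<gamma> \<tau>, \<gamma>' \<tau>)"]) auto
next
  assume "\<exists>z. phase_curve g (x, \<theta>) J z \<and> \<gamma> = fst \<circ> z"
  then obtain z where z: "phase_curve g (x, \<theta>) J z" "\<gamma> = fst \<circ> z" by blast
  have d: "(z has_vector_derivative geodesic_field g (z \<tau>)) (at \<tau>)" if "\<tau> \<in> J" for \<tau>
    using z(1) that unfolding phase_curve_def by blast
  have "((fst \<circ> z) has_vector_derivative (snd \<circ> z) \<tau>) (at \<tau>)"
    "((snd \<circ> z) has_vector_derivative - christoffel g ((fst \<circ> z) \<tau>) ((snd \<circ> z) \<tau>) ((snd \<circ> z) \<tau>)) (at \<tau>)"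
    if "\<tau> \<in> J" for \<tau>
    using bounded_linear.has_vector_derivative[OF bounded_linear_fst d[OF that]]
      bounded_linear.has_vector_derivative[OF bounded_linear_snd d[OF that]]
    by (simp_all add: geodesic_field_def o_def)
  then show "geodesic_on g x \<theta> J \<gamma>"
    unfolding geodesic_on_def using z by (intro conjI exI[of _ "snd \<circ> z"]) (auto simp: phase_curve_def)
qed

text \<open>Both arcs from 0 to \<open>\<tau>\<close> are compact, hence lie in one phase box where
  the field is Lipschitz; \<open>flow_dist_le\<close> with error 0 then identifies them.\<close>

lemma phase_curve_unique:
  assumes g: "regular_metric g" and z1: "phase_curve g p J1 z1" and z2: "phase_curve g p J2 z2"
    and \<tau>: "\<tau> \<in> J1" "\<tau> \<in> J2"
  shows "z1 \<tau> = z2 \<tau>"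
proof -
  \<comment> \<open>\<open>flow_dist_le\<close> runs forward from 0; the sign
    \<open>\<sigma>\<close> reverses time when \<open>\<tau>\<close> is negative.\<close>
  define \<sigma> where "\<sigma> = (if \<tau> \<ge> 0 then 1 else - 1 :: real)"
  define T where "T = \<bar>\<tau>\<bar>"
  have \<sigma>: "\<sigma> * T = \<tau>" "\<bar>\<sigma>\<bar> = 1" and T: "T \<ge> 0" by (auto simp: \<sigma>_def T_def)
  have J: "\<sigma> * s \<in> J1 \<inter> J2" if "s \<in> {0..T}" for s
  proof -
    have "0 \<in> J1 \<inter> J2" "\<tau> \<in> J1 \<inter> J2" "is_interval (J1 \<inter> J2)"
      using z1 z2 \<tau> by (auto simp: phase_curve_def intro: is_interval_Int)
    moreover have "0 \<le> \<sigma> * s \<and> \<sigma> * s \<le> \<tau> \<or> \<tau> \<le> \<sigma> * s \<and> \<sigma> * s \<le> 0"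
      using that by (auto simp: \<sigma>_def T_def)
    ultimately show ?thesis using is_interval_1[of "J1 \<inter> J2"] by blast
  qed
  have der: "((\<lambda>s. z (\<sigma> * s)) has_vector_derivative \<sigma> *\<^sub>R geodesic_field g (z (\<sigma> * s))) (at s within {0..T})"
    and sp: "fst (z (\<sigma> * s)) \<in> spacetime"
    if z: "phase_curve g p J z" "J = J1 \<or> J = J2" and s: "s \<in> {0..T}" for z J s
  proof -
    have "\<sigma> * s \<in> J" using J[OF s] z(2) by auto
    then have "(z has_vector_derivative geodesic_field g (z (\<sigma> * s))) (at (\<sigma> * s))" "fst (z (\<sigma> * s)) \<in> spacetime"
      using z(1) unfolding phase_curve_def by blast+
    moreover have "((\<lambda>s. \<sigma> * s) has_vector_derivative \<sigma>) (at s)"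
      by (auto intro!: derivative_eq_intros simp flip: has_real_derivative_iff_has_vector_derivative)
    ultimately show "((\<lambda>s. z (\<sigma> * s)) has_vector_derivative \<sigma> *\<^sub>R geodesic_field g (z (\<sigma> * s))) (at s within {0..T})"
      "fst (z (\<sigma> * s)) \<in> spacetime"
      using vector_diff_chain_at[of "\<lambda>s. \<sigma> * s" \<sigma> s z "geodesic_field g (z (\<sigma> * s))"]
      unfolding o_def by (blast intro: has_vector_derivative_at_within)+
  qed
  note der1 = der[OF z1 disjI1[OF refl]] and der2 = der[OF z2 disjI2[OF refl]]
  note sp1 = sp[OF z1 disjI1[OF refl]] and sp2 = sp[OF z2 disjI2[OF refl]]
  define C where "C = (\<lambda>s. z1 (\<sigma> * s)) ` {0..T} \<union> (\<lambda>s. z2 (\<sigma> * s)) ` {0..T}"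
  have "continuous_on {0..T} (\<lambda>s. z1 (\<sigma> * s))" "continuous_on {0..T} (\<lambda>s. z2 (\<sigma> * s))"
    unfolding continuous_on_eq_continuous_within
    by (rule ballI, rule has_vector_derivative_continuous, erule der1,
        rule ballI, rule has_vector_derivative_continuous, erule der2)
  then have "compact C" unfolding C_def by (intro compact_Un compact_continuous_image) auto
  moreover have "fst ` C \<subseteq> spacetime" unfolding C_def using sp1 sp2 by (simp add: image_Un image_subset_iff)
  ultimately obtain m R where m: "m > 0" "\<And>z. z \<in> C \<Longrightarrow> 2 * m \<le> fst (fst z) \<and> norm z + 1 \<le> R"
    using compact_in_phase_box by meson
  have CK: "z \<in> phase_box m R" if "z \<in> C" for z
    using m(2)[OF that] m(1) by (auto simp: phase_box_def)
  obtain L where L: "L \<ge> 0" "\<And>z w. z \<in> phase_box m R \<Longrightarrow> w \<in> phase_box m R \<Longrightarrow>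
      norm (geodesic_field g z - geodesic_field g w) \<le> L * norm (z - w)"
    using geodesic_field_lipschitz[OF g phase_box[OF m(1)]] by blast
  have "(norm (z1 (\<sigma> * T) - z2 (\<sigma> * T)))\<^sup>2 \<le> exp ((2 * L + 1) * T) * (0\<^sup>2 * T)"
  proof (rule flow_dist_le[where F = "\<lambda>z. \<sigma> *\<^sub>R geodesic_field g z" and G = "\<lambda>z. \<sigma> *\<^sub>R geodesic_field g z", OF der1 der2 _ _ L(1)])
    show "norm (\<sigma> *\<^sub>R geodesic_field g (z1 (\<sigma> * s)) - \<sigma> *\<^sub>R geodesic_field g (z2 (\<sigma> * s)))
        \<le> L * norm (z1 (\<sigma> * s) - z2 (\<sigma> * s))" if "s \<in> {0..T}" for s
    proof -
      have "z1 (\<sigma> * s) \<in> C" "z2 (\<sigma> * s) \<in> C" using that unfolding C_def by blast+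
      then show ?thesis using L(2)[OF CK CK] \<sigma>(2) by (simp flip: scaleR_diff_right)
    qed
    show "z1 (\<sigma> * 0) = z2 (\<sigma> * 0)" using z1 z2 by (simp add: phase_curve_def)
  qed (use T in auto)
  then show ?thesis using \<sigma>(1) by simp
qed

lemma phase_curve_subset_geod_dom: "phase_curve g (x, \<theta>) J z \<Longrightarrow> J \<subseteq> geod_dom g x \<theta>"
  unfolding geod_dom_def geodesic_on_iff_phase_curve by blast

lemma geod_eq_phase_curve:
  assumes g: "regular_metric g" and z: "phase_curve g (x, \<theta>) J z" and \<tau>: "\<tau> \<in> J"
  shows "geod g x \<theta> \<tau> = fst (z \<tau>)"
  unfolding geod_def
proof (rule the_equality)
  show "\<exists>J \<gamma>. geodesic_on g x \<theta> J \<gamma> \<and> \<tau> \<in> J \<and> fst (z \<tau>) = \<gamma> \<tau>"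
    using z \<tau> unfolding geodesic_on_iff_phase_curve by (intro exI[of _ J] exI[of _ "fst \<circ> z"]) auto
  show "p = fst (z \<tau>)" if "\<exists>J \<gamma>. geodesic_on g x \<theta> J \<gamma> \<and> \<tau> \<in> J \<and> p = \<gamma> \<tau>" for p
    using that phase_curve_unique[OF g _ z _ \<tau>] unfolding geodesic_on_iff_phase_curve by force
qed

lemma geod_vel_eq_phase_curve:
  assumes g: "regular_metric g" and z: "phase_curve g (x, \<theta>) J z" and \<tau>: "\<tau> \<in> J"
  shows "geod_vel g x \<theta> \<tau> = snd (z \<tau>)"
  unfolding geod_vel_def
proof (rule vector_derivative_at)
  have "((\<lambda>\<tau>. fst (z \<tau>)) has_vector_derivative fst (geodesic_field g (z \<tau>))) (at \<tau>)"
    using z \<tau> unfolding phase_curve_def by (blast intro: bounded_linear.has_vector_derivative[OF bounded_linear_fst])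
  then have "((\<lambda>\<tau>. fst (z \<tau>)) has_vector_derivative snd (z \<tau>)) (at \<tau>)" by (simp add: geodesic_field_def)
  then show "(geod g x \<theta> has_vector_derivative snd (z \<tau>)) (at \<tau>)"
    by (rule has_vector_derivative_transform_within_open[where S=J])
      (use z \<tau> geod_eq_phase_curve[OF g z] in \<open>auto simp: phase_curve_def\<close>)
qed

definition geod_phase :: "tensor2 \<Rightarrow> event \<Rightarrow> event \<Rightarrow> real \<Rightarrow> event \<times> event" where
  "geod_phase g x \<theta> \<tau> = (geod g x \<theta> \<tau>, geod_vel g x \<theta> \<tau>)"

lemma geod_phase_eq:
  assumes "regular_metric g" "phase_curve g (x, \<theta>) J z" "\<tau> \<in> J"
  shows "geod_phase g x \<theta> \<tau> = z \<tau>"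
  using geod_eq_phase_curve[OF assms] geod_vel_eq_phase_curve[OF assms] by (simp add: geod_phase_def)

text \<open>All local domains contain 0, so their union is connected, and near each parameter
  \<open>geod_phase\<close> coincides with a local solution. That any solution exists is supplied by
  \<open>flrw_ray_reaches\<close> for the background and by \<open>geod_stable\<close> for the
  perturbed metrics.\<close>

lemma phase_curve_geod:
  assumes g: "regular_metric g" and ne: "geod_dom g x \<theta> \<noteq> {}"
  shows "phase_curve g (x, \<theta>) (geod_dom g x \<theta>) (geod_phase g x \<theta>)"
proof -
  have Jz: "\<exists>J z. phase_curve g (x, \<theta>) J z \<and> \<tau> \<in> J" if "\<tau> \<in> geod_dom g x \<theta>" for \<tau>
    using that unfolding geod_dom_def geodesic_on_iff_phase_curve by blast
  have J: "open J \<and> is_interval J \<and> 0 \<in> J" if "J \<in> {J. \<exists>\<gamma>. geodesic_on g x \<theta> J \<gamma>}" for J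
    using that unfolding geodesic_on_def by blast
  have op: "open (geod_dom g x \<theta>)" unfolding geod_dom_def using J by (intro open_Union) blast
  moreover have "is_interval (geod_dom g x \<theta>)"
    unfolding is_interval_connected_1 geod_dom_def
  proof (rule connected_Union)
    have "0 \<in> \<Inter> {J. \<exists>\<gamma>. geodesic_on g x \<theta> J \<gamma>}" using J by blast
    then show "\<Inter> {J. \<exists>\<gamma>. geodesic_on g x \<theta> J \<gamma>} \<noteq> {}" by blast
  qed (use J is_interval_connected_1 in blast)
  moreover obtain J z where *: "phase_curve g (x, \<theta>) J z" using ne Jz by blast
  then have "0 \<in> J" "z 0 = (x, \<theta>)" unfolding phase_curve_def by blast+
  then have "0 \<in> geod_dom g x \<theta>" "geod_phase g x \<theta> 0 = (x, \<theta>)"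
    using geod_phase_eq[OF g *] phase_curve_subset_geod_dom[OF *] by auto
  moreover have "fst (geod_phase g x \<theta> \<tau>) \<in> spacetime \<and>
      (geod_phase g x \<theta> has_vector_derivative geodesic_field g (geod_phase g x \<theta> \<tau>)) (at \<tau>)"
    if \<tau>: "\<tau> \<in> geod_dom g x \<theta>" for \<tau>
  proof -
    obtain J z where *: "phase_curve g (x, \<theta>) J z" "\<tau> \<in> J" using Jz[OF \<tau>] by blast
    have "(z has_vector_derivative geodesic_field g (z \<tau>)) (at \<tau>)" "fst (z \<tau>) \<in> spacetime" "open J"
      using * unfolding phase_curve_def by blast+
    then show ?thesis
      using has_vector_derivative_transform_within_open[of z _ \<tau> J "geod_phase g x \<theta>"] *(2)
        geod_phase_eq[OF g *(1)] by metis
  qed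
  ultimately show ?thesis unfolding phase_curve_def by blast
qed

section \<open>Stability of geodesics under small changes of the metric\<close>

text \<open>The vector field is extended from a convex phase box by composing with the closest point
  projection, which makes the extension globally bounded and Lipschitz.\<close>

lemma geod_stable:
  assumes g0: "regular_metric g0" and T: "T \<ge> 0" "T \<in> geod_dom g0 x \<theta>" and \<eta>: "\<eta> > 0"
  shows "\<exists>\<delta>>0. \<forall>g. regular_metric g \<and> C1_close \<delta> g g0 \<longrightarrow> {0..T} \<subseteq> geod_dom g x \<theta> \<and>
     (\<forall>\<tau>\<in>{0..T}. norm (geod_phase g x \<theta> \<tau> - geod_phase g0 x \<theta> \<tau>) \<le> \<eta>)"
proof -
  define z0 where "z0 = geod_phase g0 x \<theta>"
  have pc: "phase_curve g0 (x, \<theta>) (geod_dom g0 x \<theta>) z0"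
    unfolding z0_def using T by (intro phase_curve_geod[OF g0]) auto
  have dom: "{0..T} \<subseteq> geod_dom g0 x \<theta>"
    using pc T unfolding phase_curve_def is_interval_1 by auto
  have der0: "(z0 has_vector_derivative geodesic_field g0 (z0 s)) (at s within {0..T})"
    and sp: "fst (z0 s) \<in> spacetime" if "s \<in> {0..T}" for s
    using pc that dom unfolding phase_curve_def by (blast intro: has_vector_derivative_at_within)+
  have "continuous_on {0..T} z0"
    by (meson der0 continuous_on_eq_continuous_within has_vector_derivative_continuous)
  then have "compact (z0 ` {0..T})" by (rule compact_continuous_image) auto
  moreover have "fst ` z0 ` {0..T} \<subseteq> spacetime" using sp by blast
  ultimately obtain m R where m: "m > 0" and mR: "\<And>s. s \<in> {0..T} \<Longrightarrow> 2 * m \<le> fst (fst (z0 s)) \<and> norm (z0 s) + 1 \<le> R"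
    using compact_in_phase_box by (metis imageI)
  define K where "K = phase_box m R"
  note K = phase_box[OF m, of R, folded K_def]
  have z0K: "z0 s \<in> K" if "s \<in> {0..T}" for s
    using mR[OF that] m by (auto simp: K_def phase_box_def)
  have Kne: "K \<noteq> {}" using z0K[of 0] T by auto
  have Kcl: "closed K" using K(1) compact_imp_closed by blast
  obtain L where L: "L \<ge> 0" "\<And>z w. z \<in> K \<Longrightarrow> w \<in> K \<Longrightarrow>
      norm (geodesic_field g0 z - geodesic_field g0 w) \<le> L * norm (z - w)"
    using geodesic_field_lipschitz[OF g0 K] by blast
  \<comment> \<open>Strictly below both margins left by \<open>compact_in_phase_box\<close>, so a
    curve within \<open>r\<close> of \<open>z0\<close> stays in the interior of the box.\<close>
  define r where "r = min (min m 1 / 2) \<eta>"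
  have r: "r > 0" "r < m" "r < 1" "r \<le> \<eta>" using m \<eta> by (auto simp: r_def)
  define E where "E = exp ((2 * L + 1) * T) * T"
  have E: "E \<ge> 0" using T by (simp add: E_def)
  \<comment> \<open>Chosen so that the bound \<open>\<delta>'\<^sup>2 * E\<close> of
    \<open>flow_dist_le\<close> is at most \<open>r\<^sup>2\<close>; the summand 1 covers
    \<open>E = 0\<close>.\<close>
  define \<delta>' where "\<delta>' = r / sqrt (E + 1)"
  have \<delta>': "\<delta>' > 0" using r E by (simp add: \<delta>'_def)
  have \<delta>'E: "\<delta>'\<^sup>2 * E \<le> r\<^sup>2"
  proof -
    have "\<delta>'\<^sup>2 * E = r\<^sup>2 * (E / (E + 1))" using E by (simp add: \<delta>'_def power_divide)
    also have "\<dots> \<le> r\<^sup>2 * 1" using E by (intro mult_left_mono) auto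
    finally show ?thesis by simp
  qed
  obtain \<delta> where \<delta>: "\<delta> > 0" "\<And>g z. regular_metric g \<Longrightarrow> C1_close \<delta> g g0 \<Longrightarrow> z \<in> K \<Longrightarrow>
      norm (geodesic_field g z - geodesic_field g0 z) \<le> \<delta>'"
    using geodesic_field_close[OF g0 K \<delta>'] by blast
  have "{0..T} \<subseteq> geod_dom g x \<theta> \<and> (\<forall>\<tau>\<in>{0..T}. norm (geod_phase g x \<theta> \<tau> - z0 \<tau>) \<le> \<eta>)"
    if g: "regular_metric g" "C1_close \<delta> g g0" for g
  proof -
    define P where "P = closest_point K"
    have PK: "P z \<in> K" for z unfolding P_def by (rule closest_point_in_set[OF Kcl Kne])
    have Pid: "P z = z" if "z \<in> K" for z unfolding P_def using that by (rule closest_point_self)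
    have Plip: "norm (P z - P w) \<le> norm (z - w)" for z w
      using closest_point_lipschitz[OF K(2) Kcl Kne, of z w] by (simp add: P_def dist_norm)
    obtain B Lg where B: "\<And>z. z \<in> K \<Longrightarrow> norm (geodesic_field g z) \<le> B"
      and Lg: "Lg \<ge> 0" "\<And>z w. z \<in> K \<Longrightarrow> w \<in> K \<Longrightarrow>
        norm (geodesic_field g z - geodesic_field g w) \<le> Lg * norm (z - w)"
      using geodesic_field_lipschitz[OF g(1) K] by blast
    have "norm (geodesic_field g (P z) - geodesic_field g (P w)) \<le> Lg * norm (z - w)" for z w
      using Lg(2)[OF PK PK, of z w] mult_left_mono[OF Plip[of z w] Lg(1)] by linarith
    from global_flow_exists[of "\<lambda>z. geodesic_field g (P z)", OF B[OF PK] this, of "(x, \<theta>)"]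
    obtain w where w: "w 0 = (x, \<theta>)" "\<And>t. (w has_vector_derivative geodesic_field g (P (w t))) (at t)"
      by blast
    have close: "norm (w s - z0 s) \<le> r" if s: "s \<in> {0..T}" for s
    proof -
      have "(norm (w s - z0 s))\<^sup>2 \<le> exp ((2 * L + 1) * s) * (\<delta>'\<^sup>2 * s)"
      proof (rule flow_dist_le[where F = "\<lambda>z. geodesic_field g (P z)" and G = "\<lambda>z. geodesic_field g0 (P z)", OF _ _ _ _ L(1) _ s])
        fix s assume s: "s \<in> {0..T}"
        show "(w has_vector_derivative geodesic_field g (P (w s))) (at s within {0..T})"
          by (rule has_vector_derivative_at_within[OF w(2)])
        show "(z0 has_vector_derivative geodesic_field g0 (P (z0 s))) (at s within {0..T})"
          using der0[OF s] Pid[OF z0K[OF s]] by simp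
        show "norm (geodesic_field g (P (w s)) - geodesic_field g0 (P (w s))) \<le> \<delta>'"
          by (rule \<delta>(2)[OF g PK])
        show "norm (geodesic_field g0 (P (w s)) - geodesic_field g0 (P (z0 s))) \<le> L * norm (w s - z0 s)"
          using L(2)[OF PK PK, of "w s" "z0 s"] mult_left_mono[OF Plip[of "w s" "z0 s"] L(1)] by linarith
      next
        show "w 0 = z0 0" using w(1) pc by (simp add: phase_curve_def)
      qed
      also have "\<dots> \<le> exp ((2 * L + 1) * T) * (\<delta>'\<^sup>2 * T)"
        using s L(1) by (intro mult_mono) auto
      also have "\<dots> \<le> r\<^sup>2" using \<delta>'E by (simp add: E_def mult_ac)
      finally show ?thesis using r by (simp add: power2_le_iff_abs_le)
    qed
    \<comment> \<open>An open set inside \<open>K\<close>, where the projection \<open>P\<close> is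
      the identity: as long as \<open>w\<close> is in \<open>U\<close>, it solves the true geodesic
      equation of \<open>g\<close>.\<close>
    define U where "U = {z::event \<times> event. m < fst (fst z)} \<inter> {z. norm z < R}"
    have U: "open U" unfolding U_def by (intro open_Int open_Collect_less continuous_intros)
    have UK: "U \<subseteq> K" by (auto simp: U_def K_def phase_box_def)
    have wU: "w s \<in> U" if s: "s \<in> {0..T}" for s
    proof -
      have "\<bar>fst (fst (w s)) - fst (fst (z0 s))\<bar> \<le> norm (w s - z0 s)"
        using norm_fst_le_norm[of "fst (w s - z0 s)"] norm_fst_le_norm[of "w s - z0 s"] by simp
      then have "m < fst (fst (w s))" using close[OF s] mR[OF s] r by linarith
      moreover have "norm (w s) < R" using norm_triangle_sub[of "w s" "z0 s"] close[OF s] mR[OF s] r by linarith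
      ultimately show ?thesis by (simp add: U_def)
    qed
    have contw: "continuous_on UNIV w"
      by (meson w(2) continuous_at_imp_continuous_on has_vector_derivative_continuous)
    have "open (w -` U)" using contw U by (simp add: open_vimage)
    moreover have "{0..T} \<subseteq> w -` U" using wU by blast
    ultimately obtain e where e: "e > 0" "(\<Union>s\<in>{0..T}. ball s e) \<subseteq> w -` U"
      using compact_subset_open_imp_ball_epsilon_subset[of "{0..T}" "w -` U"] by auto
    \<comment> \<open>\<open>phase_curve\<close> asks for an open interval, so \<open>{0..T}\<close>
      is enlarged by the room \<open>e\<close> that compactness leaves inside the preimage of
      \<open>U\<close>.\<close>
    define J where "J = {- e<..<T + e}"
    have JU: "w s \<in> U" if "s \<in> J" for s
    proof -
      have "s \<in> ball (min T (max 0 s)) e" using that e(1) T(1)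
        by (auto simp: J_def dist_real_def min_def max_def)
      moreover have "min T (max 0 s) \<in> {0..T}" using T(1) by auto
      ultimately show ?thesis using e(2) by blast
    qed
    have pcw: "phase_curve g (x, \<theta>) J w"
      unfolding phase_curve_def
    proof (intro conjI ballI)
      fix s assume "s \<in> J"
      then have "w s \<in> K" using JU UK by blast
      then show "fst (w s) \<in> spacetime" "(w has_vector_derivative geodesic_field g (w s)) (at s)"
        using K(3) w(2)[of s] Pid by auto
    qed (use e T w(1) in \<open>auto simp: J_def is_interval_1\<close>)
    have JT: "{0..T} \<subseteq> J" using e by (auto simp: J_def)
    show ?thesis
    proof (intro conjI ballI)
      show "{0..T} \<subseteq> geod_dom g x \<theta>" using JT phase_curve_subset_geod_dom[OF pcw] by blast
      show "norm (geod_phase g x \<theta> \<tau> - z0 \<tau>) \<le> \<eta>" if "\<tau> \<in> {0..T}" for \<tau>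
        using geod_phase_eq[OF g(1) pcw, of \<tau>] JT that close[OF that] r(4) by auto
    qed
  qed
  with \<delta>(1) show ?thesis unfolding z0_def by blast
qed

subsection \<open>Conservation laws\<close>

text \<open>By the Leibniz rule and the geodesic equation, the terms differentiating the metric
  along the velocity cancel and half of its derivative along \<open>W\<close> is left. If
  \<open>W\<close> is a vector field along the curve, this is half its Lie derivative of the metric
  on the velocity.\<close>

lemma phase_curve_pairing_derivative:
  assumes g: "regular_metric g" and z: "phase_curve g p J z" "\<tau> \<in> J"
    and W: "(W has_vector_derivative W') (at \<tau>)"
  shows "((\<lambda>s. g (fst (z s)) (snd (z s)) (W s)) has_real_derivative
     pd (W \<tau>) (\<lambda>x. g x (snd (z \<tau>)) (snd (z \<tau>))) (fst (z \<tau>)) / 2 + g (fst (z \<tau>)) (snd (z \<tau>)) W') (at \<tau>)"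
proof -
  have sp: "fst (z \<tau>) \<in> spacetime" and d: "(z has_vector_derivative geodesic_field g (z \<tau>)) (at \<tau>)"
    using z unfolding phase_curve_def by blast+
  have d1: "((\<lambda>s. fst (z s)) has_vector_derivative snd (z \<tau>)) (at \<tau>)"
    using bounded_linear.has_vector_derivative[OF bounded_linear_fst d] by (simp add: geodesic_field_def)
  have d2: "((\<lambda>s. snd (z s)) has_vector_derivative - christoffel g (fst (z \<tau>)) (snd (z \<tau>)) (snd (z \<tau>))) (at \<tau>)"
    using bounded_linear.has_vector_derivative[OF bounded_linear_snd d] by (simp add: geodesic_field_def)
  note C1 = regular_metric_C1[OF g]
  show ?thesis
    using C1_sym2_along_curve[OF C1 open_spacetime sp d1 d2 W]
    by (simp add: sym_bilinear_simps[OF regular_metric_sym[OF g sp]]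
        christoffel_works[OF C1 open_spacetime sp regular_metric_nondegenerate[OF g sp]])
qed

lemma constant_on_interval:
  fixes f :: "real \<Rightarrow> real"
  assumes J: "is_interval J" and d: "\<And>\<tau>. \<tau> \<in> J \<Longrightarrow> (f has_real_derivative 0) (at \<tau>)"
    and "\<sigma> \<in> J" "\<tau> \<in> J"
  shows "f \<sigma> = f \<tau>"
proof -
  have "convex J" using J by (simp add: is_interval_convex_1)
  then have "\<exists>c. \<forall>x\<in>J. f x = c"
    by (rule has_field_derivative_zero_constant) (use d in \<open>blast intro: has_field_derivative_at_within\<close>)
  then show ?thesis using assms(3,4) by metis
qed

text \<open>The preceding rule with \<open>W\<close> the velocity: the derivative \<open>W'\<close>
  is minus the Christoffel vector, whose pairing with the velocity is again half the derivative of
  the metric.\<close>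

lemma phase_curve_norm_conserved:
  assumes g: "regular_metric g" and z: "phase_curve g p J z" "\<tau> \<in> J"
  shows "g (fst (z \<tau>)) (snd (z \<tau>)) (snd (z \<tau>)) = g (fst p) (snd p) (snd p)"
proof -
  have "((\<lambda>s. g (fst (z s)) (snd (z s)) (snd (z s))) has_real_derivative 0) (at \<sigma>)" if \<sigma>: "\<sigma> \<in> J" for \<sigma>
  proof -
    have sp: "fst (z \<sigma>) \<in> spacetime" and d: "(z has_vector_derivative geodesic_field g (z \<sigma>)) (at \<sigma>)"
      using z(1) \<sigma> unfolding phase_curve_def by blast+
    have d2: "((\<lambda>s. snd (z s)) has_vector_derivative - christoffel g (fst (z \<sigma>)) (snd (z \<sigma>)) (snd (z \<sigma>))) (at \<sigma>)"
      using bounded_linear.has_vector_derivative[OF bounded_linear_snd d] by (simp add: geodesic_field_def)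
    have sb: "sym_bilinear (g (fst (z \<sigma>)))" by (rule regular_metric_sym[OF g sp])
    show ?thesis
      using phase_curve_pairing_derivative[OF g z(1) \<sigma> d2]
        christoffel_works[OF regular_metric_C1[OF g] open_spacetime sp regular_metric_nondegenerate[OF g sp], of "snd (z \<sigma>)" "snd (z \<sigma>)"]
      by (simp add: sym_bilinear_simps[OF sb] sym_bilinear_commute[OF sb, of "snd (z \<sigma>)" "christoffel _ _ _ _"])
  qed
  moreover have "is_interval J" "0 \<in> J" "z 0 = p" using z unfolding phase_curve_def by blast+
  ultimately show ?thesis using constant_on_interval[of J "\<lambda>s. g (fst (z s)) (snd (z s)) (snd (z s))" \<tau> 0] z(2) by simp
qed

lemma smooth_on_pos_derivs:
  assumes "smooth_on_pos a" "0 < t"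
  shows "(a has_real_derivative deriv a t) (at t)" "isCont (deriv a) t"
proof -
  have 0: "(deriv ^^ n) a differentiable (at t)" for n using assms unfolding smooth_on_pos_def by blast
  show "(a has_real_derivative deriv a t) (at t)"
    using 0[of 0] by (simp add: DERIV_deriv_iff_real_differentiable)
  show "isCont (deriv a) t"
    using 0[of 1] by (simp add: differentiable_imp_continuous_within)
qed

lemma flrw_has_derivative:
  assumes a: "(a has_real_derivative a') (at (fst x))"
  shows "((\<lambda>x. flrw a x u w) has_derivative (\<lambda>v. 2 * a (fst x) * a' * fst v * (snd u \<bullet> snd w))) (at x)"
proof -
  have "((\<lambda>x. a (fst x)) has_derivative (\<lambda>v. a' * fst v)) (at x)"
    using has_derivative_compose[OF has_derivative_fst[OF has_derivative_ident] a[unfolded has_field_derivative_def]]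
    by (simp add: o_def)
  then show ?thesis unfolding flrw_def by (auto intro!: derivative_eq_intros simp: algebra_simps)
qed

lemma pd_eq_flrw:
  assumes g: "\<And>x. x \<in> spacetime \<Longrightarrow> g x = flrw a x" and x: "x \<in> spacetime"
    and a: "(a has_real_derivative a') (at (fst x))"
  shows "pd v (\<lambda>x. g x u w) x = 2 * a (fst x) * a' * fst v * (snd u \<bullet> snd w)"
proof -
  have "pd v (\<lambda>x. g x u w) x = pd v (\<lambda>x. flrw a x u w) x"
    by (rule pd_cong[OF open_spacetime x]) (simp add: g)
  then show ?thesis using pd_eqI[OF flrw_has_derivative[OF a]] by simp
qed

text \<open>The diagonal part of \<open>a\<^sup>2 \<L>\<^sub>X (a\<^sup>-\<^sup>2 h)\<close> for \<open>X = a \<partial>\<^sub>t\<close>, written without differentiating \<open>a\<^sup>-\<^sup>2\<close>.\<close>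

definition conformal_lie :: "(real \<Rightarrow> real) \<Rightarrow> tensor2 \<Rightarrow> event \<times> event \<Rightarrow> real" where
  "conformal_lie a h z =
     a (fst (fst z)) * pd (1, 0) (\<lambda>x. h x (snd z) (snd z)) (fst z)
     + 2 * deriv a (fst (fst z)) * fst (snd z) * h (fst z) (snd z) (1, 0)
     - 2 * deriv a (fst (fst z)) * h (fst z) (snd z) (snd z)"

text \<open>As \<open>a \<partial>\<^sub>t\<close> is a conformal Killing field of the background metric, its pairing with
  the velocity of a null geodesic changes only through the perturbation.\<close>

lemma null_phase_curve_pairing_derivative:
  assumes g: "regular_metric g" and g0: "regular_metric g0" "\<And>x. x \<in> spacetime \<Longrightarrow> g0 x = flrw a x"
    and a: "smooth_on_pos a"
    and z: "phase_curve g p J z" "\<tau> \<in> J" and null: "g (fst p) (snd p) (snd p) = 0"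
  shows "((\<lambda>s. g (fst (z s)) (snd (z s)) (a (fst (fst (z s))), 0)) has_real_derivative
     conformal_lie a (\<lambda>x u w. g x u w - g0 x u w) (z \<tau>) / 2) (at \<tau>)"
proof -
  define x where "x = fst (z \<tau>)"
  define u where "u = snd (z \<tau>)"
  have sp: "x \<in> spacetime" and d: "(z has_vector_derivative geodesic_field g (z \<tau>)) (at \<tau>)"
    using z unfolding phase_curve_def x_def by blast+
  have t: "0 < fst x" using sp by (simp add: spacetime_def)
  have d1: "((\<lambda>s. fst (fst (z s))) has_vector_derivative fst u) (at \<tau>)"
    using bounded_linear.has_vector_derivative[OF bounded_linear_fst
        bounded_linear.has_vector_derivative[OF bounded_linear_fst d]]
    by (simp add: geodesic_field_def u_def)
  define a' where "a' = deriv a (fst x)"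
  have da: "(a has_real_derivative a') (at (fst x))"
    unfolding a'_def by (rule smooth_on_pos_derivs[OF a t])
  have "((\<lambda>s. a (fst (fst (z s)))) has_real_derivative a' * fst u) (at \<tau>)"
    using DERIV_chain2[of a a' "\<lambda>s. fst (fst (z s))" \<tau> "fst u" UNIV] da d1
    by (simp add: x_def has_real_derivative_iff_has_vector_derivative)
  then have dW: "((\<lambda>s. (a (fst (fst (z s))), 0::real^3)) has_vector_derivative (a' * fst u, 0)) (at \<tau>)"
    by (intro has_vector_derivative_Pair has_vector_derivative_const)
      (simp add: has_real_derivative_iff_has_vector_derivative)
  define h where "h = (\<lambda>x u w. g x u w - g0 x u w)"
  note C1 = regular_metric_C1[OF g] and C10 = regular_metric_C1[OF g0(1)]
  have sb: "sym_bilinear (g x)" by (rule regular_metric_sym[OF g sp])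
  have sc: "(r, 0) = r *\<^sub>R (1, 0 :: real^3)" for r by simp
  \<comment> \<open>Nullness enters here: \<open>g\<close> vanishes on \<open>(u, u)\<close>, so
    \<open>h\<close> equals minus the background form. The terms in \<open>fst u * fst u\<close> and
    \<open>snd u \<bullet> snd u\<close> then cancel against those from \<open>hp\<close> and
    \<open>hd\<close>.\<close>
  have hu: "h x u u = fst u * fst u - (a (fst x))\<^sup>2 * (snd u \<bullet> snd u)"
    using phase_curve_norm_conserved[OF g z] null g0(2)[OF sp]
    by (simp add: h_def x_def u_def flrw_def)
  have hp: "h x u (1, 0) = g x u (1, 0) + fst u"
    using g0(2)[OF sp] by (simp add: h_def flrw_def)
  have hd: "pd (1, 0) (\<lambda>x. h x u u) x = pd (1, 0) (\<lambda>x. g x u u) x - 2 * a (fst x) * a' * (snd u \<bullet> snd u)"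
    unfolding h_def using pd_C1_sym2_diff[OF C1 C10 open_spacetime sp] pd_eq_flrw[OF g0(2) sp da] by simp
  have "pd (a (fst x), 0) (\<lambda>x. g x u u) x / 2 + g x u (a' * fst u, 0)
      = a (fst x) * pd (1, 0) (\<lambda>x. g x u u) x / 2 + a' * fst u * g x u (1, 0)"
    unfolding sc[of "a (fst x)"] sc[of "a' * fst u"] sym_bilinear_simps(6)[OF sb]
      linear_cmul[OF pd_C1_sym2_linear(1)[OF C1 open_spacetime sp]] by simp
  also have "\<dots> = conformal_lie a h (z \<tau>) / 2"
    unfolding conformal_lie_def x_def[symmetric] u_def[symmetric] a'_def[symmetric] hu hp hd
    by (simp add: field_simps power2_eq_square)
  finally have eq: "pd (a (fst x), 0) (\<lambda>x. g x u u) x / 2 + g x u (a' * fst u, 0) = conformal_lie a h (z \<tau>) / 2" .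
  show ?thesis
    using phase_curve_pairing_derivative[OF g z dW] unfolding x_def[symmetric] u_def[symmetric] eq
    unfolding h_def .
qed

subsection \<open>Null geodesics of the background metric\<close>

lemma christoffel_flrw:
  assumes g: "regular_metric g" "\<And>x. x \<in> spacetime \<Longrightarrow> g x = flrw a x" and x: "x \<in> spacetime"
    and a: "(a has_real_derivative a') (at (fst x))" "a (fst x) > 0"
  shows "christoffel g x u u =
    (a (fst x) * a' * (snd u \<bullet> snd u), (2 * a' * fst u / a (fst x)) *\<^sub>R snd u)" (is "_ = ?c")
proof -
  have sb: "sym_bilinear (g x)" and nd: "nondegenerate (g x)"
    using g x regular_metric_sym regular_metric_nondegenerate by blast+
  have "g x (christoffel g x u u) w = g x ?c w" for w
    using christoffel_works[OF regular_metric_C1[OF g(1)] open_spacetime x nd, of u w]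
      pd_eq_flrw[OF g(2) x a(1), of u u w] pd_eq_flrw[OF g(2) x a(1), of w u u] a(2)
    by (simp add: g(2)[OF x] flrw_def power2_eq_square field_simps)
  then have "\<forall>w. g x (christoffel g x u u - ?c) w = 0" by (simp only: sym_bilinear_simps[OF sb]) simp
  then show ?thesis using nd unfolding nondegenerate_def by (metis eq_iff_diff_eq_0)
qed

lemma real_C1_lipschitz:
  fixes f f' :: "real \<Rightarrow> real"
  assumes d: "\<And>t. t \<in> {lo..hi} \<Longrightarrow> (f has_real_derivative f' t) (at t)" and c: "continuous_on {lo..hi} f'"
  obtains B L where "L \<ge> 0" "\<And>t. t \<in> {lo..hi} \<Longrightarrow> \<bar>f t\<bar> \<le> B"
    "\<And>s t. s \<in> {lo..hi} \<Longrightarrow> t \<in> {lo..hi} \<Longrightarrow> \<bar>f s - f t\<bar> \<le> L * \<bar>s - t\<bar>"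
proof -
  have "continuous_on {lo..hi} f" using d DERIV_isCont by (blast intro: continuous_at_imp_continuous_on)
  then have "bounded (f ` {lo..hi})" "bounded (f' ` {lo..hi})"
    using c compact_continuous_image compact_imp_bounded compact_Icc by blast+
  then obtain B L where B: "\<And>t. t \<in> {lo..hi} \<Longrightarrow> \<bar>f t\<bar> \<le> B" and L: "L > 0" "\<And>t. t \<in> {lo..hi} \<Longrightarrow> \<bar>f' t\<bar> \<le> L"
    unfolding bounded_pos bounded_iff by (metis imageI real_norm_def)
  have "norm (f s - f t) \<le> L * norm (s - t)" if "s \<in> {lo..hi}" "t \<in> {lo..hi}" for s t
    by (rule field_differentiable_bound[where S = "{lo..hi}" and f' = f'])
      (use d L that in \<open>auto intro: has_field_derivative_at_within\<close>)
  then show ?thesis using B L(1) by (intro that[of L B]) auto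
qed

text \<open>The null geodesic solves a first order system, because \<open>a t'\<close> and \<open>a\<^sup>2 y'\<close> are
  constant along it.\<close>

lemma flrw_ray_reaches:
  assumes g: "regular_metric g" "\<And>x. x \<in> spacetime \<Longrightarrow> g x = flrw a x"
    and a_pos: "\<And>t. 0 < t \<Longrightarrow> 0 < a t" and a_smooth: "smooth_on_pos a"
    and t01: "0 < t0" "t0 < t1" and v: "norm v = 1"
  shows "\<exists>T>0. T \<in> geod_dom g (t1, y) (ray_dir a t1 v) \<and>
    fst (geod g (t1, y) (ray_dir a t1 v) T) < t0"
proof -
  \<comment> \<open>The band has to reach below \<open>t0\<close>, for the ray to cross the slice
    inside it, and above \<open>t1\<close>, for 0 to be an interior parameter.\<close>
  define lo where "lo = t0 / 2"
  define hi where "hi = t1 + 1"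
  have lohi: "0 < lo" "lo < t0" "t1 < hi" "lo < t1" "lo \<le> hi" using t01 by (auto simp: lo_def hi_def)
  define a1 where "a1 = a t1"
  have a1: "a1 > 0" using a_pos t01 by (simp add: a1_def)
  note da = smooth_on_pos_derivs[OF a_smooth]
  have contd: "continuous_on {lo..hi} (deriv a)" "continuous_on {lo..hi} a"
    using da(2) DERIV_isCont[OF da(1)] lohi by (auto intro!: continuous_at_imp_continuous_on)
  \<comment> \<open>The components \<open>t'\<close> and \<open>y' / v\<close> as functions of time:
    the constants of motion have the values \<open>- a t1\<close> and
    \<open>- a t1 *\<^sub>R v\<close> at the initial direction.\<close>
  define p where "p t = - a1 / a t" for t
  define q where "q t = - a1 / (a t)\<^sup>2" for t
  have dp: "(p has_real_derivative a1 * deriv a t / (a t)\<^sup>2) (at t)" if "0 < t" for t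
    unfolding p_def using a_pos[OF that]
    by (auto intro!: derivative_eq_intros da that simp: power2_eq_square)
  have dq: "(q has_real_derivative 2 * a1 * deriv a t / (a t) ^ 3) (at t)" if "0 < t" for t
    unfolding q_def using a_pos[OF that]
    by (auto intro!: derivative_eq_intros da that simp: field_simps power2_eq_square power3_eq_cube)
  have ane: "a t \<noteq> 0" if "t \<in> {lo..hi}" for t using a_pos[of t] that lohi by auto
  have cdp: "continuous_on {lo..hi} (\<lambda>t. a1 * deriv a t / (a t)\<^sup>2)"
    and cdq: "continuous_on {lo..hi} (\<lambda>t. 2 * a1 * deriv a t / (a t) ^ 3)"
    using ane by (intro continuous_intros contd; simp)+
  obtain Bp Lp where p: "Lp \<ge> 0" "\<And>t. t \<in> {lo..hi} \<Longrightarrow> \<bar>p t\<bar> \<le> Bp"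
      "\<And>s t. s \<in> {lo..hi} \<Longrightarrow> t \<in> {lo..hi} \<Longrightarrow> \<bar>p s - p t\<bar> \<le> Lp * \<bar>s - t\<bar>"
    by (rule real_C1_lipschitz[OF dp cdp]) (use lohi in auto)
  obtain Bq Lq where q: "Lq \<ge> 0" "\<And>t. t \<in> {lo..hi} \<Longrightarrow> \<bar>q t\<bar> \<le> Bq"
      "\<And>s t. s \<in> {lo..hi} \<Longrightarrow> t \<in> {lo..hi} \<Longrightarrow> \<bar>q s - q t\<bar> \<le> Lq * \<bar>s - t\<bar>"
    by (rule real_C1_lipschitz[OF dq cdq]) (use lohi in auto)
  \<comment> \<open>Clamping the time to the band makes the first order field globally bounded and
    Lipschitz, so it has a global flow.\<close>
  define k where "k t = max lo (min hi t)" for t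
  have k: "k t \<in> {lo..hi}" "\<bar>k s - k t\<bar> \<le> \<bar>s - t\<bar>" for s t
    using lohi by (auto simp: k_def max_def min_def)
  define G where "G x = (p (k (fst x)), q (k (fst x)) *\<^sub>R v)" for x :: event
  have "norm (G x) \<le> Bp + Bq" for x
    using norm_Pair_le[of "p (k (fst x))" "q (k (fst x)) *\<^sub>R v"] p(2)[OF k(1), of "fst x"] q(2)[OF k(1), of "fst x"] v
    by (simp add: G_def)
  moreover have "norm (G x - G x') \<le> (Lp + Lq) * norm (x - x')" for x x'
  proof -
    have *: "\<bar>k (fst x) - k (fst x')\<bar> \<le> norm (x - x')"
      using k(2)[of "fst x" "fst x'"] norm_fst_le_norm[of "x - x'"] by simp
    have "norm (G x - G x') \<le> \<bar>p (k (fst x)) - p (k (fst x'))\<bar> + \<bar>q (k (fst x)) - q (k (fst x'))\<bar>"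
      using norm_Pair_le[of "p (k (fst x)) - p (k (fst x'))" "q (k (fst x)) *\<^sub>R v - q (k (fst x')) *\<^sub>R v"] v
      by (simp add: G_def flip: scaleR_diff_left)
    also have "\<dots> \<le> Lp * \<bar>k (fst x) - k (fst x')\<bar> + Lq * \<bar>k (fst x) - k (fst x')\<bar>"
      by (intro add_mono p(3) q(3) k(1))
    also have "\<dots> \<le> Lp * norm (x - x') + Lq * norm (x - x')"
      using p(1) q(1) * by (intro add_mono mult_left_mono)
    finally show ?thesis by (simp add: distrib_right)
  qed
  ultimately obtain w where w: "w 0 = (t1, y)" "\<And>\<tau>. (w has_vector_derivative G (w \<tau>)) (at \<tau>)"
    using global_flow_exists[of G "Bp + Bq" "Lp + Lq" "(t1, y)"] by blast
  define T where "T = (\<lambda>\<tau>. fst (w \<tau>))"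
  have dT: "(T has_real_derivative p (k (T \<tau>))) (at \<tau>)" for \<tau>
    using bounded_linear.has_vector_derivative[OF bounded_linear_fst w(2)[of \<tau>]]
    by (simp add: G_def T_def has_real_derivative_iff_has_vector_derivative)
  have "bounded (a ` {lo..hi})" by (intro compact_imp_bounded compact_continuous_image contd(2)) auto
  then obtain M where M: "\<forall>s\<in>a ` {lo..hi}. norm s \<le> M" "M > 0" unfolding bounded_pos by blast
  have pneg: "p (k t) \<le> - (a1 / M)" for t
  proof -
    have "0 < a (k t)" using a_pos[of "k t"] k(1)[of t] lohi by auto
    moreover have "a (k t) \<le> M" using M(1) k(1)[of t] by force
    ultimately have "a1 / M \<le> a1 / a (k t)" using a1 by (intro divide_left_mono) auto
    then show ?thesis by (simp add: p_def)
  qed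
  have c: "a1 / M > 0" using a1 M by simp
  have anti: "T \<sigma> \<le> T \<tau> - a1 / M * (\<sigma> - \<tau>)" if "\<tau> \<le> \<sigma>" for \<tau> \<sigma>
  proof -
    have "T \<sigma> + a1 / M * \<sigma> \<le> T \<tau> + a1 / M * \<tau>"
    proof (rule DERIV_nonpos_imp_nonincreasing[OF that])
      fix x
      have "((\<lambda>x. T x + a1 / M * x) has_real_derivative p (k (T x)) + a1 / M * 1) (at x)"
        by (intro DERIV_add DERIV_cmult DERIV_ident dT)
      then show "\<exists>y. ((\<lambda>x. T x + a1 / M * x) has_real_derivative y) (at x) \<and> y \<le> 0"
        using pneg[of "T x"] by (intro exI[of _ "p (k (T x)) + a1 / M * 1"]) auto
    qed
    then show ?thesis unfolding right_diff_distrib by linarith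
  qed
  have T0: "T 0 = t1" using w(1) by (simp add: T_def)
  have contT: "continuous_on UNIV T" using dT DERIV_isCont by (blast intro: continuous_at_imp_continuous_on)
  \<comment> \<open>The parameters at which the clamp is inactive; an interval because
    \<open>T\<close> is decreasing by \<open>anti\<close>. Only here is \<open>w\<close> claimed to
    be a geodesic.\<close>
  define J where "J = T -` {lo<..<hi}"
  have "is_interval J"
    unfolding is_interval_1 J_def
  proof (intro ballI allI impI)
    fix r s x assume rs: "r \<in> T -` {lo<..<hi}" "s \<in> T -` {lo<..<hi}" "r \<le> x \<and> x \<le> s"
    have "a1 / M * (s - x) \<ge> 0" "a1 / M * (x - r) \<ge> 0"
      using c rs(3) by (intro mult_nonneg_nonneg; linarith)+
    then have "T s \<le> T x" "T x \<le> T r" using anti[of x s] anti[of r x] rs(3) by linarith+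
    moreover have "lo < T s" "T r < hi" using rs(1,2) by auto
    ultimately show "x \<in> T -` {lo<..<hi}" by simp
  qed
  moreover have "open J" unfolding J_def using contT by (simp add: open_vimage)
  moreover have "0 \<in> J" using T0 lohi by (simp add: J_def)
  moreover have "((\<lambda>\<tau>. (w \<tau>, G (w \<tau>))) has_vector_derivative geodesic_field g (w \<tau>, G (w \<tau>))) (at \<tau>)
      \<and> w \<tau> \<in> spacetime" if \<tau>: "\<tau> \<in> J" for \<tau>
  proof -
    define t where "t = T \<tau>"
    have t: "lo < t" "t < hi" "k t = t" using \<tau> lohi by (auto simp: J_def k_def t_def)
    have tp: "0 < t" "0 < a t" using t lohi a_pos[of t] by auto
    have sp: "w \<tau> \<in> spacetime" using tp by (simp add: spacetime_def T_def t_def)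
    have Geq: "G (w s) = (p (T s), q (T s) *\<^sub>R v)" if "s \<in> J" for s
      using that lohi by (auto simp: G_def J_def k_def T_def)
    have dT': "(T has_real_derivative p t) (at \<tau>)" using dT[of \<tau>] t(3) by (simp add: t_def)
    have d1: "((\<lambda>s. p (T s)) has_real_derivative a1 * deriv a t / (a t)\<^sup>2 * p t) (at \<tau>)"
      by (rule DERIV_chain2[OF _ dT']) (use dp[OF tp(1)] in \<open>simp add: t_def\<close>)
    have d2: "((\<lambda>s. q (T s)) has_real_derivative 2 * a1 * deriv a t / (a t) ^ 3 * p t) (at \<tau>)"
      by (rule DERIV_chain2[OF _ dT']) (use dq[OF tp(1)] in \<open>simp add: t_def\<close>)
    have "((\<lambda>s. (p (T s), q (T s) *\<^sub>R v)) has_vector_derivative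
        (a1 * deriv a t / (a t)\<^sup>2 * p t, (2 * a1 * deriv a t / (a t) ^ 3 * p t) *\<^sub>R v)) (at \<tau>)"
      using d1 d2 unfolding has_real_derivative_iff_has_vector_derivative
      by (intro has_vector_derivative_Pair bounded_linear.has_vector_derivative[OF bounded_linear_scaleR_left])
    also have "(a1 * deriv a t / (a t)\<^sup>2 * p t, (2 * a1 * deriv a t / (a t) ^ 3 * p t) *\<^sub>R v)
        = - christoffel g (w \<tau>) (G (w \<tau>)) (G (w \<tau>))"
    proof -
      have vv: "v \<bullet> v = 1" using v by (simp flip: power2_norm_eq_inner)
      have wt: "fst (w \<tau>) = t" by (simp add: t_def T_def)
      have gt: "G (w \<tau>) = (p t, q t *\<^sub>R v)" using Geq[OF \<tau>] by (simp add: t_def)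
      show ?thesis
        using christoffel_flrw[OF g sp, of "deriv a t" "G (w \<tau>)"] da(1)[OF tp(1)] tp(2)
        unfolding wt gt by (simp add: vv p_def q_def field_simps power2_eq_square power3_eq_cube)
    qed
    finally have "((\<lambda>s. G (w s)) has_vector_derivative - christoffel g (w \<tau>) (G (w \<tau>)) (G (w \<tau>))) (at \<tau>)"
      by (rule has_vector_derivative_transform_within_open[where S=J]) (use \<open>open J\<close> \<tau> Geq in auto)
    from has_vector_derivative_Pair[OF w(2) this] sp show ?thesis by (simp add: geodesic_field_def)
  qed
  moreover have "G (t1, y) = ray_dir a t1 v"
  proof -
    have "k t1 = t1" using lohi by (simp add: k_def)
    then show ?thesis using a1 by (simp add: G_def ray_dir_def p_def q_def a1_def power2_eq_square field_simps)
  qed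
  ultimately have pc: "phase_curve g ((t1, y), ray_dir a t1 v) J (\<lambda>\<tau>. (w \<tau>, G (w \<tau>)))"
    unfolding phase_curve_def using w(1) by auto
  \<comment> \<open>A time already past the slice yet still inside the band; the slope bound
    \<open>a1 / M\<close> forces the ray to reach it by parameter \<open>S\<close>.\<close>
  define mid where "mid = (lo + t0) / 2"
  have mid: "lo < mid" "mid < t0" using lohi by (auto simp: mid_def)
  define S where "S = (t1 - mid) / (a1 / M)"
  have S: "S \<ge> 0" using c mid t01 unfolding S_def by (intro divide_nonneg_pos; linarith)
  have "a1 / M * S = t1 - mid" using a1 M(2) by (simp add: S_def)
  then have "T S \<le> mid" using anti[OF S] T0 by simp
  then have "\<exists>\<tau>\<ge>0. \<tau> \<le> S \<and> T \<tau> = mid"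
    using IVT2'[of T S mid 0] S T0 mid t01 continuous_on_subset[OF contT] by auto
  then obtain \<tau> where \<tau>: "\<tau> \<ge> 0" "T \<tau> = mid" by blast
  have "\<tau> \<noteq> 0" using \<tau> T0 mid t01 by auto
  moreover have "\<tau> \<in> J" using \<tau> mid lohi t01 by (auto simp: J_def)
  moreover from this have "fst (geod g (t1, y) (ray_dir a t1 v) \<tau>) = mid"
    using geod_eq_phase_curve[OF g(1) pc] \<tau> by (simp add: T_def)
  ultimately show ?thesis
    using phase_curve_subset_geod_dom[OF pc] \<tau>(1) mid by (intro exI[of _ \<tau>]) auto
qed

subsection \<open>Estimates for the perturbation\<close>

lemma pd_affine:
  assumes "\<phi> differentiable (at x)" "\<psi> differentiable (at x)" "\<omega> differentiable (at x)"
  shows "pd v (\<lambda>z. (\<phi> z - \<psi> z) / c - \<omega> z) x = (pd v \<phi> x - pd v \<psi> x) / c - pd v \<omega> x"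
  unfolding divide_inverse
  by (rule pd_eqI) (intro has_derivative_diff has_derivative_mult_left has_derivative_pd assms)

lemma coord_derivs_le_iff:
  "(\<forall>r\<in>coord_derivs S h. \<bar>r\<bar> \<le> B) \<longleftrightarrow> (\<forall>x\<in>S. \<forall>l\<in>Basis. \<forall>m\<in>Basis.
     \<bar>h x l m\<bar> \<le> B \<and> (\<forall>i\<in>Basis. \<bar>pd i (\<lambda>z. h z l m) x\<bar> \<le> B) \<and>
     (\<forall>i\<in>Basis. \<forall>j\<in>Basis. \<bar>pd j (pd i (\<lambda>z. h z l m)) x\<bar> \<le> B))"
  unfolding coord_derivs_def by (simp only: ball_UN ball_Un ball_simps ball_empty simp_thms conj_assoc)

lemma C2b_sym2_bound:
  assumes "h \<in> C2b_sym2 S"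
  shows "\<exists>B\<ge>0. \<forall>r\<in>coord_derivs S h. \<bar>r\<bar> \<le> B"
proof -
  have "bounded (coord_derivs S h)" using assms unfolding C2b_sym2_def by blast
  then show ?thesis unfolding bounded_pos by (metis less_imp_le real_norm_def)
qed

lemma diff_quotient_derivs:
  assumes h: "h \<in> C2_sym2 S" and k: "k \<in> C2_sym2 S" and d: "d \<in> C2_sym2 S"
    and S: "open S" "x \<in> S" and lm: "l \<in> Basis" "m \<in> Basis"
  shows "pd i (\<lambda>z. (h z l m - k z l m) / c - d z l m) x =
      (pd i (\<lambda>z. h z l m) x - pd i (\<lambda>z. k z l m) x) / c - pd i (\<lambda>z. d z l m) x"
    and "i \<in> Basis \<Longrightarrow> pd j (pd i (\<lambda>z. (h z l m - k z l m) / c - d z l m)) x =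
      (pd j (pd i (\<lambda>z. h z l m)) x - pd j (pd i (\<lambda>z. k z l m)) x) / c - pd j (pd i (\<lambda>z. d z l m)) x"
proof -
  have df: "(\<lambda>z. h z l m) differentiable (at x)" if "h \<in> C2_sym2 S" "x \<in> S" for h x
    by (rule C1_sym2_differentiable[OF C2_sym2_imp_C1[OF that(1)] S(1) that(2)])
  have df2: "pd i (\<lambda>z. h z l m) differentiable (at x)" if "h \<in> C2_sym2 S" "x \<in> S" "i \<in> Basis" for h x i
    using that lm unfolding C2_sym2_def C2_on_def C1_on_def by blast
  have 1: "pd i (\<lambda>z. (h z l m - k z l m) / c - d z l m) x =
      (pd i (\<lambda>z. h z l m) x - pd i (\<lambda>z. k z l m) x) / c - pd i (\<lambda>z. d z l m) x" if "x \<in> S" for x i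
    by (rule pd_affine) (use df h k d that in blast)+
  show "pd i (\<lambda>z. (h z l m - k z l m) / c - d z l m) x =
      (pd i (\<lambda>z. h z l m) x - pd i (\<lambda>z. k z l m) x) / c - pd i (\<lambda>z. d z l m) x" by (rule 1[OF S(2)])
  assume i: "i \<in> Basis"
  have "pd j (pd i (\<lambda>z. (h z l m - k z l m) / c - d z l m)) x =
      pd j (\<lambda>x. (pd i (\<lambda>z. h z l m) x - pd i (\<lambda>z. k z l m) x) / c - pd i (\<lambda>z. d z l m) x) x"
    by (rule pd_cong[OF S]) (rule 1)
  also have "\<dots> = (pd j (pd i (\<lambda>z. h z l m)) x - pd j (pd i (\<lambda>z. k z l m)) x) / c - pd j (pd i (\<lambda>z. d z l m)) x"
    by (rule pd_affine) (use df2 h k d S(2) i in blast)+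
  finally show "pd j (pd i (\<lambda>z. (h z l m - k z l m) / c - d z l m)) x =
      (pd j (pd i (\<lambda>z. h z l m)) x - pd j (pd i (\<lambda>z. k z l m)) x) / c - pd j (pd i (\<lambda>z. d z l m)) x" .
qed

lemma diff_quotient_bounded:
  assumes h: "h \<in> C2b_sym2 S" and k: "k \<in> C2b_sym2 S" and d: "d \<in> C2b_sym2 S" and S: "open S"
  shows "bounded (coord_derivs S (\<lambda>x u w. (h x u w - k x u w) / c - d x u w))"
proof -
  obtain Bh Bk Bd where B: "\<forall>r\<in>coord_derivs S h. \<bar>r\<bar> \<le> Bh" "\<forall>r\<in>coord_derivs S k. \<bar>r\<bar> \<le> Bk"
      "\<forall>r\<in>coord_derivs S d. \<bar>r\<bar> \<le> Bd"
    using C2b_sym2_bound[OF h] C2b_sym2_bound[OF k] C2b_sym2_bound[OF d] by blast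
  note B' = B[unfolded coord_derivs_le_iff]
  have C2: "h \<in> C2_sym2 S" "k \<in> C2_sym2 S" "d \<in> C2_sym2 S" using h k d unfolding C2b_sym2_def by blast+
  define M where "M = (Bh + Bk) / \<bar>c\<bar> + Bd"
  have est: "\<bar>(p - q) / c - r\<bar> \<le> M" if "\<bar>p\<bar> \<le> Bh" "\<bar>q\<bar> \<le> Bk" "\<bar>r\<bar> \<le> Bd" for p q r
  proof -
    have "\<bar>(p - q) / c - r\<bar> \<le> \<bar>p - q\<bar> / \<bar>c\<bar> + \<bar>r\<bar>"
      using abs_triangle_ineq4[of "(p - q) / c" r] by simp
    also have "\<bar>p - q\<bar> / \<bar>c\<bar> \<le> (Bh + Bk) / \<bar>c\<bar>" using that by (intro divide_right_mono) auto
    finally show ?thesis using that by (simp add: M_def)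
  qed
  have "\<forall>r\<in>coord_derivs S (\<lambda>x u w. (h x u w - k x u w) / c - d x u w). \<bar>r\<bar> \<le> M"
    unfolding coord_derivs_le_iff
  proof (intro ballI conjI)
    fix x l m i j :: event assume x: "x \<in> S" and lm: "l \<in> Basis" "m \<in> Basis"
    note b = bspec[OF bspec[OF bspec[OF B'(1) x] lm(1)] lm(2)] bspec[OF bspec[OF bspec[OF B'(2) x] lm(1)] lm(2)]
      bspec[OF bspec[OF bspec[OF B'(3) x] lm(1)] lm(2)]
    show "\<bar>(h x l m - k x l m) / c - d x l m\<bar> \<le> M" using b by (intro est) blast+
    assume i: "i \<in> Basis"
    show "\<bar>pd i (\<lambda>z. (h z l m - k z l m) / c - d z l m) x\<bar> \<le> M"
      unfolding diff_quotient_derivs(1)[OF C2 S x lm] using b i by (intro est) blast+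
    assume j: "j \<in> Basis"
    show "\<bar>pd j (pd i (\<lambda>z. (h z l m - k z l m) / c - d z l m)) x\<bar> \<le> M"
      unfolding diff_quotient_derivs(2)[OF C2 S x lm i] using b i j by (intro est) blast+
  qed
  then show ?thesis unfolding bounded_iff by auto
qed

definition C1_diff_quotient_close ::
    "(real \<Rightarrow> tensor2) \<Rightarrow> event set \<Rightarrow> tensor2 \<Rightarrow> real \<Rightarrow> real \<Rightarrow> bool" where
  "C1_diff_quotient_close g S d \<eta> \<epsilon> \<longleftrightarrow> (\<forall>x\<in>S. \<forall>l\<in>Basis. \<forall>m\<in>Basis.
     \<bar>(g \<epsilon> x l m - g 0 x l m) / \<epsilon> - d x l m\<bar> \<le> \<eta> \<and>
     (\<forall>i\<in>Basis. \<bar>(pd i (\<lambda>z. g \<epsilon> z l m) x - pd i (\<lambda>z. g 0 z l m) x) / \<epsilon> - pd i (\<lambda>z. d z l m) x\<bar> \<le> \<eta>))"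

text \<open>Boundedness of the derivatives is needed because \<open>C2b_norm\<close> is a supremum, which says
  nothing about unbounded sets.\<close>

lemma C2b_differentiable_at_0:
  assumes diff: "C2b_differentiable_on g S {0..1}" and S: "open S"
  shows "\<exists>d\<in>C2b_sym2 S. \<forall>\<eta>>0. \<forall>\<^sub>F \<epsilon> in at 0 within {0..1}. C1_diff_quotient_close g S d \<eta> \<epsilon>"
proof -
  have gb: "g \<epsilon> \<in> C2b_sym2 S" if "\<epsilon> \<in> {0..1}" for \<epsilon> using diff that unfolding C2b_differentiable_on_def by blast
  have "\<exists>d\<in>C2b_sym2 S. ((\<lambda>s. C2b_norm S (\<lambda>x u w. (g s x u w - g 0 x u w) / (s - 0) - d x u w)) \<longlongrightarrow> 0) (at 0 within {0..1})"
    by (rule bspec[OF conjunct2[OF diff[unfolded C2b_differentiable_on_def]]]) simp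
  then obtain d where d: "d \<in> C2b_sym2 S" and
    lim: "((\<lambda>s. C2b_norm S (\<lambda>x u w. (g s x u w - g 0 x u w) / s - d x u w)) \<longlongrightarrow> 0) (at 0 within {0..1})"
    by auto
  have C2: "h \<in> C2_sym2 S" if "h \<in> C2b_sym2 S" for h using that unfolding C2b_sym2_def by blast
  show ?thesis
  proof (rule bexI[OF _ d], intro allI impI)
    fix \<eta> :: real assume \<eta>: "\<eta> > 0"
    have "\<forall>\<^sub>F s in at 0 within {0..1}. C2b_norm S (\<lambda>x u w. (g s x u w - g 0 x u w) / s - d x u w) < \<eta>"
      by (rule order_tendstoD(2)[OF lim \<eta>])
    moreover have "\<forall>\<^sub>F s in at 0 within {0..1}. s \<in> {0..1::real}"
      by (auto simp: eventually_at_filter)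
    ultimately show "\<forall>\<^sub>F \<epsilon> in at 0 within {0..1}. C1_diff_quotient_close g S d \<eta> \<epsilon>"
    proof eventually_elim
      case (elim s)
      define q where "q = (\<lambda>x u w. (g s x u w - g 0 x u w) / s - d x u w)"
      have s: "g s \<in> C2b_sym2 S" "g 0 \<in> C2b_sym2 S" using gb elim by auto
      have "bounded (coord_derivs S q)" unfolding q_def by (rule diff_quotient_bounded[OF s d S])
      then have "bdd_above (abs ` coord_derivs S q)"
        unfolding bounded_iff bdd_above_def by auto
      then have le: "\<bar>r\<bar> \<le> C2b_norm S q" if "r \<in> coord_derivs S q" for r
        unfolding C2b_norm_def using that by (intro cSUP_upper)
      have "C2b_norm S q < \<eta>" using elim by (simp add: q_def)
      then have "\<forall>r\<in>coord_derivs S q. \<bar>r\<bar> \<le> \<eta>" using le by fastforce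
      note * = this[unfolded coord_derivs_le_iff]
      show ?case
        unfolding C1_diff_quotient_close_def
      proof (intro ballI conjI)
        fix x l m i :: event assume x: "x \<in> S" and lm: "l \<in> Basis" "m \<in> Basis"
        note b = bspec[OF bspec[OF bspec[OF * x] lm(1)] lm(2)]
        show "\<bar>(g s x l m - g 0 x l m) / s - d x l m\<bar> \<le> \<eta>" using conjunct1[OF b] by (simp add: q_def)
        assume i: "i \<in> Basis"
        have "\<bar>pd i (\<lambda>z. q z l m) x\<bar> \<le> \<eta>" using b i by blast
        then show "\<bar>(pd i (\<lambda>z. g s z l m) x - pd i (\<lambda>z. g 0 z l m) x) / s - pd i (\<lambda>z. d z l m) x\<bar> \<le> \<eta>"
          unfolding q_def diff_quotient_derivs(1)[OF C2[OF s(1)] C2[OF s(2)] C2[OF d] S x lm] .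
      qed
    qed
  qed
qed

lemma basis_sum_bound:
  fixes u w :: event and Q :: "event \<Rightarrow> event \<Rightarrow> real"
  assumes "\<And>i j. i \<in> Basis \<Longrightarrow> j \<in> Basis \<Longrightarrow> \<bar>Q i j\<bar> \<le> \<delta>"
  shows "\<bar>\<Sum>i\<in>Basis. \<Sum>j\<in>Basis. (u \<bullet> i) * (w \<bullet> j) * Q i j\<bar> \<le>
    (\<Sum>i\<in>(Basis::event set). \<Sum>j\<in>(Basis::event set). 1) * (norm u * norm w * \<delta>)"
proof -
  have "\<bar>\<Sum>i\<in>Basis. \<Sum>j\<in>Basis. (u \<bullet> i) * (w \<bullet> j) * Q i j\<bar> \<le>
      (\<Sum>i\<in>(Basis::event set). \<Sum>j\<in>(Basis::event set). norm u * norm w * \<delta>)"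
  proof (intro order_trans[OF sum_abs] sum_mono)
    fix i j :: event assume "i \<in> Basis" "j \<in> Basis"
    then show "\<bar>(u \<bullet> i) * (w \<bullet> j) * Q i j\<bar> \<le> norm u * norm w * \<delta>"
      unfolding abs_mult using assms by (intro mult_mono Basis_le_norm) auto
  qed
  also have "\<dots> = (\<Sum>i\<in>(Basis::event set). \<Sum>j\<in>(Basis::event set). 1) * (norm u * norm w * \<delta>)"
    unfolding sum_distrib_right by simp
  finally show ?thesis .
qed

lemma time_in_Basis: "(1, 0) \<in> (Basis :: event set)"
  by (simp add: Basis_prod_def)

text \<open>The three terms of \<open>conformal_lie\<close> are linear in the components of
  \<open>h\<close> and of its time derivative. The first two give \<open>M R R\<close> and
  \<open>2 M R R\<close>, the third \<open>2 M R R\<close>; the double sum counts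
  components.\<close>

lemma conformal_lie_bound:
  assumes h: "h \<in> C1_sym2 S" "open S" "fst z \<in> S"
    and \<delta>: "\<And>i j. i \<in> Basis \<Longrightarrow> j \<in> Basis \<Longrightarrow> \<bar>h (fst z) i j\<bar> \<le> \<delta>"
      "\<And>i j. i \<in> Basis \<Longrightarrow> j \<in> Basis \<Longrightarrow> \<bar>pd (1, 0) (\<lambda>x. h x i j) (fst z)\<bar> \<le> \<delta>"
    and R: "norm z \<le> R" and M: "\<bar>a (fst (fst z))\<bar> \<le> M" "\<bar>deriv a (fst (fst z))\<bar> \<le> M"
  shows "\<bar>conformal_lie a h z\<bar> \<le>
    (3 * M * R * R + 2 * M * R * R) * (\<Sum>i\<in>(Basis::event set). \<Sum>j\<in>(Basis::event set). 1) * \<delta>"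
proof -
  define N where "N = (\<Sum>i\<in>(Basis::event set). \<Sum>j\<in>(Basis::event set). (1::real))"
  define u where "u = snd z"
  define x where "x = fst z"
  have N: "N \<ge> 0" by (auto simp: N_def intro!: sum_nonneg)
  have d0: "\<delta> \<ge> 0" using \<delta>(1)[OF time_in_Basis time_in_Basis] by linarith
  have u: "norm u \<le> R" using norm_snd_le_norm[of z] R by (simp add: u_def)
  have R0: "R \<ge> 0" using u norm_ge_zero order_trans by blast
  have M0: "M \<ge> 0" using M by linarith
  have sb: "sym_bilinear (h x)" using h by (simp add: C1_sym2_def x_def)
  have ut: "\<bar>fst u\<bar> \<le> R" using norm_fst_le_norm[of u] u by simp
  have e: "\<bar>h x u w\<bar> \<le> N * (norm u * norm w * \<delta>)" for w
    unfolding sym_bilinear_expand[OF sb, of u w] N_def using \<delta>(1) by (intro basis_sum_bound) (simp add: x_def)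
  have n1: "norm ((1, 0) :: event) = 1" by (simp add: norm_Pair)
  have uu: "norm u * norm u * \<delta> \<le> R * R * \<delta>" using u d0 R0 by (intro mult_mono) auto
  have 1: "\<bar>pd (1, 0) (\<lambda>x. h x u u) x\<bar> \<le> N * (R * R * \<delta>)"
  proof -
    have "\<bar>pd (1, 0) (\<lambda>x. h x u u) x\<bar> \<le> N * (norm u * norm u * \<delta>)"
      unfolding x_def by (subst pd_C1_sym2[OF h], unfold N_def, rule basis_sum_bound, rule \<delta>(2))
    then show ?thesis using mult_left_mono[OF uu N] by linarith
  qed
  have 2: "\<bar>h x u u\<bar> \<le> N * (R * R * \<delta>)"
    using e[of u] mult_left_mono[OF uu N] by linarith
  have 3: "\<bar>h x u (1, 0)\<bar> \<le> N * (R * \<delta>)"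
  proof -
    have "norm u * norm ((1, 0) :: event) * \<delta> \<le> R * \<delta>" using u d0 n1 by (simp add: mult_right_mono)
    then show ?thesis using e[of "(1, 0)"] mult_left_mono[OF _ N] by (meson order_trans)
  qed
  have "\<bar>conformal_lie a h z\<bar> \<le> \<bar>a (fst x)\<bar> * \<bar>pd (1, 0) (\<lambda>x. h x u u) x\<bar>
      + 2 * \<bar>deriv a (fst x)\<bar> * \<bar>fst u\<bar> * \<bar>h x u (1, 0)\<bar> + 2 * \<bar>deriv a (fst x)\<bar> * \<bar>h x u u\<bar>"
  proof -
    have "\<bar>p + q - r\<bar> \<le> \<bar>p\<bar> + \<bar>q\<bar> + \<bar>r\<bar>" for p q r :: real by linarith
    from this[of "a (fst x) * pd (1, 0) (\<lambda>x. h x u u) x" "2 * deriv a (fst x) * fst u * h x u (1, 0)"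
        "2 * deriv a (fst x) * h x u u"]
    show ?thesis by (simp add: conformal_lie_def x_def u_def abs_mult)
  qed
  also have "\<dots> \<le> M * (N * (R * R * \<delta>)) + 2 * M * R * (N * (R * \<delta>)) + 2 * M * (N * (R * R * \<delta>))"
    using 1 2 3 ut M M0 R0 N d0 by (intro add_mono mult_mono) (auto simp: x_def)
  also have "\<dots> = (3 * M * R * R + 2 * M * R * R) * N * \<delta>" by (simp add: algebra_simps)
  finally show ?thesis by (simp only: N_def)
qed

lemma continuous_on_conformal_lie:
  assumes h: "h \<in> C1_sym2 S" "open S" and a: "smooth_on_pos a" and S: "S \<subseteq> spacetime"
  shows "continuous_on (S \<times> UNIV) (conformal_lie a h)"
proof -
  have c1: "continuous_on (S \<times> UNIV) (\<lambda>z::event\<times>event. h (fst z) i j)"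
    "continuous_on (S \<times> UNIV) (\<lambda>z::event\<times>event. pd (1, 0) (\<lambda>x. h x i j) (fst z))"
    if ij: "i \<in> Basis" "j \<in> Basis" for i j
  proof -
    have C1: "C1_on S (\<lambda>x. h x i j)" using h ij by (simp add: C1_sym2_def)
    have "continuous_on S (\<lambda>x. h x i j)"
      using C1 unfolding C1_on_def by (meson continuous_at_imp_continuous_on differentiable_imp_continuous_within)
    then show "continuous_on (S \<times> UNIV) (\<lambda>z::event\<times>event. h (fst z) i j)"
      by (rule continuous_on_compose2) (auto intro: continuous_intros)
    have "continuous_on S (pd (1, 0) (\<lambda>x. h x i j))" using C1 time_in_Basis unfolding C1_on_def by blast
    then show "continuous_on (S \<times> UNIV) (\<lambda>z::event\<times>event. pd (1, 0) (\<lambda>x. h x i j) (fst z))"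
      by (rule continuous_on_compose2) (auto intro: continuous_intros)
  qed
  have ca: "continuous_on (S \<times> UNIV) (\<lambda>z::event\<times>event. a (fst (fst z)))"
    "continuous_on (S \<times> UNIV) (\<lambda>z::event\<times>event. deriv a (fst (fst z)))"
  proof -
    have "continuous_on {0<..} a" "continuous_on {0<..} (deriv a)"
      using smooth_on_pos_derivs(2)[OF a] DERIV_isCont[OF smooth_on_pos_derivs(1)[OF a]]
      by (auto intro!: continuous_at_imp_continuous_on)
    then have ca: "continuous_on {0<..} b" if "b = a \<or> b = deriv a" for b using that by blast
    have "continuous_on (S \<times> UNIV) (\<lambda>z::event\<times>event. b (fst (fst z)))" if "b = a \<or> b = deriv a" for b
      by (rule continuous_on_compose2[OF ca[OF that]])
        (use S in \<open>auto simp: spacetime_def intro!: continuous_intros\<close>)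
    then show "continuous_on (S \<times> UNIV) (\<lambda>z::event\<times>event. a (fst (fst z)))"
      "continuous_on (S \<times> UNIV) (\<lambda>z::event\<times>event. deriv a (fst (fst z)))" by blast+
  qed
  have "continuous_on (S \<times> UNIV) (\<lambda>z.
     a (fst (fst z)) * (\<Sum>i\<in>Basis. \<Sum>j\<in>Basis. (snd z \<bullet> i) * (snd z \<bullet> j) * pd (1, 0) (\<lambda>x. h x i j) (fst z))
     + 2 * deriv a (fst (fst z)) * fst (snd z) * (\<Sum>i\<in>Basis. \<Sum>j\<in>Basis. (snd z \<bullet> i) * ((1, 0) \<bullet> j) * h (fst z) i j)
     - 2 * deriv a (fst (fst z)) * (\<Sum>i\<in>Basis. \<Sum>j\<in>Basis. (snd z \<bullet> i) * (snd z \<bullet> j) * h (fst z) i j))"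
    by (intro continuous_intros ca c1)
  also have "?this \<longleftrightarrow> continuous_on (S \<times> UNIV) (conformal_lie a h)"
  proof (rule continuous_on_cong[OF refl])
    fix z :: "event \<times> event" assume "z \<in> S \<times> UNIV"
    then have z: "fst z \<in> S" by (simp add: mem_Times_iff)
    have sb: "sym_bilinear (h (fst z))" using h z by (simp add: C1_sym2_def)
    show "a (fst (fst z)) * (\<Sum>i\<in>Basis. \<Sum>j\<in>Basis. (snd z \<bullet> i) * (snd z \<bullet> j) * pd (1, 0) (\<lambda>x. h x i j) (fst z))
     + 2 * deriv a (fst (fst z)) * fst (snd z) * (\<Sum>i\<in>Basis. \<Sum>j\<in>Basis. (snd z \<bullet> i) * ((1, 0) \<bullet> j) * h (fst z) i j)
     - 2 * deriv a (fst (fst z)) * (\<Sum>i\<in>Basis. \<Sum>j\<in>Basis. (snd z \<bullet> i) * (snd z \<bullet> j) * h (fst z) i j)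
     = conformal_lie a h z"
      unfolding conformal_lie_def pd_C1_sym2[OF h z, of "(1, 0)" "snd z" "snd z"]
        sym_bilinear_expand[OF sb, of "snd z" "snd z"] sym_bilinear_expand[OF sb, of "snd z" "(1, 0)"] ..
  qed
  finally show ?thesis .
qed

lemma conformal_lie_linear:
  assumes h: "h \<in> C1_sym2 S" and d: "d \<in> C1_sym2 S" and S: "open S" "fst z \<in> S"
  shows "conformal_lie a (\<lambda>x u w. r * h x u w - d x u w) z = r * conformal_lie a h z - conformal_lie a d z"
  unfolding conformal_lie_def pd_C1_sym2_lincomb[OF h d S]
  by (simp add: algebra_simps)

subsection \<open>Perturbed light rays\<close>

lemma christoffel_cong:
  assumes "\<And>x. x \<in> spacetime \<Longrightarrow> g x = g' x" "x \<in> spacetime"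
  shows "christoffel g x u w = christoffel g' x u w"
proof -
  have "pd v (\<lambda>z. g z p q) x = pd v (\<lambda>z. g' z p q) x" for v p q
    by (rule pd_cong[OF open_spacetime assms(2)]) (simp add: assms(1))
  then show ?thesis unfolding christoffel_def assms(1)[OF assms(2)] by simp
qed

text \<open>\<open>g 0\<close> and \<open>flrw a\<close> are equal only on \<open>spacetime\<close>,
  where geodesics live. This links \<open>light_ray_transform\<close>, which is stated with
  \<open>flrw a\<close>, to the metric \<open>g 0\<close> for which regularity is assumed.\<close>

lemma geodesic_on_cong:
  assumes "\<And>x. x \<in> spacetime \<Longrightarrow> g x = g' x"
  shows "geodesic_on g x \<theta> J \<gamma> \<longleftrightarrow> geodesic_on g' x \<theta> J \<gamma>"
proof -
  have imp: "geodesic_on g2 x \<theta> J \<gamma>"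
    if eq: "\<And>x. x \<in> spacetime \<Longrightarrow> g1 x = g2 x" and geo: "geodesic_on g1 x \<theta> J \<gamma>" for g1 g2 :: tensor2
  proof -
    obtain \<gamma>' where \<gamma>': "\<gamma> 0 = x" "\<gamma>' 0 = \<theta>"
        "\<And>\<tau>. \<tau> \<in> J \<Longrightarrow> (\<gamma> has_vector_derivative \<gamma>' \<tau>) (at \<tau>)"
        "\<And>\<tau>. \<tau> \<in> J \<Longrightarrow> (\<gamma>' has_vector_derivative - christoffel g1 (\<gamma> \<tau>) (\<gamma>' \<tau>) (\<gamma>' \<tau>)) (at \<tau>)"
      using geo unfolding geodesic_on_def by blast
    have "christoffel g1 (\<gamma> \<tau>) u w = christoffel g2 (\<gamma> \<tau>) u w" if "\<tau> \<in> J" for \<tau> u w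
      by (rule christoffel_cong[OF eq]) (use geo that in \<open>auto simp: geodesic_on_def\<close>)
    then have "(\<gamma>' has_vector_derivative - christoffel g2 (\<gamma> \<tau>) (\<gamma>' \<tau>) (\<gamma>' \<tau>)) (at \<tau>)" if "\<tau> \<in> J" for \<tau>
      using \<gamma>'(4)[OF that] that by simp
    with \<gamma>'(1-3) geo show ?thesis unfolding geodesic_on_def by blast
  qed
  show ?thesis using imp[of g g'] imp[of g' g] assms by metis
qed

section \<open>One fixed ray: starting point \<open>y\<close> and direction \<open>v\<close>\<close>

locale redshift_setting =
  fixes a :: "real \<Rightarrow> real" and t0 t1 :: real and U1 :: "(real^3) set" and g :: "real \<Rightarrow> tensor2"
    and y v :: "real^3"
  assumes a_pos: "\<And>t. 0 < t \<Longrightarrow> 0 < a t"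
    and a_smooth: "smooth_on_pos a"
    and t0_pos: "0 < t0"
    and t0_less_t1: "t0 < t1"
    and g_regular: "\<And>\<epsilon>. \<epsilon> \<in> {0..1} \<Longrightarrow> regular_metric (g \<epsilon>)"
    and g_zero: "\<And>x. x \<in> spacetime \<Longrightarrow> g 0 x = flrw a x"
    and g_differentiable: "C2b_differentiable_on g (after t0) {0..1}"
    and g_agrees: "\<And>\<epsilon> x. \<epsilon> \<in> {0..1} \<Longrightarrow>
          x \<in> ({t1} \<times> U1) \<union> time_slice t0 \<union> (spacetime - after t0) \<Longrightarrow> g \<epsilon> x = flrw a x"
    and y: "y \<in> U1" and v: "norm v = 1"
begin

definition x0 :: event where "x0 = (t1, y)"
definition \<theta> :: event where "\<theta> = ray_dir a t1 v"
definition D :: "real \<Rightarrow> real set" where "D \<epsilon> = geod_dom (g \<epsilon>) x0 \<theta>"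
definition Z :: "real \<Rightarrow> real \<Rightarrow> event \<times> event" where "Z \<epsilon> = geod_phase (g \<epsilon>) x0 \<theta>"
definition hit :: "real \<Rightarrow> real" where "hit \<epsilon> = hit_param (g \<epsilon>) t0 x0 \<theta>"
definition h :: "real \<Rightarrow> tensor2" where "h \<epsilon> = (\<lambda>x u w. g \<epsilon> x u w - g 0 x u w)"

lemma g0: "regular_metric (g 0)" using g_regular by simp

lemma after_subset: "after t0 \<subseteq> spacetime"
  using t0_pos by (auto simp: after_def spacetime_def)

lemma h_C1: "\<epsilon> \<in> {0..1} \<Longrightarrow> h \<epsilon> \<in> C1_sym2 spacetime"
  unfolding h_def by (intro C1_sym2_diff regular_metric_C1 g_regular open_spacetime) auto

text \<open>The norm on \<open>after t0\<close> controls nothing for \<open>t \<le> t0\<close>.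
  Before \<open>t0\<close> the metrics agree on an open set, so their derivatives do; on the slice
  itself this passes to the limit by continuity of the partials.\<close>

lemma pd_agrees_before:
  assumes \<epsilon>: "\<epsilon> \<in> {0..1}" and x: "x \<in> spacetime" "fst x \<le> t0" and lm: "l \<in> Basis" "m \<in> Basis" "i \<in> Basis"
  shows "pd i (\<lambda>z. g \<epsilon> z l m) x = pd i (\<lambda>z. g 0 z l m) x"
proof -
  define \<phi> where "\<phi> x = pd i (\<lambda>z. g \<epsilon> z l m) x - pd i (\<lambda>z. g 0 z l m) x" for x
  have zero: "\<phi> x = 0" if "x \<in> spacetime" "fst x < t0" for x
  proof -
    define S where "S = spacetime \<inter> {z. fst z < t0}"
    have S: "open S" unfolding S_def by (intro open_Int open_spacetime open_Collect_less continuous_intros)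
    have "g \<epsilon> z l m = g 0 z l m" if "z \<in> S" for z
    proof -
      have "z \<in> spacetime - after t0" using that by (auto simp: S_def after_def)
      then show ?thesis using g_agrees[OF \<epsilon>] g_zero by simp
    qed
    moreover have "x \<in> S" using that by (simp add: S_def)
    ultimately show ?thesis unfolding \<phi>_def using pd_cong[OF S, of x "\<lambda>z. g \<epsilon> z l m" "\<lambda>z. g 0 z l m"] by simp
  qed
  have "continuous_on spacetime (pd i (\<lambda>z. g \<epsilon> z l m))" if "\<epsilon> \<in> {0..1}" for \<epsilon>
    using regular_metric_C1[OF g_regular[OF that]] lm unfolding C1_sym2_def C1_on_def by blast
  from continuous_on_diff[OF this[OF \<epsilon>] this[of 0]] have cont: "continuous_on spacetime \<phi>"
    by (simp add: \<phi>_def)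
  \<comment> \<open>Points approaching \<open>x\<close> from earlier times. The factor starts at
    \<open>1 / 2\<close>, so that no point has time 0.\<close>
  define s where "s n = (fst x - fst x * inverse (real (Suc (Suc n))), snd x)" for n
  have "(\<lambda>n. inverse (real (Suc (Suc n)))) \<longlonglongrightarrow> 0"
    by (rule LIMSEQ_Suc[OF LIMSEQ_inverse_real_of_nat])
  then have "s \<longlonglongrightarrow> (fst x - fst x * 0, snd x)" unfolding s_def by (intro tendsto_intros)
  then have lim: "s \<longlonglongrightarrow> x" by simp
  have fx: "0 < fst x" using x by (simp add: spacetime_def)
  have sn: "0 < fst (s n)" "fst (s n) < t0" for n
  proof -
    have "inverse (real (Suc (Suc n))) < 1" "0 < inverse (real (Suc (Suc n)))" by (auto simp: field_simps)
    then have "0 < fst x * inverse (real (Suc (Suc n)))" "fst x * inverse (real (Suc (Suc n))) < fst x * 1"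
      using fx by (intro mult_pos_pos mult_strict_left_mono; simp)+
    then show "0 < fst (s n)" "fst (s n) < t0" using x by (auto simp: s_def)
  qed
  have "isCont \<phi> x" using cont x open_spacetime by (simp add: continuous_on_eq_continuous_at)
  then have "(\<lambda>n. \<phi> (s n)) \<longlonglongrightarrow> \<phi> x" using lim by (rule isCont_tendsto_compose)
  moreover have "\<phi> (s n) = 0" for n using zero sn[of n] by (simp add: spacetime_def)
  ultimately have "\<phi> x = 0" by (simp add: LIMSEQ_const_iff)
  then show ?thesis by (simp add: \<phi>_def)
qed

text \<open>Unlike \<open>first_variation\<close>, this field is not cut off at \<open>t1\<close>:
  it is regular on the whole open set \<open>after t0\<close>, so perturbed rays can be inserted in
  it.\<close>

definition d :: tensor2 where
  "d = (SOME d. d \<in> C2b_sym2 (after t0) \<and>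
     (\<forall>\<eta>>0. \<forall>\<^sub>F \<epsilon> in at 0 within {0..1}. C1_diff_quotient_close g (after t0) d \<eta> \<epsilon>))"

lemma d: "d \<in> C2b_sym2 (after t0)"
  and d_approx: "\<eta> > 0 \<Longrightarrow> \<forall>\<^sub>F \<epsilon> in at 0 within {0..1}. C1_diff_quotient_close g (after t0) d \<eta> \<epsilon>"
proof -
  note * = someI_ex[OF C2b_differentiable_at_0[OF g_differentiable open_after, unfolded Bex_def], folded d_def]
  show "d \<in> C2b_sym2 (after t0)" by (rule conjunct1[OF *])
  show "\<eta> > 0 \<Longrightarrow> \<forall>\<^sub>F \<epsilon> in at 0 within {0..1}. C1_diff_quotient_close g (after t0) d \<eta> \<epsilon>"
    by (rule mp[OF spec[OF conjunct2[OF *]]])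
qed

lemma d_C1: "d \<in> C1_sym2 (after t0)"
  using d C2_sym2_imp_C1 unfolding C2b_sym2_def by blast

lemma d_bound: "\<exists>B\<ge>0. \<forall>x\<in>after t0. \<forall>l\<in>Basis. \<forall>m\<in>Basis. \<bar>d x l m\<bar> \<le> B \<and> (\<forall>i\<in>Basis. \<bar>pd i (\<lambda>z. d z l m) x\<bar> \<le> B)"
proof -
  obtain B where B: "B \<ge> 0" "\<forall>r\<in>coord_derivs (after t0) d. \<bar>r\<bar> \<le> B"
    using C2b_sym2_bound[OF d] by blast
  then show ?thesis unfolding coord_derivs_le_iff by (intro exI[of _ B]) simp
qed

text \<open>On \<open>after t0\<close> the difference quotient is within 1 of \<open>d\<close>, and
  \<open>d\<close> is bounded by \<open>B\<close>, whence \<open>C = B + 1\<close>; elsewhere values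
  and first derivatives of the metrics agree.\<close>

lemma close_linear: "\<exists>C\<ge>0. \<forall>\<^sub>F \<epsilon> in at 0 within {0..1}. C1_close (C * \<epsilon>) (g \<epsilon>) (g 0)"
proof -
  obtain B where B: "B \<ge> 0" "\<And>x l m. x \<in> after t0 \<Longrightarrow> l \<in> Basis \<Longrightarrow> m \<in> Basis \<Longrightarrow> \<bar>d x l m\<bar> \<le> B"
    "\<And>x l m i. x \<in> after t0 \<Longrightarrow> l \<in> Basis \<Longrightarrow> m \<in> Basis \<Longrightarrow> i \<in> Basis \<Longrightarrow> \<bar>pd i (\<lambda>z. d z l m) x\<bar> \<le> B"
    using d_bound by blast
  have "\<forall>\<^sub>F \<epsilon> in at 0 within {0..1}. \<epsilon> \<in> {0..1::real} \<and> \<epsilon> \<noteq> 0"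
    by (auto simp: eventually_at_filter)
  from this d_approx[OF zero_less_one]
  have "\<forall>\<^sub>F \<epsilon> in at 0 within {0..1}. C1_close ((B + 1) * \<epsilon>) (g \<epsilon>) (g 0)"
  proof eventually_elim
    case (elim \<epsilon>)
    have \<epsilon>: "\<epsilon> \<in> {0..1}" "\<epsilon> > 0" using elim(1) by auto
    have est: "\<bar>p\<bar> \<le> (B + 1) * \<epsilon>" if "\<bar>p / \<epsilon> - q\<bar> \<le> 1" "\<bar>q\<bar> \<le> B" for p q
    proof -
      have "\<bar>p / \<epsilon>\<bar> \<le> B + 1" using that by linarith
      then show ?thesis using \<epsilon>(2) by (simp add: pos_divide_le_eq)
    qed
    have nn: "0 \<le> (B + 1) * \<epsilon>" using B \<epsilon> by simp
    show ?case unfolding C1_close_def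
    proof (intro ballI conjI)
      fix x l m i :: event assume x: "x \<in> spacetime" and lm: "l \<in> Basis" "m \<in> Basis"
      show "\<bar>g \<epsilon> x l m - g 0 x l m\<bar> \<le> (B + 1) * \<epsilon>"
      proof (cases "x \<in> after t0")
        case True
        then have "\<bar>(g \<epsilon> x l m - g 0 x l m) / \<epsilon> - d x l m\<bar> \<le> 1" using elim(2) lm unfolding C1_diff_quotient_close_def by blast
        then show ?thesis by (rule est) (rule B(2)[OF True lm])
      next
        case False
        then have "x \<in> ({t1} \<times> U1) \<union> time_slice t0 \<union> (spacetime - after t0)" using x by simp
        then have "g \<epsilon> x = g 0 x" using g_agrees[OF \<epsilon>(1)] g_zero[OF x] by simp
        then show ?thesis using nn by simp
      qed
      assume i: "i \<in> Basis"
      show "\<bar>pd i (\<lambda>z. g \<epsilon> z l m) x - pd i (\<lambda>z. g 0 z l m) x\<bar> \<le> (B + 1) * \<epsilon>"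
      proof (cases "x \<in> after t0")
        case True
        then have "\<bar>(pd i (\<lambda>z. g \<epsilon> z l m) x - pd i (\<lambda>z. g 0 z l m) x) / \<epsilon> - pd i (\<lambda>z. d z l m) x\<bar> \<le> 1"
          using elim(2) lm i unfolding C1_diff_quotient_close_def by blast
        then show ?thesis by (rule est) (rule B(3)[OF True lm i])
      next
        case False
        then have "fst x \<le> t0" by (simp add: after_def)
        then show ?thesis using pd_agrees_before[OF \<epsilon>(1) x _ lm i] nn by simp
      qed
    qed
  qed
  then show ?thesis using B(1) by (intro exI[of _ "B + 1"]) auto
qed

lemma a_t1: "a t1 > 0" and a_t0: "a t0 > 0" using a_pos t0_pos t0_less_t1 by auto

lemma g_x0: "\<epsilon> \<in> {0..1} \<Longrightarrow> g \<epsilon> x0 = flrw a x0"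
  using y by (intro g_agrees) (auto simp: x0_def)

text \<open>All metrics equal the background at \<open>x0\<close>, so one direction is null for
  every \<open>\<epsilon>\<close>. The same fact fixes the initial pairing in
  \<open>ray_energy\<close>.\<close>

lemma ray_null:
  assumes "\<epsilon> \<in> {0..1}"
  shows "g \<epsilon> x0 \<theta> \<theta> = 0"
proof -
  have "v \<bullet> v = 1" using v by (simp flip: power2_norm_eq_inner)
  then show ?thesis
    unfolding g_x0[OF assms] using a_t1
    by (simp add: flrw_def \<theta>_def ray_dir_def x0_def power2_eq_square field_simps)
qed

lemma ray_energy: "\<epsilon> \<in> {0..1} \<Longrightarrow> g \<epsilon> x0 \<theta> (a t1, 0) = a t1"
  by (simp only: g_x0) (simp add: flrw_def \<theta>_def ray_dir_def)

lemma Z_phase_curve: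
  assumes "\<epsilon> \<in> {0..1}" "\<tau> \<in> D \<epsilon>"
  shows "phase_curve (g \<epsilon>) (x0, \<theta>) (D \<epsilon>) (Z \<epsilon>)"
  unfolding D_def Z_def using assms(2) by (intro phase_curve_geod g_regular assms) (auto simp: D_def)

lemma Z_facts:
  assumes "\<epsilon> \<in> {0..1}" "\<tau> \<in> D \<epsilon>"
  shows "fst (Z \<epsilon> \<tau>) \<in> spacetime"
    "((\<lambda>s. fst (fst (Z \<epsilon> s))) has_real_derivative fst (snd (Z \<epsilon> \<tau>))) (at \<tau>)"
    "isCont (Z \<epsilon>) \<tau>" "Z \<epsilon> 0 = (x0, \<theta>)" "is_interval (D \<epsilon>)" "0 \<in> D \<epsilon>" "open (D \<epsilon>)"
proof -
  note pc = Z_phase_curve[OF assms]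
  have d: "(Z \<epsilon> has_vector_derivative geodesic_field (g \<epsilon>) (Z \<epsilon> \<tau>)) (at \<tau>)"
    using pc assms(2) unfolding phase_curve_def by blast
  show "isCont (Z \<epsilon>) \<tau>" by (rule has_vector_derivative_continuous[OF d])
  show "((\<lambda>s. fst (fst (Z \<epsilon> s))) has_real_derivative fst (snd (Z \<epsilon> \<tau>))) (at \<tau>)"
    using bounded_linear.has_vector_derivative[OF bounded_linear_fst
        bounded_linear.has_vector_derivative[OF bounded_linear_fst d]]
    by (simp add: geodesic_field_def has_real_derivative_iff_has_vector_derivative)
  show "fst (Z \<epsilon> \<tau>) \<in> spacetime" "Z \<epsilon> 0 = (x0, \<theta>)" "is_interval (D \<epsilon>)" "0 \<in> D \<epsilon>" "open (D \<epsilon>)"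
    using pc assms(2) unfolding phase_curve_def by blast+
qed

lemma Z_pairing_derivative:
  assumes "\<epsilon> \<in> {0..1}" "\<tau> \<in> D \<epsilon>"
  shows "((\<lambda>s. g \<epsilon> (fst (Z \<epsilon> s)) (snd (Z \<epsilon> s)) (a (fst (fst (Z \<epsilon> s))), 0)) has_real_derivative
     conformal_lie a (h \<epsilon>) (Z \<epsilon> \<tau>) / 2) (at \<tau>)"
proof -
  have null: "g \<epsilon> (fst (x0, \<theta>)) (snd (x0, \<theta>)) (snd (x0, \<theta>)) = 0"
    using ray_null[OF assms(1)] by simp
  show ?thesis
    unfolding h_def
    by (rule null_phase_curve_pairing_derivative[OF g_regular[OF assms(1)] g0 g_zero a_smooth
          Z_phase_curve[OF assms] assms(2) null])
qed

lemma conformal_lie_h0: "conformal_lie a (h 0) z = 0"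
proof -
  have "((\<lambda>x. 0::real) has_derivative (\<lambda>v. 0)) (at (fst z))" by (rule has_derivative_const)
  from pd_eqI[OF this] show ?thesis by (simp add: conformal_lie_def h_def)
qed

text \<open>For \<open>\<epsilon> = 0\<close> the perturbation vanishes, so the pairing
  \<open>- a(t) t'\<close> is constant, with initial value \<open>a t1 > 0\<close>.\<close>

lemma ray0_velocity:
  assumes "\<tau> \<in> D 0"
  shows "fst (snd (Z 0 \<tau>)) < 0"
proof -
  have 0: "(0::real) \<in> {0..1}" by simp
  define f where "f s = g 0 (fst (Z 0 s)) (snd (Z 0 s)) (a (fst (fst (Z 0 s))), 0)" for s
  have "(f has_real_derivative 0) (at s)" if "s \<in> D 0" for s
    using Z_pairing_derivative[OF 0 that] unfolding conformal_lie_h0 f_def by simp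
  then have "f \<tau> = f 0"
    using constant_on_interval[OF Z_facts(5)[OF 0 assms]] assms Z_facts(6)[OF 0 assms] by blast
  also have "f 0 = a t1" using Z_facts(4)[OF 0 assms] ray_energy[OF 0] by (simp add: f_def x0_def)
  finally have "f \<tau> > 0" using a_t1 by simp
  moreover have sp: "fst (Z 0 \<tau>) \<in> spacetime" by (rule Z_facts(1)[OF 0 assms])
  then have "f \<tau> = - (fst (snd (Z 0 \<tau>)) * a (fst (fst (Z 0 \<tau>))))"
    using g_zero[OF sp] by (simp add: f_def flrw_def)
  moreover have "a (fst (fst (Z 0 \<tau>))) > 0" using sp a_pos by (simp add: spacetime_def)
  ultimately show ?thesis by (simp add: mult_less_0_iff)
qed

section \<open>The unique crossing of the initial slice\<close>

lemma time_decreasing: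
  assumes \<epsilon>: "\<epsilon> \<in> {0..1}" and I: "{p..q} \<subseteq> D \<epsilon>" and "p < q"
    and neg: "\<And>s. s \<in> {p..q} \<Longrightarrow> fst (snd (Z \<epsilon> s)) < 0"
  shows "fst (fst (Z \<epsilon> q)) < fst (fst (Z \<epsilon> p))"
proof (rule DERIV_neg_imp_decreasing[OF \<open>p < q\<close>])
  fix s assume "p \<le> s" "s \<le> q"
  then have s: "s \<in> {p..q}" by simp
  show "\<exists>y. ((\<lambda>s. fst (fst (Z \<epsilon> s))) has_real_derivative y) (at s) \<and> y < 0"
    using Z_facts(2)[OF \<epsilon>] I s neg[OF s] by blast
qed

text \<open>A parameter strictly past the crossing of the background ray: all comparison happens on
  the fixed compact interval \<open>{0..T}\<close>, whatever the perturbed hitting parameter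
  is.\<close>

definition T :: real where
  "T = (SOME T. 0 < T \<and> T \<in> D 0 \<and> fst (fst (Z 0 T)) < t0)"

lemma T: "0 < T" "T \<in> D 0" "fst (fst (Z 0 T)) < t0"
proof -
  have "\<exists>T>0. T \<in> geod_dom (g 0) (t1, y) (ray_dir a t1 v) \<and> fst (geod (g 0) (t1, y) (ray_dir a t1 v) T) < t0"
    by (rule flrw_ray_reaches[OF g0 g_zero a_pos a_smooth t0_pos t0_less_t1 v])
  then have "\<exists>T. 0 < T \<and> T \<in> D 0 \<and> fst (fst (Z 0 T)) < t0"
    by (auto simp: D_def Z_def geod_phase_def x0_def \<theta>_def)
  from someI_ex[OF this, folded T_def] show "0 < T" "T \<in> D 0" "fst (fst (Z 0 T)) < t0" by blast+
qed

lemma T_dom: "{0..T} \<subseteq> D 0"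
proof
  fix s assume s: "s \<in> {0..T}"
  have 0: "(0::real) \<in> {0..1}" by simp
  show "s \<in> D 0"
    by (rule mem_is_interval_1_I[OF Z_facts(5,6)[OF 0 T(2)] T(2)]) (use s in auto)
qed

text \<open>Conditions that survive small perturbations and force exactly one crossing in
  \<open>{0..T}\<close>: time decreases strictly and has passed \<open>t0\<close> at
  \<open>T\<close>.\<close>

definition good :: "real \<Rightarrow> bool" where
  "good \<epsilon> \<longleftrightarrow> \<epsilon> \<in> {0..1} \<and> {0..T} \<subseteq> D \<epsilon> \<and> (\<forall>\<tau>\<in>{0..T}. fst (snd (Z \<epsilon> \<tau>)) < 0) \<and> fst (fst (Z \<epsilon> T)) < t0"

lemma good_0: "good 0"
  unfolding good_def
proof (intro conjI ballI)
  show "fst (snd (Z 0 \<tau>)) < 0" if "\<tau> \<in> {0..T}" for \<tau>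
    by (rule ray0_velocity) (use T_dom that in blast)
qed (use T_dom T(3) in simp_all)

lemma fst_fst_diff_le: "\<bar>fst (fst p) - fst (fst q)\<bar> \<le> norm (p - q)" for p q :: "event \<times> event"
  using norm_fst_le_norm[of "fst (p - q)"] norm_fst_le_norm[of "p - q"] by simp

lemma fst_snd_diff_le: "\<bar>fst (snd p) - fst (snd q)\<bar> \<le> norm (p - q)" for p q :: "event \<times> event"
  using norm_fst_le_norm[of "snd (p - q)"] norm_snd_le_norm[of "p - q"] by simp

lemma eventually_good:
  assumes \<eta>: "\<eta> > 0"
  shows "\<forall>\<^sub>F \<epsilon> in at 0 within {0..1}. good \<epsilon> \<and> (\<forall>\<tau>\<in>{0..T}. norm (Z \<epsilon> \<tau> - Z 0 \<tau>) \<le> \<eta>)"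
proof -
  have 0: "(0::real) \<in> {0..1}" by simp
  have "continuous_on {0..T} (Z 0)"
    using Z_facts(3)[OF 0] T_dom by (meson continuous_at_imp_continuous_on subsetD)
  then have "continuous_on {0..T} (\<lambda>s. fst (snd (Z 0 s)))" by (intro continuous_intros)
  then obtain s0 where s0: "s0 \<in> {0..T}" "\<And>s. s \<in> {0..T} \<Longrightarrow> fst (snd (Z 0 s)) \<le> fst (snd (Z 0 s0))"
    using continuous_attains_sup[of "{0..T}" "\<lambda>s. fst (snd (Z 0 s))"] T(1) by auto
  define \<kappa> where "\<kappa> = - fst (snd (Z 0 s0))"
  have \<kappa>: "\<kappa> > 0" using ray0_velocity T_dom s0(1) by (auto simp: \<kappa>_def)
  \<comment> \<open>Closeness below \<open>\<kappa>\<close>, the least speed of the background time,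
    keeps the time velocity negative; closeness below the overshoot at \<open>T\<close> keeps the
    endpoint past the slice. The halves make both strict.\<close>
  define \<eta>' where "\<eta>' = min \<eta> (min (\<kappa> / 2) ((t0 - fst (fst (Z 0 T))) / 2))"
  have \<eta>': "\<eta>' > 0" "\<eta>' \<le> \<eta>" "\<eta>' < \<kappa>" "\<eta>' < t0 - fst (fst (Z 0 T))"
    using \<eta> \<kappa> T(3) by (auto simp: \<eta>'_def min_less_iff_disj)
  obtain \<delta> where \<delta>: "\<delta> > 0" "\<And>g'. regular_metric g' \<Longrightarrow> C1_close \<delta> g' (g 0) \<Longrightarrow> {0..T} \<subseteq> geod_dom g' x0 \<theta> \<and>
     (\<forall>\<tau>\<in>{0..T}. norm (geod_phase g' x0 \<theta> \<tau> - geod_phase (g 0) x0 \<theta> \<tau>) \<le> \<eta>')"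
    using geod_stable[OF g0 _ _ \<eta>'(1), of T x0 \<theta>] T(1,2) unfolding D_def by (meson less_imp_le)
  obtain C where C: "C \<ge> 0" "\<forall>\<^sub>F \<epsilon> in at 0 within {0..1}. C1_close (C * \<epsilon>) (g \<epsilon>) (g 0)"
    using close_linear by blast
  have "((\<lambda>\<epsilon>. C * \<epsilon>) \<longlongrightarrow> C * 0) (at 0 within {0..1})" by (intro tendsto_intros)
  then have "\<forall>\<^sub>F \<epsilon> in at 0 within {0..1}. C * \<epsilon> < \<delta>" using \<delta>(1) by (intro order_tendstoD) auto
  moreover have "\<forall>\<^sub>F \<epsilon> in at 0 within {0..1}. \<epsilon> \<in> {0..1::real}" by (auto simp: eventually_at_filter)
  ultimately show ?thesis using C(2)
  proof eventually_elim
    case (elim \<epsilon>)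
    have "C1_close \<delta> (g \<epsilon>) (g 0)"
      using elim(1,3) unfolding C1_close_def by (meson less_imp_le order_trans)
    then have *: "{0..T} \<subseteq> D \<epsilon>" "\<And>\<tau>. \<tau> \<in> {0..T} \<Longrightarrow> norm (Z \<epsilon> \<tau> - Z 0 \<tau>) \<le> \<eta>'"
      using \<delta>(2)[OF g_regular[OF elim(2)]] unfolding D_def Z_def by blast+
    have "fst (snd (Z \<epsilon> \<tau>)) < 0" if "\<tau> \<in> {0..T}" for \<tau>
      using *(2)[OF that] fst_snd_diff_le[of "Z \<epsilon> \<tau>" "Z 0 \<tau>"] s0(2)[OF that] \<eta>'(3)
      unfolding \<kappa>_def by linarith
    moreover have "fst (fst (Z \<epsilon> T)) < t0"
      using *(2)[of T] fst_fst_diff_le[of "Z \<epsilon> T" "Z 0 T"] \<eta>'(4) T(1) by auto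
    ultimately show ?case using elim(2) * \<eta>'(2) unfolding good_def by (meson order_trans)
  qed
qed

lemma good_time_less:
  assumes "good \<epsilon>" "0 \<le> p" "p < q" "q \<le> T"
  shows "fst (fst (Z \<epsilon> q)) < fst (fst (Z \<epsilon> p))"
  using assms unfolding good_def by (intro time_decreasing) auto

text \<open>\<open>LEAST\<close> on the reals is informative only if a minimum is attained: the
  intermediate value theorem provides a crossing, and strict decrease of time rules out an earlier
  one.\<close>

lemma hit:
  assumes good: "good \<epsilon>"
  shows "0 < hit \<epsilon>" "hit \<epsilon> < T" "fst (fst (Z \<epsilon> (hit \<epsilon>))) = t0"
    "hit_param (g \<epsilon>) t0 x0 \<theta> = hit \<epsilon>"
proof -
  have \<epsilon>: "\<epsilon> \<in> {0..1}" and dom: "{0..T} \<subseteq> D \<epsilon>" using good by (auto simp: good_def)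
  have "0 \<in> D \<epsilon>" using dom T(1) by auto
  then have Z0: "fst (fst (Z \<epsilon> 0)) = t1" using Z_facts(4)[OF \<epsilon>] by (simp add: x0_def)
  have "continuous_on {0..T} (\<lambda>s. fst (fst (Z \<epsilon> s)))"
    using Z_facts(2)[OF \<epsilon>] dom by (intro continuous_at_imp_continuous_on ballI) (meson DERIV_isCont subsetD)
  then obtain r where r: "0 \<le> r" "r \<le> T" "fst (fst (Z \<epsilon> r)) = t0"
    using IVT2'[of "\<lambda>s. fst (fst (Z \<epsilon> s))" T t0 0] Z0 t0_less_t1 good T(1) by (auto simp: good_def)
  have r': "0 < r" "r < T" using r Z0 t0_less_t1 good by (auto simp: good_def less_le)
  have geodZ: "geod (g \<epsilon>) x0 \<theta> s = fst (Z \<epsilon> s)" for s by (simp add: Z_def geod_phase_def)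
  have "hit_param (g \<epsilon>) t0 x0 \<theta> = r"
    unfolding hit_param_def
  proof (rule Least_equality)
    show "0 < r \<and> r \<in> geod_dom (g \<epsilon>) x0 \<theta> \<and> geod (g \<epsilon>) x0 \<theta> r \<in> time_slice t0"
      using r r' dom by (auto simp: time_slice_def geodZ D_def)
    fix s assume s: "0 < s \<and> s \<in> geod_dom (g \<epsilon>) x0 \<theta> \<and> geod (g \<epsilon>) x0 \<theta> s \<in> time_slice t0"
    then have ts: "fst (fst (Z \<epsilon> s)) = t0" by (simp add: time_slice_def geodZ)
    show "r \<le> s"
    proof (rule ccontr)
      assume "\<not> r \<le> s"
      then show False using good_time_less[OF good, of s r] s r ts by simp
    qed
  qed
  then show "0 < hit \<epsilon>" "hit \<epsilon> < T" "fst (fst (Z \<epsilon> (hit \<epsilon>))) = t0" "hit_param (g \<epsilon>) t0 x0 \<theta> = hit \<epsilon>"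
    using r r' by (simp_all add: hit_def)
qed

text \<open>Comparison with the hitting parameter becomes comparison of time with \<open>t0\<close>.
  Thus convergence of \<open>Z\<close> can do the work of convergence of \<open>hit\<close>.\<close>

lemma good_time_iff:
  assumes good: "good \<epsilon>" and \<tau>: "\<tau> \<in> {0..T}"
  shows "t0 < fst (fst (Z \<epsilon> \<tau>)) \<longleftrightarrow> \<tau> < hit \<epsilon>" "fst (fst (Z \<epsilon> \<tau>)) < t0 \<longleftrightarrow> hit \<epsilon> < \<tau>"
proof -
  note * = hit[OF good] good_time_less[OF good, of \<tau> "hit \<epsilon>"] good_time_less[OF good, of "hit \<epsilon>" \<tau>]
  consider "\<tau> < hit \<epsilon>" | "\<tau> = hit \<epsilon>" | "hit \<epsilon> < \<tau>" by linarith
  then show "t0 < fst (fst (Z \<epsilon> \<tau>)) \<longleftrightarrow> \<tau> < hit \<epsilon>" "fst (fst (Z \<epsilon> \<tau>)) < t0 \<longleftrightarrow> hit \<epsilon> < \<tau>"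
    by (cases; use * \<tau> in force)+
qed

lemma good_time_le:
  assumes good: "good \<epsilon>" and \<tau>: "\<tau> \<in> {0..T}"
  shows "fst (fst (Z \<epsilon> \<tau>)) \<le> t1"
proof -
  have \<epsilon>: "\<epsilon> \<in> {0..1}" "0 \<in> D \<epsilon>" using good T(1) by (auto simp: good_def)
  have "fst (fst (Z \<epsilon> 0)) = t1" using Z_facts(4)[OF \<epsilon>] by (simp add: x0_def)
  then show ?thesis using good_time_less[OF good, of 0 \<tau>] \<tau> by (cases "\<tau> = 0") auto
qed

lemma redshift_integral:
  assumes good: "good \<epsilon>"
  shows "((\<lambda>\<tau>. conformal_lie a (h \<epsilon>) (Z \<epsilon> \<tau>) / 2) has_integral
     a t0 * (redshift a t0 t1 (g \<epsilon>) y v + 1) - a t1) {0..hit \<epsilon>}"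
proof -
  have \<epsilon>: "\<epsilon> \<in> {0..1}" and dom: "{0..T} \<subseteq> D \<epsilon>" using good by (auto simp: good_def)
  have D0: "0 \<in> D \<epsilon>" using dom T(1) by auto
  note hh = hit[OF good]
  define f where "f s = g \<epsilon> (fst (Z \<epsilon> s)) (snd (Z \<epsilon> s)) (a (fst (fst (Z \<epsilon> s))), 0)" for s
  have "((\<lambda>\<tau>. conformal_lie a (h \<epsilon>) (Z \<epsilon> \<tau>) / 2) has_integral f (hit \<epsilon>) - f 0) {0..hit \<epsilon>}"
  proof (rule fundamental_theorem_of_calculus)
    fix s assume "s \<in> {0..hit \<epsilon>}"
    then have "s \<in> D \<epsilon>" using dom hh by auto
    from Z_pairing_derivative[OF \<epsilon> this]
    show "(f has_vector_derivative conformal_lie a (h \<epsilon>) (Z \<epsilon> s) / 2) (at s within {0..hit \<epsilon>})"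
      unfolding f_def has_real_derivative_iff_has_vector_derivative by (rule has_vector_derivative_at_within)
  qed (use hh in simp)
  moreover have "f 0 = a t1"
    using Z_facts(4)[OF \<epsilon> D0] ray_energy[OF \<epsilon>] by (simp add: f_def x0_def)
  moreover have "f (hit \<epsilon>) = a t0 * (redshift a t0 t1 (g \<epsilon>) y v + 1)"
  proof -
    have h': "hit \<epsilon> \<in> D \<epsilon>" using dom hh by auto
    have sb: "sym_bilinear (g \<epsilon> (fst (Z \<epsilon> (hit \<epsilon>))))"
      by (intro regular_metric_sym g_regular \<epsilon> Z_facts(1) h')
    have "redshift a t0 t1 (g \<epsilon>) y v = g \<epsilon> (fst (Z \<epsilon> (hit \<epsilon>))) (snd (Z \<epsilon> (hit \<epsilon>))) (1, 0) - 1"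
      by (simp add: redshift_def Let_def hh(4)[unfolded x0_def \<theta>_def] Z_def geod_phase_def x0_def \<theta>_def)
    moreover have "(a t0, 0 :: real^3) = a t0 *\<^sub>R (1, 0)" by simp
    ultimately show ?thesis unfolding f_def hh(3) by (simp only: sym_bilinear_simps(6)[OF sb]) simp
  qed
  ultimately show ?thesis by simp
qed

text \<open>Subtracting this background value turns the boundary term of
  \<open>redshift_integral\<close> into \<open>a t0\<close> times the change of the
  redshift.\<close>

lemma redshift_0: "a t0 * (redshift a t0 t1 (g 0) y v + 1) = a t1"
proof -
  have "((\<lambda>\<tau>. 0 / 2) has_integral a t0 * (redshift a t0 t1 (g 0) y v + 1) - a t1) {0..hit 0}"
    using redshift_integral[OF good_0] unfolding conformal_lie_h0 .
  then show ?thesis using has_integral_0_eq by fastforce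
qed

section \<open>Bounds uniform in the perturbation parameter\<close>

lemma a_bounds: "\<exists>M. \<forall>t\<in>{t0..t1}. \<bar>a t\<bar> \<le> M \<and> \<bar>deriv a t\<bar> \<le> M"
proof -
  have c: "continuous_on {t0..t1} a" "continuous_on {t0..t1} (deriv a)"
    using smooth_on_pos_derivs(2)[OF a_smooth] DERIV_isCont[OF smooth_on_pos_derivs(1)[OF a_smooth]] t0_pos
    by (auto intro!: continuous_at_imp_continuous_on)
  have "bounded (a ` {t0..t1})" "bounded (deriv a ` {t0..t1})"
    by (intro compact_imp_bounded compact_continuous_image c; simp)+
  then obtain M1 M2 where "\<forall>x\<in>a ` {t0..t1}. norm x \<le> M1" "\<forall>x\<in>deriv a ` {t0..t1}. norm x \<le> M2"
    unfolding bounded_iff by blast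
  then show ?thesis by (intro exI[of _ "max M1 M2"]) (auto simp: le_max_iff_disj)
qed

lemma Z0_bounded: "\<exists>R. \<forall>\<tau>\<in>{0..T}. norm (Z 0 \<tau>) \<le> R"
proof -
  have 0: "(0::real) \<in> {0..1}" by simp
  have "continuous_on {0..T} (Z 0)"
    using Z_facts(3)[OF 0] T_dom by (meson continuous_at_imp_continuous_on subsetD)
  then have "bounded (Z 0 ` {0..T})" by (intro compact_imp_bounded compact_continuous_image) auto
  then show ?thesis unfolding bounded_iff by blast
qed

text \<open>The summand 1 makes \<open>R\<close> a bound also for phase points within distance 1 of
  the background ray.\<close>

definition phase_bound :: "real \<Rightarrow> real \<Rightarrow> bool" where
  "phase_bound R M \<longleftrightarrow> (\<forall>\<tau>\<in>{0..T}. norm (Z 0 \<tau>) + 1 \<le> R) \<and> (\<forall>t\<in>{t0..t1}. \<bar>a t\<bar> \<le> M \<and> \<bar>deriv a t\<bar> \<le> M)"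

lemma phase_bound_exists: "\<exists>R M. phase_bound R M"
proof -
  obtain R M where "\<forall>\<tau>\<in>{0..T}. norm (Z 0 \<tau>) \<le> R" "\<forall>t\<in>{t0..t1}. \<bar>a t\<bar> \<le> M \<and> \<bar>deriv a t\<bar> \<le> M"
    using Z0_bounded a_bounds by blast
  then show ?thesis unfolding phase_bound_def by (intro exI[of _ "R + 1"] exI[of _ M]) auto
qed

definition lie_const :: "real \<Rightarrow> real \<Rightarrow> real" where
  "lie_const R M = (3 * M * R * R + 2 * M * R * R) * (\<Sum>i\<in>(Basis::event set). \<Sum>j\<in>(Basis::event set). 1)"

lemma conformal_lie_phase_bound:
  assumes b: "phase_bound R M" and k: "k \<in> C1_sym2 S" "open S" "fst z \<in> S"
    and \<delta>: "\<And>i j. i \<in> Basis \<Longrightarrow> j \<in> Basis \<Longrightarrow> \<bar>k (fst z) i j\<bar> \<le> \<delta>"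
      "\<And>i j. i \<in> Basis \<Longrightarrow> j \<in> Basis \<Longrightarrow> \<bar>pd (1, 0) (\<lambda>x. k x i j) (fst z)\<bar> \<le> \<delta>"
    and z: "norm (z - Z 0 \<tau>) \<le> 1" "\<tau> \<in> {0..T}" "fst (fst z) \<in> {t0..t1}"
  shows "\<bar>conformal_lie a k z\<bar> \<le> lie_const R M * \<delta>"
proof -
  have "norm z \<le> norm (Z 0 \<tau>) + norm (z - Z 0 \<tau>)" by (rule norm_triangle_sub)
  moreover have "norm (Z 0 \<tau>) + 1 \<le> R" using b z(2) unfolding phase_bound_def by blast
  ultimately have R: "norm z \<le> R" using z(1) by linarith
  have M: "\<bar>a (fst (fst z))\<bar> \<le> M" "\<bar>deriv a (fst (fst z))\<bar> \<le> M"
    using b z(3) unfolding phase_bound_def by blast+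
  show ?thesis unfolding lie_const_def by (rule conformal_lie_bound[OF k \<delta> R M])
qed

lemma lie_const_nonneg: "phase_bound R M \<Longrightarrow> lie_const R M \<ge> 0"
proof -
  assume b: "phase_bound R M"
  have "norm (Z 0 0) + 1 \<le> R" using b T(1) unfolding phase_bound_def by auto
  then have "R \<ge> 0" using norm_ge_zero[of "Z 0 0"] by linarith
  moreover have "\<bar>a t0\<bar> \<le> M" using b t0_less_t1 unfolding phase_bound_def by auto
  then have "M \<ge> 0" by linarith
  ultimately show ?thesis unfolding lie_const_def by (intro mult_nonneg_nonneg add_nonneg_nonneg sum_nonneg) auto
qed

definition tame :: "real \<Rightarrow> real \<Rightarrow> bool" where
  "tame C \<epsilon> \<longleftrightarrow> good \<epsilon> \<and> \<epsilon> > 0 \<and> C1_close (C * \<epsilon>) (g \<epsilon>) (g 0) \<and> (\<forall>\<tau>\<in>{0..T}. norm (Z \<epsilon> \<tau> - Z 0 \<tau>) \<le> 1)"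

lemma eventually_tame: "\<exists>C\<ge>0. \<forall>\<^sub>F \<epsilon> in at 0 within {0..1}. tame C \<epsilon>"
proof -
  obtain C where C: "C \<ge> 0" "\<forall>\<^sub>F \<epsilon> in at 0 within {0..1}. C1_close (C * \<epsilon>) (g \<epsilon>) (g 0)"
    using close_linear by blast
  have "\<forall>\<^sub>F \<epsilon> in at 0 within {0..1}. \<epsilon> > (0::real)" by (auto simp: eventually_at_filter)
  with C(2) eventually_good[OF zero_less_one] have "\<forall>\<^sub>F \<epsilon> in at 0 within {0..1}. tame C \<epsilon>"
    unfolding tame_def by eventually_elim blast
  with C(1) show ?thesis by blast
qed

text \<open>The dominating constant: up to the hit the ray stays in the time range of
  \<open>phase_bound\<close>, and the perturbation with its first derivatives is at most
  \<open>C * \<epsilon>\<close>, which the division by \<open>\<epsilon>\<close>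
  compensates.\<close>

lemma tame_integrand_bound:
  assumes b: "phase_bound R M" and t: "tame C \<epsilon>" and \<tau>: "\<tau> \<in> {0..hit \<epsilon>}"
  shows "\<bar>conformal_lie a (h \<epsilon>) (Z \<epsilon> \<tau>) / \<epsilon>\<bar> \<le> lie_const R M * C"
proof -
  have good: "good \<epsilon>" and \<epsilon>: "\<epsilon> > 0" "\<epsilon> \<in> {0..1}" using t by (auto simp: tame_def good_def)
  have close: "C1_close (C * \<epsilon>) (g \<epsilon>) (g 0)" using t by (simp add: tame_def)
  have \<tau>T: "\<tau> \<in> {0..T}" using \<tau> hit(2)[OF good] by auto
  then have "\<tau> \<in> D \<epsilon>" using good by (auto simp: good_def)
  then have sp: "fst (Z \<epsilon> \<tau>) \<in> spacetime" by (rule Z_facts(1)[OF \<epsilon>(2)])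
  have "\<bar>conformal_lie a (h \<epsilon>) (Z \<epsilon> \<tau>)\<bar> \<le> lie_const R M * (C * \<epsilon>)"
  proof (rule conformal_lie_phase_bound[OF b h_C1[OF \<epsilon>(2)] open_spacetime sp])
    fix i j :: event assume ij: "i \<in> Basis" "j \<in> Basis"
    show "\<bar>h \<epsilon> (fst (Z \<epsilon> \<tau>)) i j\<bar> \<le> C * \<epsilon>"
      using close sp ij unfolding C1_close_def h_def by blast
    have "\<bar>pd (1, 0) (\<lambda>z. g \<epsilon> z i j) (fst (Z \<epsilon> \<tau>)) - pd (1, 0) (\<lambda>z. g 0 z i j) (fst (Z \<epsilon> \<tau>))\<bar> \<le> C * \<epsilon>"
      using close sp ij time_in_Basis unfolding C1_close_def by blast
    then show "\<bar>pd (1, 0) (\<lambda>x. h \<epsilon> x i j) (fst (Z \<epsilon> \<tau>))\<bar> \<le> C * \<epsilon>"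
      unfolding h_def
      by (subst pd_C1_sym2_diff[OF regular_metric_C1[OF g_regular[OF \<epsilon>(2)]] regular_metric_C1[OF g0] open_spacetime sp])
  next
    show "norm (Z \<epsilon> \<tau> - Z 0 \<tau>) \<le> 1" using t \<tau>T unfolding tame_def by blast
    show "fst (fst (Z \<epsilon> \<tau>)) \<in> {t0..t1}"
      using good_time_le[OF good \<tau>T] good_time_iff(2)[OF good \<tau>T] \<tau> by auto
  qed (rule \<tau>T)
  then show ?thesis using \<epsilon>(1) by (simp add: field_simps)
qed

section \<open>Passage to the limit\<close>

lemma C1_sym2_subset: "k \<in> C1_sym2 S \<Longrightarrow> S' \<subseteq> S \<Longrightarrow> k \<in> C1_sym2 S'"
  unfolding C1_sym2_def C1_on_def by (blast intro: continuous_on_subset)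

text \<open>Two errors are separated. Replacing \<open>h \<epsilon> / \<epsilon>\<close> by
  \<open>d\<close> at the perturbed point costs little by linearity and uniform closeness on
  \<open>after t0\<close>; moving that point to the background ray costs little by continuity.
  \<open>\<tau> < hit 0\<close> places the limit point in the open set
  \<open>after t0\<close>.\<close>

lemma integrand_tendsto:
  assumes \<tau>: "0 \<le> \<tau>" "\<tau> < hit 0"
  shows "((\<lambda>\<epsilon>. conformal_lie a (h \<epsilon>) (Z \<epsilon> \<tau>) / \<epsilon>) \<longlongrightarrow> conformal_lie a d (Z 0 \<tau>)) (at 0 within {0..1})"
proof -
  let ?F = "at 0 within {0..1::real}"
  have \<tau>T: "\<tau> \<in> {0..T}" using \<tau> hit(2)[OF good_0] by auto
  obtain R M where b: "phase_bound R M" using phase_bound_exists by blast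
  define N where "N = lie_const R M"
  have N: "N \<ge> 0" unfolding N_def by (rule lie_const_nonneg[OF b])
  have Zlim: "((\<lambda>\<epsilon>. Z \<epsilon> \<tau>) \<longlongrightarrow> Z 0 \<tau>) ?F"
  proof (rule tendstoI)
    fix e :: real assume "e > 0"
    then have "e / 2 > 0" by simp
    from eventually_good[OF this] show "\<forall>\<^sub>F \<epsilon> in ?F. dist (Z \<epsilon> \<tau>) (Z 0 \<tau>) < e"
    proof eventually_elim
      case (elim \<epsilon>)
      then have "norm (Z \<epsilon> \<tau> - Z 0 \<tau>) \<le> e / 2" using \<tau>T by blast
      then show ?case using \<open>e > 0\<close> by (simp add: dist_norm)
    qed
  qed
  have t0: "t0 < fst (fst (Z 0 \<tau>))" using good_time_iff(1)[OF good_0 \<tau>T] \<tau> by simp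
  have "isCont (conformal_lie a d) (Z 0 \<tau>)"
  proof -
    have op: "open (after t0 \<times> (UNIV :: event set))" by (intro open_Times open_after open_UNIV)
    have "\<forall>p\<in>after t0 \<times> UNIV. isCont (conformal_lie a d) p"
      by (rule iffD1[OF continuous_on_eq_continuous_at[OF op]
            continuous_on_conformal_lie[OF d_C1 open_after a_smooth after_subset]])
    moreover have "Z 0 \<tau> \<in> after t0 \<times> UNIV" using t0 by (simp add: after_def mem_Times_iff)
    ultimately show ?thesis by (rule bspec)
  qed
  then have lim1: "((\<lambda>\<epsilon>. conformal_lie a d (Z \<epsilon> \<tau>)) \<longlongrightarrow> conformal_lie a d (Z 0 \<tau>)) ?F"
    using Zlim by (rule isCont_tendsto_compose)
  have lim2: "((\<lambda>\<epsilon>. conformal_lie a (h \<epsilon>) (Z \<epsilon> \<tau>) / \<epsilon> - conformal_lie a d (Z \<epsilon> \<tau>)) \<longlongrightarrow> 0) ?F"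
  proof (rule tendstoI)
    fix e :: real assume e: "e > 0"
    \<comment> \<open>The summand 1 keeps the denominator positive, and the factor 2 makes
      \<open>N * \<eta> < e\<close> strict.\<close>
    define \<eta> where "\<eta> = e / (2 * (N + 1))"
    have \<eta>: "\<eta> > 0" using e N by (simp add: \<eta>_def)
    have N\<eta>: "N * \<eta> < e"
    proof -
      have "\<eta> * (2 * (N + 1)) = e" using N by (simp add: \<eta>_def)
      then have "2 * \<eta> + 2 * (N * \<eta>) = e" by (simp add: algebra_simps)
      moreover have "N * \<eta> \<ge> 0" using \<eta> N by simp
      ultimately show ?thesis using \<eta> by linarith
    qed
    have ft: "((\<lambda>\<epsilon>. fst (fst (Z \<epsilon> \<tau>))) \<longlongrightarrow> fst (fst (Z 0 \<tau>))) ?F" by (intro tendsto_intros Zlim)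
    have "\<forall>\<^sub>F \<epsilon> in ?F. \<epsilon> > (0::real)" by (auto simp: eventually_at_filter)
    then show "\<forall>\<^sub>F \<epsilon> in ?F. dist (conformal_lie a (h \<epsilon>) (Z \<epsilon> \<tau>) / \<epsilon> - conformal_lie a d (Z \<epsilon> \<tau>)) 0 < e"
      using order_tendstoD(1)[OF ft t0] d_approx[OF \<eta>] eventually_good[OF zero_less_one]
    proof eventually_elim
      case (elim \<epsilon>)
      have good: "good \<epsilon>" using elim(4) by blast
      have \<epsilon>: "\<epsilon> \<in> {0..1}" using good by (simp add: good_def)
      have af: "fst (Z \<epsilon> \<tau>) \<in> after t0" using elim(2) by (simp add: after_def)
      have sp: "fst (Z \<epsilon> \<tau>) \<in> spacetime" using af after_subset by blast
      define q where "q = (\<lambda>x u w. inverse \<epsilon> * h \<epsilon> x u w - d x u w)"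
      have hC: "h \<epsilon> \<in> C1_sym2 (after t0)" by (rule C1_sym2_subset[OF h_C1[OF \<epsilon>] after_subset])
      have qC: "q \<in> C1_sym2 (after t0)" unfolding q_def by (rule C1_sym2_lincomb[OF hC d_C1 open_after])
      have eq: "conformal_lie a q (Z \<epsilon> \<tau>) = conformal_lie a (h \<epsilon>) (Z \<epsilon> \<tau>) / \<epsilon> - conformal_lie a d (Z \<epsilon> \<tau>)"
        unfolding q_def conformal_lie_linear[OF hC d_C1 open_after af] by (simp add: divide_inverse mult.commute)
      have "\<bar>conformal_lie a q (Z \<epsilon> \<tau>)\<bar> \<le> N * \<eta>"
        unfolding N_def
      proof (rule conformal_lie_phase_bound[OF b qC open_after af])
        fix i j :: event assume ij: "i \<in> Basis" "j \<in> Basis"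
        have "\<bar>(g \<epsilon> (fst (Z \<epsilon> \<tau>)) i j - g 0 (fst (Z \<epsilon> \<tau>)) i j) / \<epsilon> - d (fst (Z \<epsilon> \<tau>)) i j\<bar> \<le> \<eta>"
          using elim(3) af ij unfolding C1_diff_quotient_close_def by blast
        then show "\<bar>q (fst (Z \<epsilon> \<tau>)) i j\<bar> \<le> \<eta>" by (simp add: q_def h_def divide_inverse mult.commute)
        have pq: "pd (1, 0) (\<lambda>x. q x i j) (fst (Z \<epsilon> \<tau>)) =
          (pd (1, 0) (\<lambda>z. g \<epsilon> z i j) (fst (Z \<epsilon> \<tau>)) - pd (1, 0) (\<lambda>z. g 0 z i j) (fst (Z \<epsilon> \<tau>))) / \<epsilon>
          - pd (1, 0) (\<lambda>z. d z i j) (fst (Z \<epsilon> \<tau>))"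
          unfolding q_def pd_C1_sym2_lincomb[OF hC d_C1 open_after af]
          unfolding h_def pd_C1_sym2_diff[OF regular_metric_C1[OF g_regular[OF \<epsilon>]] regular_metric_C1[OF g0] open_spacetime sp]
          by (simp add: divide_inverse mult.commute)
        show "\<bar>pd (1, 0) (\<lambda>x. q x i j) (fst (Z \<epsilon> \<tau>))\<bar> \<le> \<eta>"
          unfolding pq using elim(3) af ij time_in_Basis unfolding C1_diff_quotient_close_def by blast
      next
        show "norm (Z \<epsilon> \<tau> - Z 0 \<tau>) \<le> 1" using elim(4) \<tau>T by blast
        show "fst (fst (Z \<epsilon> \<tau>)) \<in> {t0..t1}" using elim(2) good_time_le[OF good \<tau>T] by simp
      qed (rule \<tau>T)
      then show ?case using N\<eta> unfolding eq by simp
    qed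
  qed
  show ?thesis using tendsto_add[OF lim2 lim1] by simp
qed

text \<open>The interval is open because the ray lies on the slice at \<open>hit 0\<close>, outside
  the set where \<open>d\<close> is determined.\<close>

definition limit_integral :: real where
  "limit_integral = integral {0<..<hit 0} (\<lambda>\<tau>. conformal_lie a d (Z 0 \<tau>))"

lemma limit_integrand_set_integrable:
  "set_integrable lborel {0<..<hit 0} (\<lambda>\<tau>. conformal_lie a d (Z 0 \<tau>))"
proof -
  have 0: "(0::real) \<in> {0..1}" by simp
  obtain R M where b: "phase_bound R M" using phase_bound_exists by blast
  obtain B where B: "\<And>x l m. x \<in> after t0 \<Longrightarrow> l \<in> Basis \<Longrightarrow> m \<in> Basis \<Longrightarrow> \<bar>d x l m\<bar> \<le> B"
    "\<And>x l m i. x \<in> after t0 \<Longrightarrow> l \<in> Basis \<Longrightarrow> m \<in> Basis \<Longrightarrow> i \<in> Basis \<Longrightarrow> \<bar>pd i (\<lambda>z. d z l m) x\<bar> \<le> B"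
    using d_bound by blast
  have sub: "\<tau> \<in> {0..T}" "\<tau> \<in> D 0" "fst (Z 0 \<tau>) \<in> after t0" "fst (fst (Z 0 \<tau>)) \<in> {t0..t1}"
    if "\<tau> \<in> {0<..<hit 0}" for \<tau>
  proof -
    show \<tau>: "\<tau> \<in> {0..T}" using that hit(2)[OF good_0] by auto
    then show "\<tau> \<in> D 0" using T_dom by blast
    show "fst (Z 0 \<tau>) \<in> after t0" "fst (fst (Z 0 \<tau>)) \<in> {t0..t1}"
      using good_time_iff(1)[OF good_0 \<tau>] good_time_le[OF good_0 \<tau>] that by (auto simp: after_def)
  qed
  have bound: "\<bar>conformal_lie a d (Z 0 \<tau>)\<bar> \<le> lie_const R M * B" if "\<tau> \<in> {0<..<hit 0}" for \<tau>
  proof (rule conformal_lie_phase_bound[OF b d_C1 open_after sub(3)[OF that]])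
    show "norm (Z 0 \<tau> - Z 0 \<tau>) \<le> 1" by simp
  qed (use B sub[OF that] time_in_Basis in blast)+
  have "continuous_on {0<..<hit 0} (Z 0)"
    using Z_facts(3)[OF 0] sub(2) by (intro continuous_at_imp_continuous_on) blast
  then have cont: "continuous_on {0<..<hit 0} (\<lambda>\<tau>. conformal_lie a d (Z 0 \<tau>))"
    by (rule continuous_on_compose2[OF continuous_on_conformal_lie[OF d_C1 open_after a_smooth after_subset]])
      (use sub(3) in \<open>simp add: image_subset_iff mem_Times_iff\<close>)
  have meas: "(\<lambda>\<tau>. indicator {0<..<hit 0} \<tau> *\<^sub>R conformal_lie a d (Z 0 \<tau>)) \<in> borel_measurable lborel"
    using borel_measurable_continuous_on_indicator[OF _ cont] by simp
  show ?thesis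
    unfolding set_integrable_def
  proof (rule integrableI_bounded_set[OF _ meas, of "{0<..<hit 0}" "lie_const R M * B"])
    show "emeasure lborel {0<..<hit 0} < \<infinity>" using hit(1)[OF good_0] by simp
  qed (use bound in auto)
qed

text \<open>Dominated convergence along an arbitrary sequence. The moving endpoint sits inside the
  integrand as a cut-off: for \<open>\<tau> \<noteq> hit 0\<close> the time on the background ray
  differs from \<open>t0\<close>, the strict inequality persists along the sequence, and
  \<open>\<tau>\<close> ends up on the correct side of the cut.\<close>

lemma redshift_derivative:
  "((\<lambda>\<epsilon>. redshift a t0 t1 (g \<epsilon>) y v) has_real_derivative 1 / (2 * a t0) * limit_integral) (at 0 within {0..1})"
  unfolding has_field_derivative_iff tendsto_at_iff_sequentially
proof (intro allI impI)
  fix X :: "nat \<Rightarrow> real" assume X: "\<forall>n. X n \<in> {0..1} - {0}" "X \<longlonglongrightarrow> 0"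
  define r where "r \<epsilon> = redshift a t0 t1 (g \<epsilon>) y v" for \<epsilon>
  have XF: "filterlim X (at 0 within {0..1}) sequentially"
    using X unfolding filterlim_at by (auto intro!: always_eventually)
  obtain C where C: "C \<ge> 0" "\<forall>\<^sub>F \<epsilon> in at 0 within {0..1}. tame C \<epsilon>" using eventually_tame by blast
  have ev: "\<forall>\<^sub>F n in sequentially. tame C (X n)"
    using XF C(2) unfolding filterlim_iff by blast
  obtain R M where b: "phase_bound R M" using phase_bound_exists by blast
  \<comment> \<open>Pointwise convergence may fail at \<open>hit 0\<close>, where the cut-off limit
    is ambiguous, and at 0, where \<open>l\<close> is set to 0. Removing two points changes no
    integral.\<close>
  define S where "S = {0..T} - {0, hit 0}"
  \<comment> \<open>Terms that are not \<open>tame\<close> are set to 0, so that the domination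
    holds for every \<open>n\<close> and not only eventually.\<close>
  define f where "f n \<tau> = (if tame C (X n) then if \<tau> \<in> {0..hit (X n)}
      then conformal_lie a (h (X n)) (Z (X n) \<tau>) / X n else 0 else 0)" for n \<tau>
  define l where "l \<tau> = (if \<tau> \<in> {0<..<hit 0} then conformal_lie a d (Z 0 \<tau>) else 0)" for \<tau>
  have neg: "negligible {\<tau> \<in> {0..T} - S. k \<tau> \<noteq> 0}" "negligible {\<tau> \<in> S - {0..T}. k \<tau> \<noteq> 0}" for k :: "real \<Rightarrow> real"
    by (rule negligible_subset[of "{0, hit 0}"]; auto simp: S_def)+
  have int: "(f n has_integral (if tame C (X n) then 2 * a t0 * (r (X n) - r 0) / X n else 0)) S" for n
  proof (cases "tame C (X n)")
    case True
    then have good: "good (X n)" by (simp add: tame_def)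
    \<comment> \<open>The 2 undoes the half in the pairing derivative. Together with
      \<open>a t0\<close> from the boundary term it is the source of
      \<open>1 / (2 * a t0)\<close>.\<close>
    have "((\<lambda>\<tau>. 2 / X n * (conformal_lie a (h (X n)) (Z (X n) \<tau>) / 2)) has_integral
        2 / X n * (a t0 * (r (X n) + 1) - a t1)) {0..hit (X n)}"
      unfolding r_def by (rule has_integral_mult_right[OF redshift_integral[OF good]])
    also have "a t0 * (r (X n) + 1) - a t1 = a t0 * (r (X n) - r 0)"
      using redshift_0 by (simp add: r_def algebra_simps)
    finally have "((\<lambda>\<tau>. conformal_lie a (h (X n)) (Z (X n) \<tau>) / X n) has_integral
        2 * a t0 * (r (X n) - r 0) / X n) {0..hit (X n)}" by (simp add: mult.assoc)
    moreover have sub: "{0..hit (X n)} \<subseteq> {0..T}" using hit(2)[OF good] by auto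
    moreover have "f n = (\<lambda>\<tau>. if \<tau> \<in> {0..hit (X n)} then conformal_lie a (h (X n)) (Z (X n) \<tau>) / X n else 0)"
      by (rule ext) (simp only: f_def True if_True)
    ultimately have "(f n has_integral 2 * a t0 * (r (X n) - r 0) / X n) {0..T}"
      by (simp only: has_integral_restrict[OF sub])
    then show ?thesis using True has_integral_spike_set_eq[OF neg] by simp
  next
    case False
    then have "f n = (\<lambda>\<tau>. 0)" by (intro ext) (simp add: f_def)
    then show ?thesis using False by (simp add: has_integral_0)
  qed
  have lim: "(\<lambda>n. integral S (f n)) \<longlonglongrightarrow> integral S l"
  proof (rule dominated_convergence(2))
    show "f n integrable_on S" for n using int by blast
    have "(\<lambda>_. lie_const R M * C) integrable_on {0..T}" by (intro integrable_continuous_real continuous_on_const)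
    then show "(\<lambda>_. lie_const R M * C) integrable_on S"
      using has_integral_spike_set_eq[OF neg] unfolding integrable_on_def by blast
    show "norm (f n \<tau>) \<le> lie_const R M * C" for n \<tau>
      using tame_integrand_bound[OF b, of C "X n" \<tau>] C(1) lie_const_nonneg[OF b] by (auto simp: f_def)
    fix \<tau> assume \<tau>: "\<tau> \<in> S"
    then have \<tau>T: "\<tau> \<in> {0..T}" "\<tau> \<noteq> 0" "\<tau> \<noteq> hit 0" by (auto simp: S_def)
    have Zlim: "(\<lambda>n. fst (fst (Z (X n) \<tau>))) \<longlonglongrightarrow> fst (fst (Z 0 \<tau>))"
    proof (rule tendstoI)
      fix e :: real assume "e > 0"
      then have "e / 2 > 0" by simp
      from eventually_good[OF this]
      have "\<forall>\<^sub>F n in sequentially. good (X n) \<and> (\<forall>\<tau>\<in>{0..T}. norm (Z (X n) \<tau> - Z 0 \<tau>) \<le> e / 2)"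
        using XF unfolding filterlim_iff by blast
      then show "\<forall>\<^sub>F n in sequentially. dist (fst (fst (Z (X n) \<tau>))) (fst (fst (Z 0 \<tau>))) < e"
      proof eventually_elim
        case (elim n)
        then have "norm (Z (X n) \<tau> - Z 0 \<tau>) \<le> e / 2" using \<tau>T by blast
        then show ?case using \<open>e > 0\<close> fst_fst_diff_le[of "Z (X n) \<tau>" "Z 0 \<tau>"] by (simp add: dist_real_def)
      qed
    qed
    show "(\<lambda>n. f n \<tau>) \<longlonglongrightarrow> l \<tau>"
    proof (cases "\<tau> < hit 0")
      case True
      have "t0 < fst (fst (Z 0 \<tau>))" using good_time_iff(1)[OF good_0 \<tau>T(1)] True by simp
      then have "\<forall>\<^sub>F n in sequentially. t0 < fst (fst (Z (X n) \<tau>))" by (rule order_tendstoD(1)[OF Zlim])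
      with ev have "\<forall>\<^sub>F n in sequentially. conformal_lie a (h (X n)) (Z (X n) \<tau>) / X n = f n \<tau>"
      proof eventually_elim
        case (elim n)
        then have "\<tau> < hit (X n)" using good_time_iff(1)[of "X n" \<tau>] \<tau>T(1) by (simp add: tame_def)
        then show ?case using elim \<tau>T(1) by (simp add: f_def)
      qed
      moreover have "(\<lambda>n. conformal_lie a (h (X n)) (Z (X n) \<tau>) / X n) \<longlonglongrightarrow> conformal_lie a d (Z 0 \<tau>)"
        using filterlim_compose[OF integrand_tendsto[OF _ True] XF] \<tau>T(1) by simp
      ultimately have "(\<lambda>n. f n \<tau>) \<longlonglongrightarrow> conformal_lie a d (Z 0 \<tau>)" by (rule Lim_transform_eventually[rotated])
      then show ?thesis using True \<tau>T by (simp add: l_def)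
    next
      case False
      then have gt: "hit 0 < \<tau>" using \<tau>T by simp
      then have "fst (fst (Z 0 \<tau>)) < t0" using good_time_iff(2)[OF good_0 \<tau>T(1)] by simp
      then have "\<forall>\<^sub>F n in sequentially. fst (fst (Z (X n) \<tau>)) < t0" by (rule order_tendstoD(2)[OF Zlim])
      with ev have "\<forall>\<^sub>F n in sequentially. f n \<tau> = l \<tau>"
      proof eventually_elim
        case (elim n)
        then have "hit (X n) < \<tau>" using good_time_iff(2)[of "X n" \<tau>] \<tau>T(1) by (simp add: tame_def)
        then show ?case using gt by (simp add: f_def l_def)
      qed
      then show ?thesis by (rule tendsto_eventually)
    qed
  qed
  have "((\<lambda>\<tau>. conformal_lie a d (Z 0 \<tau>)) has_integral limit_integral) {0<..<hit 0}"
    unfolding limit_integral_def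
    using set_borel_integral_eq_integral(1)[OF limit_integrand_set_integrable] by (rule integrable_integral)
  moreover have sub: "{0<..<hit 0} \<subseteq> S" using hit(2)[OF good_0] by (auto simp: S_def)
  moreover have "l = (\<lambda>\<tau>. if \<tau> \<in> {0<..<hit 0} then conformal_lie a d (Z 0 \<tau>) else 0)"
    by (rule ext) (simp only: l_def)
  ultimately have "(l has_integral limit_integral) S" by (simp only: has_integral_restrict[OF sub])
  then have li: "integral S l = limit_integral" by (rule integral_unique)
  have "(\<lambda>n. 1 / (2 * a t0) * integral S (f n)) \<longlonglongrightarrow> 1 / (2 * a t0) * limit_integral"
    using tendsto_mult_left[OF lim] unfolding li .
  moreover from ev have "\<forall>\<^sub>F n in sequentially. 1 / (2 * a t0) * integral S (f n) = (r (X n) - r 0) / (X n - 0)"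
  proof eventually_elim
    case (elim n)
    then have "integral S (f n) = 2 * a t0 * (r (X n) - r 0) / X n" using int[of n] by (auto dest: integral_unique)
    then show ?case using a_t0 by simp
  qed
  ultimately have "(\<lambda>n. (r (X n) - r 0) / (X n - 0)) \<longlonglongrightarrow> 1 / (2 * a t0) * limit_integral"
    by (rule Lim_transform_eventually)
  then show "((\<lambda>s. (redshift a t0 t1 (g s) y v - redshift a t0 t1 (g 0) y v) / (s - 0)) \<circ> X)
      \<longlonglongrightarrow> 1 / (2 * a t0) * limit_integral" by (simp add: o_def r_def)
qed

section \<open>Identification with the light ray transform\<close>

abbreviation ray_tensor :: tensor2 where
  "ray_tensor \<equiv> scale_field (\<lambda>x. (a (fst x))\<^sup>2)
     (lie_deriv (a_dt a) (scale_field (\<lambda>x. inverse ((a (fst x))\<^sup>2)) (first_variation g t0 t1)))"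

text \<open>Uniform closeness of the difference quotients contains the pointwise derivative of each
  component; bilinearity extends it to \<open>u\<close> and \<open>w\<close>, and uniqueness of the
  one-sided derivative evaluates \<open>vector_derivative\<close>.\<close>

lemma first_variation_eq:
  assumes x: "t0 < fst x" "fst x < t1"
  shows "first_variation g t0 t1 x u w = d x u w"
proof -
  have af: "x \<in> after t0" using x by (simp add: after_def)
  have sp: "x \<in> spacetime" using af after_subset by blast
  have dsb: "sym_bilinear (d x)" using d_C1 af by (simp add: C1_sym2_def)
  have gsb: "sym_bilinear (g \<epsilon> x)" if "\<epsilon> \<in> {0..1}" for \<epsilon>
    by (rule regular_metric_sym[OF g_regular[OF that] sp])
  have comp: "((\<lambda>\<epsilon>. g \<epsilon> x l m) has_real_derivative d x l m) (at 0 within {0..1})"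
    if lm: "l \<in> Basis" "m \<in> Basis" for l m
    unfolding has_field_derivative_iff
  proof (rule tendstoI)
    fix e :: real assume "e > 0"
    then have "e / 2 > 0" by simp
    from d_approx[OF this]
    show "\<forall>\<^sub>F \<epsilon> in at 0 within {0..1}. dist ((g \<epsilon> x l m - g 0 x l m) / (\<epsilon> - 0)) (d x l m) < e"
    proof eventually_elim
      case (elim \<epsilon>)
      then have "\<bar>(g \<epsilon> x l m - g 0 x l m) / \<epsilon> - d x l m\<bar> \<le> e / 2"
        using af lm unfolding C1_diff_quotient_close_def by blast
      then show ?case using \<open>e > 0\<close> by (simp add: dist_real_def)
    qed
  qed
  have "((\<lambda>\<epsilon>. \<Sum>i\<in>Basis. \<Sum>j\<in>Basis. (u \<bullet> i) * (w \<bullet> j) * g \<epsilon> x i j) has_real_derivative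
      (\<Sum>i\<in>Basis. \<Sum>j\<in>Basis. (u \<bullet> i) * (w \<bullet> j) * d x i j)) (at 0 within {0..1})"
    by (intro DERIV_sum DERIV_cmult comp)
  then have "((\<lambda>\<epsilon>. g \<epsilon> x u w) has_real_derivative d x u w) (at 0 within {0..1})"
    unfolding sym_bilinear_expand[OF dsb, of u w, symmetric]
    by (rule has_field_derivative_transform_within[of _ _ _ _ 1])
      (use sym_bilinear_expand[OF gsb, of _ u w] in auto)
  then show ?thesis
    using x vector_derivative_within_closed_interval[of 0 1 0 "\<lambda>\<epsilon>. g \<epsilon> x u w" "d x u w"]
    by (simp add: first_variation_def has_real_derivative_iff_has_vector_derivative)
qed

lemma a_dt_derivative:
  assumes "0 < fst x"
  shows "frechet_derivative (a_dt a) (at x) u = (deriv a (fst x) * fst u, 0)"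
proof -
  have "((\<lambda>x. a (fst x)) has_derivative (\<lambda>v. deriv a (fst x) * fst v)) (at x)"
    using has_derivative_compose[OF has_derivative_fst[OF has_derivative_ident]
        smooth_on_pos_derivs(1)[OF a_smooth assms, unfolded has_field_derivative_def]]
    by (simp add: o_def)
  then have "((\<lambda>x. (a (fst x), 0::real^3)) has_derivative (\<lambda>v. (deriv a (fst x) * fst v, 0))) (at x)"
    by (intro has_derivative_Pair has_derivative_const)
  moreover have "(\<lambda>x. (a (fst x), 0::real^3)) = a_dt a" by (rule ext) (simp add: a_dt_def)
  ultimately show ?thesis by (metis frechet_derivative_at)
qed

text \<open>For \<open>X = a \<partial>\<^sub>t\<close>, differentiating
  \<open>a\<^sup>-\<^sup>2\<close> along \<open>X\<close> and multiplying by
  \<open>a\<^sup>2\<close> yields the term \<open>- 2 a' d(u, u)\<close>. The two terms with the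
  derivative of \<open>X\<close> coincide by symmetry and make up
  \<open>2 a' u\<^sup>t d(u, \<partial>\<^sub>t)\<close>.\<close>

lemma ray_tensor_inside:
  assumes x: "t0 < fst x" "fst x < t1"
  shows "ray_tensor x u u = conformal_lie a d (x, u)"
proof -
  have af: "x \<in> after t0" using x by (simp add: after_def)
  have fx: "0 < fst x" using x t0_pos by simp
  have ax: "a (fst x) > 0" by (rule a_pos[OF fx])
  define A where "A = a (fst x)"
  define A' where "A' = deriv a (fst x)"
  have dsb: "sym_bilinear (d x)" using d_C1 af by (simp add: C1_sym2_def)
  have sc: "(r, 0) = r *\<^sub>R (1, 0 :: real^3)" for r by simp
  have "((\<lambda>t. inverse ((a t)\<^sup>2)) has_real_derivative - 2 * A' / A ^ 3) (at (fst x))"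
    using ax unfolding A_def A'_def
    by (auto intro!: derivative_eq_intros smooth_on_pos_derivs(1)[OF a_smooth fx]
        simp: field_simps power2_eq_square power3_eq_cube)
  then have di: "((\<lambda>z. inverse ((a (fst z))\<^sup>2)) has_derivative (\<lambda>v. - 2 * A' / A ^ 3 * fst v)) (at x)"
    unfolding has_field_derivative_def
    by (rule has_derivative_compose[OF has_derivative_fst[OF has_derivative_ident]])
  have dd: "((\<lambda>z. d z u u) has_derivative (\<lambda>v. pd v (\<lambda>z. d z u u) x)) (at x)"
    by (rule has_derivative_pd[OF C1_sym2_differentiable[OF d_C1 open_after af]])
  \<comment> \<open>\<open>first_variation\<close> is known to equal \<open>d\<close> only between
    the two times, and \<open>pd_cong\<close> needs an open set of agreement.\<close>
  define slab where "slab = {z::event. t0 < fst z} \<inter> {z. fst z < t1}"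
  have slab: "open slab" "x \<in> slab"
    using x by (auto simp: slab_def intro!: open_Int open_Collect_less continuous_intros)
  have "pd (A, 0) (\<lambda>z. inverse ((a (fst z))\<^sup>2) * first_variation g t0 t1 z u u) x
      = pd (A, 0) (\<lambda>z. inverse ((a (fst z))\<^sup>2) * d z u u) x"
    by (rule pd_cong[OF slab]) (simp add: slab_def first_variation_eq)
  also have "\<dots> = inverse (A\<^sup>2) * pd (A, 0) (\<lambda>z. d z u u) x + - 2 * A' / A ^ 3 * A * d x u u"
    using pd_eqI[OF has_derivative_mult[OF di dd], of "(A, 0)"] by (simp add: A_def)
  also have "pd (A, 0) (\<lambda>z. d z u u) x = A * pd (1, 0) (\<lambda>z. d z u u) x"
    using linear_cmul[OF pd_C1_sym2_linear(1)[OF d_C1 open_after af], of A "(1, 0)" u u] by simp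
  finally have 1: "pd (A, 0) (\<lambda>z. inverse ((a (fst z))\<^sup>2) * first_variation g t0 t1 z u u) x
      = inverse (A\<^sup>2) * (A * pd (1, 0) (\<lambda>z. d z u u) x) + - 2 * A' / A ^ 3 * A * d x u u" .
  have 2: "d x (A' * fst u, 0) u = A' * fst u * d x u (1, 0)" "d x u (A' * fst u, 0) = A' * fst u * d x u (1, 0)"
    unfolding sc[of "A' * fst u"] sym_bilinear_simps[OF dsb] sym_bilinear_commute[OF dsb, of "(1, 0)" u] by simp_all
  show ?thesis
    unfolding scale_field_def lie_deriv_def a_dt_derivative[OF fx] first_variation_eq[OF x] A'_def[symmetric] 2
    using ax 1
    by (simp add: a_dt_def conformal_lie_def flip: A_def A'_def)
      (simp add: field_simps power2_eq_square power3_eq_cube)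
qed

text \<open>Away from \<open>t0\<close> and \<open>t1\<close> the cut-off field vanishes on an open
  neighbourhood, so its derivative does too. At these two times it may fail to be differentiable and
  no value is claimed.\<close>

lemma ray_tensor_outside:
  assumes x: "0 < fst x" "fst x < t0 \<or> t1 < fst x"
  shows "ray_tensor x u u = 0"
proof -
  define S where "S = (if fst x < t0 then {z::event. fst z < t0} else {z. t1 < fst z})"
  have S: "open S" "x \<in> S"
    using x by (auto simp: S_def intro!: open_Collect_less continuous_intros)
  have "first_variation g t0 t1 z u w = 0" if "z \<in> S" for z u w
    using that t0_less_t1 by (auto simp: S_def first_variation_def split: if_splits)
  then have "pd v (\<lambda>z. inverse ((a (fst z))\<^sup>2) * first_variation g t0 t1 z u u) x = pd v (\<lambda>z. 0) x"
      and "first_variation g t0 t1 x u w = 0" for v u w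
    using S pd_cong[OF S, of "\<lambda>z. inverse ((a (fst z))\<^sup>2) * first_variation g t0 t1 z u u" "\<lambda>z. 0" v] by auto
  moreover have "pd v (\<lambda>z. 0) x = 0" for v by (rule pd_eqI[OF has_derivative_const])
  ultimately show ?thesis by (simp add: scale_field_def lie_deriv_def)
qed

lemma background_geodesics:
  "geod_dom (flrw a) x0 \<theta> = D 0" "geod (flrw a) x0 \<theta> \<tau> = fst (Z 0 \<tau>)" "geod_vel (flrw a) x0 \<theta> \<tau> = snd (Z 0 \<tau>)"
proof -
  have *: "geodesic_on (flrw a) x0 \<theta> J \<gamma> \<longleftrightarrow> geodesic_on (g 0) x0 \<theta> J \<gamma>" for J \<gamma>
    by (rule geodesic_on_cong) (simp add: g_zero)
  show "geod_dom (flrw a) x0 \<theta> = D 0" by (simp add: D_def geod_dom_def *)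
  have "geod (flrw a) x0 \<theta> = geod (g 0) x0 \<theta>" by (rule ext) (simp add: geod_def *)
  then show "geod (flrw a) x0 \<theta> \<tau> = fst (Z 0 \<tau>)" "geod_vel (flrw a) x0 \<theta> \<tau> = snd (Z 0 \<tau>)"
    by (simp_all add: Z_def geod_phase_def geod_vel_def)
qed

text \<open>Time decreases strictly along the background ray, so negative parameters lie above
  \<open>t1\<close> and those beyond \<open>hit 0\<close> lie below \<open>t0\<close>. Only the open
  interval between contributes; its endpoints form a null set.\<close>

lemma light_ray_transform_eq: "light_ray_transform a t1 ray_tensor y v = limit_integral"
proof -
  have 0: "(0::real) \<in> {0..1}" by simp
  define F where "F \<tau> = ray_tensor (fst (Z 0 \<tau>)) (snd (Z 0 \<tau>)) (snd (Z 0 \<tau>))" for \<tau>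
  define c where "c \<tau> = conformal_lie a d (Z 0 \<tau>)" for \<tau>
  have "light_ray_transform a t1 ray_tensor y v = (LINT \<tau>:D 0|lborel. F \<tau>)"
    using background_geodesics unfolding light_ray_transform_def Let_def F_def x0_def \<theta>_def by simp
  also have "\<dots> = (LINT \<tau>:{0<..<hit 0}|lborel. c \<tau>)"
  proof -
    \<comment> \<open>The two singleton terms carry the unknown values at times \<open>t1\<close>
      and \<open>t0\<close>. Written this way the integrand is visibly measurable and almost
      everywhere equal to the restricted one.\<close>
    have split: "indicator (D 0) \<tau> *\<^sub>R F \<tau> = indicator {0<..<hit 0} \<tau> *\<^sub>R c \<tau>
        + (indicator {0} \<tau> * F 0 + indicator {hit 0} \<tau> * F (hit 0))" for \<tau>
    proof (cases "\<tau> \<in> D 0")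
      case True
      have sp: "0 < fst (fst (Z 0 \<tau>))" using Z_facts(1)[OF 0 True] by (simp add: spacetime_def)
      have neg: "fst (snd (Z 0 s)) < 0" if "s \<in> D 0" for s by (rule ray0_velocity[OF that])
      have ivl: "{p..q} \<subseteq> D 0" if "p \<in> D 0" "q \<in> D 0" for p q
        using mem_is_interval_1_I[OF Z_facts(5)[OF 0 True] that] by auto
      have dec: "fst (fst (Z 0 q)) < fst (fst (Z 0 p))" if "p \<in> D 0" "q \<in> D 0" "p < q" for p q
        using time_decreasing[OF 0 ivl[OF that(1,2)] that(3)] neg ivl[OF that(1,2)] by blast
      have D0: "0 \<in> D 0" by (rule Z_facts(6)[OF 0 True])
      have Z0: "fst (fst (Z 0 0)) = t1" using Z_facts(4)[OF 0 True] by (simp add: x0_def)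
      note hh = hit[OF good_0]
      have Dh: "hit 0 \<in> D 0" using T_dom hh by auto
      consider "\<tau> < 0" | "\<tau> = 0" | "0 < \<tau>" "\<tau> < hit 0" | "\<tau> = hit 0" | "hit 0 < \<tau>" by linarith
      then show ?thesis
      proof cases
        case 1
        then have "t1 < fst (fst (Z 0 \<tau>))" using dec[OF True D0] Z0 by simp
        then have "F \<tau> = 0" unfolding F_def by (intro ray_tensor_outside sp) simp
        then show ?thesis using 1 hh by simp
      next
        case 2
        then show ?thesis using True hh by simp
      next
        case 3
        then have "t0 < fst (fst (Z 0 \<tau>))" "fst (fst (Z 0 \<tau>)) < t1"
          using dec[OF D0 True] dec[OF True Dh] Z0 hh by simp_all
        then have "F \<tau> = c \<tau>" unfolding F_def c_def by (simp add: ray_tensor_inside)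
        then show ?thesis using 3 True by simp
      next
        case 4
        then show ?thesis using True hh by simp
      next
        case 5
        then have "fst (fst (Z 0 \<tau>)) < t0" using dec[OF Dh True] hh by simp
        then have "F \<tau> = 0" unfolding F_def by (intro ray_tensor_outside sp) simp
        then show ?thesis using 5 hh by simp
      qed
    next
      case False
      have "{0..hit 0} \<subseteq> D 0" using T_dom hit(2)[OF good_0] by auto
      then have "\<tau> \<notin> {0..hit 0}" using False by blast
      then show ?thesis using False hit(1)[OF good_0] by (auto simp: indicator_def)
    qed
    have m: "(\<lambda>\<tau>. indicator {0<..<hit 0} \<tau> *\<^sub>R c \<tau>) \<in> borel_measurable lborel"
      using limit_integrand_set_integrable unfolding set_integrable_def c_def by (rule borel_measurable_integrable)
    show ?thesis
      unfolding set_lebesgue_integral_def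
    proof (rule integral_cong_AE[OF _ m])
      show "(\<lambda>\<tau>. indicator (D 0) \<tau> *\<^sub>R F \<tau>) \<in> borel_measurable lborel"
        unfolding split using m by (intro borel_measurable_add) auto
      show "AE \<tau> in lborel. indicator (D 0) \<tau> *\<^sub>R F \<tau> = indicator {0<..<hit 0} \<tau> *\<^sub>R c \<tau>"
        unfolding split using AE_lborel_singleton[of 0] AE_lborel_singleton[of "hit 0"]
        by eventually_elim simp
    qed
  qed
  also have "\<dots> = limit_integral"
    unfolding limit_integral_def c_def
    by (rule set_borel_integral_eq_integral(2)[OF limit_integrand_set_integrable])
  finally show ?thesis .
qed

end

theorem theorem4p2:
  fixes a :: "real \<Rightarrow> real"
    and t0 t1 :: real
    and U1 :: "(real^3) set"
    and g :: "real \<Rightarrow> tensor2"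
  assumes a_pos: "\<And>t. 0 < t \<Longrightarrow> 0 < a t"
    and a_smooth: "smooth_on_pos a"
    and t0_pos: "0 < t0"
    and t0_less_t1: "t0 < t1"
    and U1_open: "open U1"
    and U1_bounded: "bounded U1"
    and g_C2: "\<And>\<epsilon>. \<epsilon> \<in> {0..1} \<Longrightarrow> g \<epsilon> \<in> C2_sym2 spacetime"
    and g_lorentzian: "\<And>\<epsilon>. \<epsilon> \<in> {0..1} \<Longrightarrow> lorentzian_on spacetime (g \<epsilon>)"
    and g_zero: "\<And>x. x \<in> spacetime \<Longrightarrow> g 0 x = flrw a x"
    and g_differentiable: "C2b_differentiable_on g (after t0) {0..1}"
    and g_agrees: "\<And>\<epsilon> x. \<epsilon> \<in> {0..1} \<Longrightarrow>
          x \<in> ({t1} \<times> U1) \<union> time_slice t0 \<union> (spacetime - after t0) \<Longrightarrow> g \<epsilon> x = flrw a x"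
  shows "\<forall>y\<in>U1. \<forall>v\<in>sphere 0 1.
     ((\<lambda>\<epsilon>. redshift a t0 t1 (g \<epsilon>) y v) has_real_derivative
        1 / (2 * a t0) *
        light_ray_transform a t1
          (scale_field (\<lambda>x. (a (fst x))\<^sup>2)
            (lie_deriv (a_dt a)
              (scale_field (\<lambda>x. inverse ((a (fst x))\<^sup>2))
                (first_variation g t0 t1)))) y v)
     (at 0 within {0..1})"
proof (intro ballI)
  fix y v :: "real^3" assume y: "y \<in> U1" and v: "v \<in> sphere 0 1"
  interpret redshift_setting a t0 t1 U1 g y v
  proof
    show "regular_metric (g \<epsilon>)" if "\<epsilon> \<in> {0..1}" for \<epsilon>
      using g_C2[OF that] g_lorentzian[OF that] by (simp add: regular_metric_def)
    show "norm v = 1" using v by simp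
  qed (fact assms y)+
  show "((\<lambda>\<epsilon>. redshift a t0 t1 (g \<epsilon>) y v) has_real_derivative
        1 / (2 * a t0) * light_ray_transform a t1 ray_tensor y v) (at 0 within {0..1})"
    unfolding light_ray_transform_eq by (rule redshift_derivative)
qed

end
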